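(* Let $n, m \in \mathbb{N}$ with $m \leq n$ and let $k_1,\ldots,k_m \in \mathbb{N}$ be such that $0 < k_1 < \ldots < k_m \leq n$. Let $(a_i)_{i=1}^m, (b_i)_{i=1}^m \subseteq \mathbb{R} \cup \{\pm\infty\}$ be such that for all $i \in \{1,\ldots,m\}$, $a_i \leq b_i$, $a_i \neq \infty$ and $b_i \neq -\infty$. Set $$K:=\left\{ \sum_{i=0}^n c_iX^i \in P_n \;\middle|\; \text{for all }i \in \{1,\ldots,m\},\ a_i \leq c_{k_i} \leq b_i\right\}.$$ Let $p_0 \in K$. Let $f: [0,1] \to \mathbb{R}$ and let $\omega : (0, \infty) \to (0,\infty)$ be a modulus of uniform continuity for $f$. Set $M:=\frac52\|f\| + \frac32\|p_0\|$ and $$E:=\min_{q \in K} \|f-q\|.$$ Let $\delta \geq 0$, $L \in (0,E]$ and $p_1, p_2 \in K$ be such that for each $i \in \{1,2\}$, $$\|f-p_i\| \leq E + \frac{\left(\frac{\chi_{\omega,n,M}\left(\frac{L}2\right)}2\right)^{\frac{n^2}2+2n}}{10 \cdot N_n^2\,(n+1)(nF_n+1)}\cdot\delta.$$ Then $\|p_1 - p_2\| \leq \delta$.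
   Context: $\mathbb{N}$ includes $0$, and the convention $0^0=1$ is used. $P_n$ is the set of real polynomials of degree at most $n$, and $\|\cdot\|$ is the supremum norm on $[0,1]$. A modulus of uniform continuity for $f:[0,1]\to\mathbb{R}$ is a function $\omega:(0,\infty)\to(0,\infty)$ such that for any $\varepsilon>0$ and any $x,y\in[0,1]$ with $|x-y|<\omega(\varepsilon)$ one has $|f(x)-f(y)|<\varepsilon$. For $\omega:(0,\infty)\to(0,\infty)$, $n\in\mathbb{N}$, $M\geq 0$ and $\varepsilon>0$, $$\chi_{\omega,n,M}(\varepsilon):=\min\left(1,\frac{\varepsilon}{4n^2M+1},\omega\left(\frac{\varepsilon}{2}\right)\right).$$ For $n\in\mathbb{N}$, $F_n:=\frac32\max_{i\in\{0,\ldots,n\}}\frac{(2n^2)^i}{i!}$. For a strictly decreasing sequence $h=(h_1>\ldots>h_{r+1})$ of natural numbers, put $\lambda^h_i:=h_i+i-r-1$ for $1\leq i\leq r+1$ (a weakly decreasing sequence of natural numbers). For a weakly decreasing sequence $\lambda=(\lambda_1\geq\ldots\geq\lambda_{r+1})$ of natural numbers put $N_\lambda:=\prod_{1\leq i<j\leq r+1}\frac{\lambda_i-\lambda_j+j-i}{j-i}$. For $n\in\mathbb{N}$, $N_n$ is the maximum of $N_{\lambda^h}$ over all (finitely many) nonempty strictly decreasing sequences $h$ of natural numbers of length at most $n+1$ with $h_1\leq n$. *)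

theory Defs
  imports "HOL-Analysis.Analysis" "HOL-Computational_Algebra.Polynomial"
begin

text \<open>Supremum norm on \<open>[0,1]\<close>; a function \<open>[0,1] \<rightarrow> \<real>\<close> is represented by a total function,
  only whose values on \<open>{0..1}\<close> matter.\<close>

definition supnorm :: "(real \<Rightarrow> real) \<Rightarrow> real" where
  "supnorm f = (SUP x\<in>{0..1}. \<bar>f x\<bar>)"

text \<open>Only the values of \<open>\<omega>\<close> on positive arguments matter.\<close>

definition modulus_of_uniform_continuity :: "(real \<Rightarrow> real) \<Rightarrow> (real \<Rightarrow> real) \<Rightarrow> bool" where
  "modulus_of_uniform_continuity \<omega> f \<longleftrightarrow>
     (\<forall>\<epsilon>>0. \<omega> \<epsilon> > 0) \<and>
     (\<forall>\<epsilon>>0. \<forall>x\<in>{0..1}. \<forall>y\<in>{0..1}. \<bar>x - y\<bar> < \<omega> \<epsilon> \<longrightarrow> \<bar>f x - f y\<bar> < \<epsilon>)"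

definition chi :: "(real \<Rightarrow> real) \<Rightarrow> nat \<Rightarrow> real \<Rightarrow> real \<Rightarrow> real" where
  "chi \<omega> n M \<epsilon> = Min {1, \<epsilon> / (4 * (real n)\<^sup>2 * M + 1), \<omega> (\<epsilon> / 2)}"

definition F_const :: "nat \<Rightarrow> real" where
  "F_const n = 3 / 2 * Max ((\<lambda>i. (2 * (real n)\<^sup>2) ^ i / fact i) ` {0..n})"

text \<open>Sequences \<open>(h\<^sub>1, \<dots>, h\<^sub>r\<^sub>+\<^sub>1)\<close> are lists of length \<open>r + 1\<close>, so the entry \<open>h\<^sub>i\<close> is \<open>h ! (i - 1)\<close>.
  For strictly decreasing \<open>h\<close> the subtraction below does not truncate.\<close>

definition lambda_seq :: "nat list \<Rightarrow> nat list" where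
  "lambda_seq h = map (\<lambda>i. h ! i + Suc i - length h) [0..<length h]"

definition N_seq :: "nat list \<Rightarrow> real" where
  "N_seq l = (\<Prod>(i, j) \<in> {(i, j). i < j \<and> j < length l}.
      (real (l ! i) - real (l ! j) + real j - real i) / (real j - real i))"

definition N_index :: "nat \<Rightarrow> nat list set" where
  "N_index n = {h. h \<noteq> [] \<and> sorted_wrt (>) h \<and> length h \<le> n + 1 \<and> hd h \<le> n}"

definition N_const :: "nat \<Rightarrow> real" where
  "N_const n = Max ((\<lambda>h. N_seq (lambda_seq h)) ` N_index n)"

lemma finite_N_index: "finite (N_index n)"
proof (rule finite_subset)
  show "N_index n \<subseteq> {h. set h \<subseteq> {..n} \<and> length h \<le> n + 1}"
  proof
    fix h assume h: "h \<in> N_index n"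
    then obtain x xs where "h = x # xs" by (cases h) (auto simp: N_index_def)
    with h show "h \<in> {h. set h \<subseteq> {..n} \<and> length h \<le> n + 1}"
      by (force simp: N_index_def)
  qed
  show "finite {h. set h \<subseteq> {..n} \<and> length h \<le> n + 1}"
    by (rule finite_lists_length_le) simp
qed

lemma N_index_nonempty: "N_index n \<noteq> {}"
proof -
  have "[0] \<in> N_index n" by (simp add: N_index_def)
  then show ?thesis by blast
qed

lemma lambda_seq_no_truncation:
  assumes "sorted_wrt (>) h" "i < length h"
  shows "length h \<le> h ! i + Suc i"
  using assms
proof (induction h arbitrary: i)
  case (Cons x xs)
  show ?case
  proof (cases i)
    case 0
    show ?thesis
    proof (cases xs)
      case (Cons y ys)
      then show ?thesis using Cons.IH[of 0] Cons.prems 0 by auto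
    qed (use 0 in simp)
  qed (use Cons in auto)
qed simp

definition constrained_polys ::
  "nat \<Rightarrow> nat \<Rightarrow> (nat \<Rightarrow> nat) \<Rightarrow> (nat \<Rightarrow> ereal) \<Rightarrow> (nat \<Rightarrow> ereal) \<Rightarrow> real poly set" where
  "constrained_polys n m k a b =
     {p. degree p \<le> n \<and>
         (\<forall>i\<in>{1..m}. a i \<le> ereal (coeff p (k i)) \<and> ereal (coeff p (k i)) \<le> b i)}"

end

theory Submission
  imports Defs "Jordan_Normal_Form.Determinant"
begin

text \<open>
  The statement is a strong unicity theorem with an explicit constant. If \<open>p\<close> is a best
  approximation to \<open>f\<close> from \<open>K\<close>, then every \<open>q \<in> K\<close> with error at most
  \<open>E + \<eta>\<close> lies within a multiple of \<open>\<eta>\<close> of \<open>p\<close>; applied to \<open>p1\<close> and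
  \<open>p2\<close>, this bounds their distance by twice that multiple.

  Optimality of \<open>p\<close> has a dual certificate. There are extremal points \<open>z \<in> Z\<close> of
  \<open>f - p\<close> with error signs \<open>\<sigma> z\<close> and positive weights \<open>\<theta> z\<close> such that the
  functional \<open>q \<mapsto> (\<Sum>z\<in>Z. \<theta> z * \<sigma> z * poly q z)\<close> is a combination of those
  coefficients of \<open>q\<close> whose bounds are attained by \<open>p\<close>, with signs that the bounds dictate.
  For \<open>q - p\<close> with \<open>q \<in> K\<close> nearly optimal, all terms of this balance are bounded
  below by a multiple of \<open>\<eta>\<close> and they cancel, hence all of them are small: \<open>q - p\<close> is
  small on \<open>Z\<close>, and so are its coefficients that take part in the balance.

  To turn this into a bound on \<open>q - p\<close>, choose a certificate of minimal support
  (\<open>minimal_certificate\<close>). If \<open>H\<close> is the set of exponents that do not take part in the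
  balance, then \<open>Z\<close> has exactly \<open>card H + 1\<close> points, and the weights are forced: up to a
  common factor they are the alternants \<open>det (z ^ h)\<close> over \<open>H\<close> and all points but one.
  An alternant is a Vandermonde product times a Schur polynomial
  (\<open>alternant_eq_vandermonde_schur\<close>). Schur polynomials have nonnegative coefficients, so on
  \<open>[0, 1]\<close> they are bounded above by their value at \<open>(1, \<dots>, 1)\<close>, which the Weyl
  dimension formula identifies with \<open>N_\<lambda>\<close> (\<open>schur_ones\<close>), and below by any of
  their monomials (\<open>set_schur_lower_bound\<close>). The weights alternate in sign along \<open>Z\<close>,
  so the error jumps by twice its maximum between neighbours; since \<open>p\<close> cannot vary quickly by
  Markov's inequality and \<open>f\<close> cannot by its modulus, neighbours are at least
  \<open>chi \<omega> n M (L / 2) / 2\<close> apart. With this spacing, weights, Vandermonde products and Schur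
  polynomials are all bounded below, and interpolation at all points of \<open>Z\<close> but one, together
  with the coefficients outside \<open>H\<close>, bounds \<open>q - p\<close>
  (\<open>strong_unicity_from_certificate\<close>). For \<open>card H = r + 1\<close> the power of the spacing
  that is lost is about \<open>(r + 1) + 2 * r * (n - r)\<close>, and \<open>2 * r * (n - r) \<le> n\<^sup>2 / 2\<close>.

  The duality is carried out for best approximation on a finite grid, where it only concerns
  finitely many linear inequalities. The constant obtained does not depend on the grid, and the
  error of best approximation on the grid tends to \<open>E\<close> as the mesh shrinks
  (\<open>strong_unicity_perturbed\<close>).
\<close>

section \<open>Alternants and Schur polynomials\<close>

text \<open>The classical alternant of the powers \<open>h\<close>; rows belong to exponents and columns to points.\<close>

definition alternant :: "nat list \<Rightarrow> real list \<Rightarrow> real" where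
  "alternant h xs = Determinant.det (Matrix.mat (length h) (length xs) (\<lambda>(i, j). xs ! j ^ (h ! i)))"

text \<open>Schur polynomials, defined by the branching rule that splits off one variable: the inner
  sequences \<open>f\<close> interlace \<open>h\<close>. The sequence \<open>h\<close> is the partition shifted by the staircase,
  which is the form in which exponents of powers enter the alternant. The definition makes
  nonnegativity and monotonicity evident; symmetry is not, and comes from
  \<open>alternant_eq_vandermonde_schur\<close>.\<close>

primrec schur :: "real list \<Rightarrow> nat list \<Rightarrow> real" where
  "schur [] h = 1"
| "schur (z # xs) h = (\<Sum>f\<in>PiE {0..<length xs} (\<lambda>i. {h ! Suc i..<h ! i}).
     z ^ (h ! length xs) * (\<Prod>i=0..<length xs. z ^ (h ! i - 1 - f i)) * schur xs (map f [0..<length xs]))"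

primrec vandermonde_prod :: "real list \<Rightarrow> real" where
  "vandermonde_prod [] = 1"
| "vandermonde_prod (z # xs) = (\<Prod>x\<leftarrow>xs. z - x) * vandermonde_prod xs"

text \<open>As a function of the first point, the alternant is a polynomial whose exponents lie in \<open>h\<close> and
  whose coefficients are smaller alternants. This produces the polynomials with prescribed
  exponents and zeros below.\<close>

lemma alternant_laplace:
  assumes "length h = Suc (length xs)"
  shows "alternant h (y # xs) =
    (\<Sum>i<length h. (-1) ^ i * y ^ (h ! i) * alternant (take i h @ drop (Suc i) h) xs)"
proof -
  define n where "n = length xs"
  let ?A = "Matrix.mat (Suc n) (Suc n) (\<lambda>(i, j). (y # xs) ! j ^ (h ! i))"
  have "alternant h (y # xs) = Determinant.det ?A"
    using assms by (simp add: alternant_def n_def)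
  also have "\<dots> = (\<Sum>i<Suc n. ?A $$ (i, 0) * cofactor ?A i 0)"
    by (rule laplace_expansion_column) auto
  also have "\<dots> = (\<Sum>i<Suc n. (-1) ^ i * y ^ (h ! i) * alternant (take i h @ drop (Suc i) h) xs)"
  proof (rule sum.cong[OF refl])
    fix i assume i: "i \<in> {..<Suc n}"
    have "mat_delete ?A i 0 = Matrix.mat n n (\<lambda>(k, j). xs ! j ^ ((take i h @ drop (Suc i) h) ! k))"
      using i assms by (intro eq_matI) (auto simp: mat_delete_def nth_append n_def min_def)
    then show "?A $$ (i, 0) * cofactor ?A i 0
        = (-1) ^ i * y ^ (h ! i) * alternant (take i h @ drop (Suc i) h) xs"
      using i assms by (simp add: cofactor_def alternant_def n_def)
  qed
  finally show ?thesis using assms by (simp add: n_def)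
qed

lemma geometric_block:
  fixes x z :: real
  assumes "b \<le> a"
  shows "(x - z) * (\<Sum>m=b..<a. x ^ m * z ^ (a - 1 - m)) = x ^ a - z ^ (a - b) * x ^ b"
  using assms
proof (induction a rule: dec_induct)
  case (step a)
  have "(\<Sum>m=b..<Suc a. x ^ m * z ^ (Suc a - 1 - m)) = z * (\<Sum>m=b..<a. x ^ m * z ^ (a - 1 - m)) + x ^ a"
    using step by (simp add: sum_distrib_left, intro sum.cong refl)
      (simp add: mult.left_commute flip: power_Suc, metis Suc_diff_Suc)
  then have "(x - z) * (\<Sum>m=b..<Suc a. x ^ m * z ^ (Suc a - 1 - m))
      = z * ((x - z) * (\<Sum>m=b..<a. x ^ m * z ^ (a - 1 - m))) + (x - z) * x ^ a"
    by (simp only: distrib_left mult.left_commute)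
  also have "\<dots> = x ^ Suc a - z ^ (Suc a - b) * x ^ b"
    unfolding step.IH using step.hyps by (simp add: algebra_simps Suc_diff_le)
  finally show ?case .
qed simp

text \<open>Subtract from each row a multiple of the next one so that the column of \<open>z\<close> vanishes except
  in the last row. In the remaining minor each entry is \<open>x - z\<close> times a geometric block, and
  expanding the rows multilinearly over the blocks gives the branching rule.\<close>

lemma alternant_branching:
  assumes len: "length h = Suc (length xs)" and dec: "sorted_wrt (>) h"
  shows "alternant h (z # xs) = (\<Prod>x\<leftarrow>xs. z - x) *
    (\<Sum>f\<in>PiE {0..<length xs} (\<lambda>i. {h ! Suc i..<h ! i}).
       z ^ (h ! length xs) * (\<Prod>i=0..<length xs. z ^ (h ! i - 1 - f i)) *
       alternant (map f [0..<length xs]) xs)"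
proof -
  define n where "n = length xs"
  have le: "h ! Suc i \<le> h ! i" if "i < n" for i
    using sorted_wrt_nth_less[OF dec, of i "Suc i"] that len by (simp add: n_def)
  let ?A = "Matrix.mat (Suc n) (Suc n) (\<lambda>(i, j). (z # xs) ! j ^ (h ! i))"
  let ?U = "Matrix.mat (Suc n) (Suc n) (\<lambda>(i, j). if j = i then 1
              else if j = Suc i then - (z ^ (h ! i - h ! Suc i)) else 0 :: real)"
  let ?b = "\<lambda>i j. if i < n then (z # xs) ! j ^ (h ! i) - z ^ (h ! i - h ! Suc i) * (z # xs) ! j ^ (h ! Suc i)
              else (z # xs) ! j ^ (h ! i)"
  let ?B = "Matrix.mat (Suc n) (Suc n) (\<lambda>(i, j). ?b i j)"
  (* unipotent row operations: the determinant stays the same *)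
  have UA: "?U * ?A = ?B"
  proof (intro eq_matI)
    fix i j assume ij: "i < dim_row ?B" "j < dim_col ?B"
    have "(?U * ?A) $$ (i, j) = (\<Sum>k = 0..<Suc n. (if k = i then 1
              else if k = Suc i then - (z ^ (h ! i - h ! Suc i)) else 0) * (z # xs) ! j ^ (h ! k))"
      using ij by (simp add: scalar_prod_def del: sum.op_ivl_Suc)
    also have "\<dots> = (\<Sum>k = 0..<Suc n. (if k = i then (z # xs) ! j ^ (h ! i) else 0)
        + (if k = Suc i then - (z ^ (h ! i - h ! Suc i)) * (z # xs) ! j ^ (h ! Suc i) else 0))"
      by (rule sum.cong) auto
    also have "\<dots> = ?b i j"
      using ij by (simp add: sum.distrib del: sum.op_ivl_Suc)
    finally show "(?U * ?A) $$ (i, j) = ?B $$ (i, j)" using ij by simp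
  qed auto
  have "Determinant.det ?U = 1"
    by (subst det_upper_triangular[of _ "Suc n"]) (auto simp: prod_list_diag_prod)
  then have "alternant h (z # xs) = Determinant.det (?U * ?A)"
    using len by (subst det_mult[of _ "Suc n"]) (auto simp: alternant_def n_def)
  also have "\<dots> = (\<Sum>i<Suc n. ?B $$ (i, 0) * cofactor ?B i 0)"
    unfolding UA by (rule laplace_expansion_column) auto
  also have "\<dots> = z ^ (h ! n) * ((-1) ^ n * Determinant.det (mat_delete ?B n 0))"
  proof -
    have "z ^ (h ! i) - z ^ (h ! i - h ! Suc i) * z ^ (h ! Suc i) = 0" if "i < n" for i
      using le[OF that] by (simp flip: power_add)
    then show ?thesis by (simp add: cofactor_def)
  qed
  also have "mat_delete ?B n 0 = Matrix.mat n n (\<lambda>(i, j).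
     (xs ! j - z) * (\<Sum>m = h ! Suc i..<h ! i. xs ! j ^ m * z ^ (h ! i - 1 - m)))"
    by (intro eq_matI) (auto simp: mat_delete_def geometric_block[OF le, simplified])
  also have "Determinant.det \<dots> = (\<Sum>p | p permutes {0..<n}. signof p *
     (\<Prod>i = 0..<n. (xs ! p i - z) * (\<Sum>m = h ! Suc i..<h ! i. xs ! p i ^ m * z ^ (h ! i - 1 - m))))"
    by (subst det_def'[of _ n]) (auto intro!: sum.cong prod.cong simp: permutes_def)
  also have "\<dots> = (\<Sum>p | p permutes {0..<n}. \<Sum>f\<in>PiE {0..<n} (\<lambda>i. {h ! Suc i..<h ! i}).
      (\<Prod>x\<leftarrow>xs. x - z) * ((\<Prod>i=0..<n. z ^ (h ! i - 1 - f i)) * (signof p * (\<Prod>i=0..<n. xs ! p i ^ f i))))"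
  proof (rule sum.cong[OF refl])
    fix p assume p: "p \<in> {p. p permutes {0..<n}}"
    have "(\<Prod>i = 0..<n. (xs ! p i - z)) = (\<Prod>i = 0..<n. (xs ! i - z))"
      using p prod.permute[of p "{0..<n}" "\<lambda>i. xs ! i - z"] by (simp add: o_def)
    also have "\<dots> = (\<Prod>x\<leftarrow>xs. x - z)"
      by (simp add: prod.list_conv_set_nth n_def)
    finally have 1: "(\<Prod>i = 0..<n. (xs ! p i - z)) = (\<Prod>x\<leftarrow>xs. x - z)" .
    have 2: "(\<Prod>i = 0..<n. (\<Sum>m = h ! Suc i..<h ! i. xs ! p i ^ m * z ^ (h ! i - 1 - m)))
       = (\<Sum>f\<in>PiE {0..<n} (\<lambda>i. {h ! Suc i..<h ! i}). \<Prod>i=0..<n. xs ! p i ^ f i * z ^ (h ! i - 1 - f i))"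
      by (rule prod_sum_PiE) auto
    show "signof p * (\<Prod>i = 0..<n. (xs ! p i - z) * (\<Sum>m = h ! Suc i..<h ! i. xs ! p i ^ m * z ^ (h ! i - 1 - m)))
      = (\<Sum>f\<in>PiE {0..<n} (\<lambda>i. {h ! Suc i..<h ! i}).
      (\<Prod>x\<leftarrow>xs. x - z) * ((\<Prod>i=0..<n. z ^ (h ! i - 1 - f i)) * (signof p * (\<Prod>i=0..<n. xs ! p i ^ f i))))"
      unfolding prod.distrib 1 2 by (simp add: sum_distrib_left mult_ac)
  qed
  also have "\<dots> = (\<Prod>x\<leftarrow>xs. x - z) * (\<Sum>f\<in>PiE {0..<n} (\<lambda>i. {h ! Suc i..<h ! i}).
      (\<Prod>i=0..<n. z ^ (h ! i - 1 - f i)) * (\<Sum>p | p permutes {0..<n}. signof p * (\<Prod>i=0..<n. xs ! p i ^ f i)))"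
    by (subst sum.swap) (simp add: sum_distrib_left)
  also have "\<dots> = (\<Prod>x\<leftarrow>xs. x - z) * (\<Sum>f\<in>PiE {0..<n} (\<lambda>i. {h ! Suc i..<h ! i}).
      (\<Prod>i=0..<n. z ^ (h ! i - 1 - f i)) * alternant (map f [0..<n]) xs)"
  proof -
    have "(\<Sum>p | p permutes {0..<n}. signof p * (\<Prod>i=0..<n. xs ! p i ^ f i)) = alternant (map f [0..<n]) xs" for f
      unfolding alternant_def using n_def
      by (subst det_def'[of _ n]) (auto intro!: sum.cong prod.cong simp: permutes_def)
    then show ?thesis by simp
  qed
  also have "z ^ (h ! n) * ((-1) ^ n * \<dots>) = ((-1) ^ n * (\<Prod>x\<leftarrow>xs. x - z)) *
    (\<Sum>f\<in>PiE {0..<n} (\<lambda>i. {h ! Suc i..<h ! i}).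
       z ^ (h ! n) * (\<Prod>i=0..<n. z ^ (h ! i - 1 - f i)) * alternant (map f [0..<n]) xs)"
    by (simp add: sum_distrib_left mult_ac)
  also have "(-1) ^ n * (\<Prod>x\<leftarrow>xs. x - z) = (\<Prod>x\<leftarrow>xs. z - x)"
    unfolding n_def by (induction xs) (auto simp: algebra_simps)
  finally show ?thesis by (simp add: n_def)
qed

lemma interlacing_decreasing:
  fixes h :: "nat list" and f :: "nat \<Rightarrow> nat"
  assumes "length h = Suc n" "sorted_wrt (>) h" "f \<in> PiE {0..<n} (\<lambda>i. {h ! Suc i..<h ! i})"
  shows "sorted_wrt (>) (map f [0..<n])"
proof -
  have "f j < f i" if "i < j" "j < n" for i j
  proof -
    have "f j < h ! j" "h ! Suc i \<le> f i" using assms(3) that by (auto simp: PiE_iff)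
    moreover have "h ! j \<le> h ! Suc i"
      using sorted_wrt_nth_less[OF assms(2), of "Suc i" j] that assms(1)
      by (cases "Suc i = j") (auto intro: less_imp_le)
    ultimately show ?thesis by simp
  qed
  then show ?thesis by (auto simp: sorted_wrt_iff_nth_less)
qed

text \<open>Jacobi's bialternant formula.\<close>

lemma alternant_eq_vandermonde_schur:
  assumes "length h = length xs" "sorted_wrt (>) h"
  shows "alternant h xs = vandermonde_prod xs * schur xs h"
  using assms
proof (induction xs arbitrary: h)
  case Nil
  then show ?case by (simp add: alternant_def)
next
  case (Cons z xs)
  have "alternant (map f [0..<length xs]) xs = vandermonde_prod xs * schur xs (map f [0..<length xs])"
    if "f \<in> PiE {0..<length xs} (\<lambda>i. {h ! Suc i..<h ! i})" for f
    using interlacing_decreasing[OF _ Cons.prems(2) that] Cons by simp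
  then show ?case
    using Cons.prems by (simp add: alternant_branching sum_distrib_left mult_ac cong: sum.cong)
qed

lemma sorted_desc_unique:
  fixes h :: "nat list"
  assumes "sorted_wrt (>) h"
  shows "h = rev (sorted_list_of_set (set h))"
proof -
  have "sorted_wrt (<) (rev h)" using assms by (simp add: sorted_wrt_rev)
  then have "sorted_list_of_set (set (rev h)) = rev h"
    by (intro sorted_list_of_set.idem_if_sorted_distinct) (auto simp: strict_sorted_iff)
  then show ?thesis by simp
qed

lemma sorted_desc_rev_sorted_list: "sorted_wrt (>) (rev (sorted_list_of_set (H :: nat set)))"
  by (simp add: sorted_wrt_rev strict_sorted_list_of_set)

lemma schur_staircase: "schur xs (rev [0..<length xs]) = 1"
proof (induction xs)
  case (Cons z xs)
  let ?n = "length xs"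
  let ?h = "rev [0..<Suc ?n]"
  have h: "?h ! i = ?n - i" if "i \<le> ?n" for i
    using that by (subst rev_nth) (auto simp del: upt_Suc)
  have "PiE {0..<?n} (\<lambda>i. {?h ! Suc i..<?h ! i}) = PiE {0..<?n} (\<lambda>i. {?n - Suc i})"
    by (intro PiE_cong) (auto simp del: upt_Suc simp: h)
  also have "\<dots> = {restrict (\<lambda>i. ?n - Suc i) {0..<?n}}" by (auto simp: PiE_iff extensional_def restrict_def fun_eq_iff)
  finally have P: "PiE {0..<?n} (\<lambda>i. {?h ! Suc i..<?h ! i}) = {restrict (\<lambda>i. ?n - Suc i) {0..<?n}}" .
  have "map (restrict (\<lambda>i. ?n - Suc i) {0..<?n}) [0..<?n] = rev [0..<?n]"
    by (intro nth_equalityI) (auto simp: rev_nth)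
  then show ?case
    using Cons by (simp add: P h del: upt_Suc)
qed simp

lemma vandermonde_prod_eq_alternant: "vandermonde_prod xs = alternant (rev [0..<length xs]) xs"
  by (subst alternant_eq_vandermonde_schur) (auto simp: schur_staircase sorted_wrt_rev strict_sorted_iff)

lemma vandermonde_prod_nonzero: "distinct xs \<Longrightarrow> vandermonde_prod xs \<noteq> 0"
  by (induction xs) (auto simp: prod_list_zero_iff)

lemma alternant_permute:
  assumes p: "p permutes {..<length xs}" and len: "length h = length xs"
  shows "alternant h (permute_list p xs) = signof p * alternant h xs"
proof -
  let ?n = "length xs"
  let ?A = "Matrix.mat ?n ?n (\<lambda>(i, j). xs ! i ^ (h ! j))"
  have p': "p permutes {0..<?n}" using p by (simp add: atLeast0LessThan)
  have pi: "p i < ?n" if "i < ?n" for i using permutes_in_image[OF p, of i] that by simp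
  have T: "alternant h ys = Determinant.det (Matrix.mat ?n ?n (\<lambda>(i, j). ys ! i ^ (h ! j)))"
    if "length ys = ?n" for ys
    unfolding alternant_def using that len
    by (subst det_transpose[symmetric, of _ ?n]) (auto intro!: arg_cong[of _ _ Determinant.det])
  have "alternant h (permute_list p xs) = Determinant.det (Matrix.mat ?n ?n (\<lambda>(i, j). ?A $$ (p i, j)))"
    by (subst T) (auto intro!: arg_cong[of _ _ Determinant.det] eq_matI simp: permute_list_nth[OF p] pi)
  also have "\<dots> = signof p * Determinant.det ?A"
    by (rule det_permute_rows[OF _ p']) simp
  finally show ?thesis by (simp add: T)
qed

text \<open>Both the alternant and the Vandermonde product change by the sign of the permutation, so their
  quotient is symmetric.\<close>

lemma schur_mset_cong:
  assumes "mset xs = mset ys" "distinct xs" "length h = length xs" "sorted_wrt (>) h"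
  shows "schur xs h = schur ys h"
proof -
  obtain p where p: "p permutes {..<length ys}" and xs: "permute_list p ys = xs"
    using mset_eq_permutation[OF assms(1)] by blast
  have len: "length xs = length ys" using assms(1) by (metis size_mset)
  have "distinct ys" using assms(1,2) by (metis mset_eq_imp_distinct_iff)
  have "vandermonde_prod xs * schur xs h = signof p * (vandermonde_prod ys * schur ys h)"
    using alternant_permute[OF p, of h] assms len by (simp add: alternant_eq_vandermonde_schur xs)
  moreover have "vandermonde_prod xs = signof p * vandermonde_prod ys"
    using alternant_permute[OF p, of "rev [0..<length ys]"] len by (simp add: vandermonde_prod_eq_alternant xs)
  ultimately show ?thesis
    using vandermonde_prod_nonzero[OF \<open>distinct ys\<close>] vandermonde_prod_nonzero[OF \<open>distinct xs\<close>] by auto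
qed

lemma schur_mono:
  assumes "list_all2 (\<lambda>x y. 0 \<le> x \<and> x \<le> y) xs ys"
  shows "0 \<le> schur xs h" "schur xs h \<le> schur ys h"
proof -
  have "0 \<le> schur xs h \<and> schur xs h \<le> schur ys h"
    using assms
  proof (induction arbitrary: h rule: list_all2_induct)
    case (Cons x xs y ys)
    then have len: "length xs = length ys" and xy: "0 \<le> x" "x \<le> y"
      by (auto dest: list_all2_lengthD)
    have "0 \<le> x ^ a * (\<Prod>i\<in>A. x ^ b i) * schur xs h \<and>
        x ^ a * (\<Prod>i\<in>A. x ^ b i) * schur xs h \<le> y ^ a * (\<Prod>i\<in>A. y ^ b i) * schur ys h"
      for a h and A :: "nat set" and b
      using xy Cons.IH[of h]
      by (intro conjI mult_mono mult_nonneg_nonneg prod_nonneg prod_mono power_mono) auto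
    then show ?case
      using len by (simp add: sum_nonneg sum_mono)
  qed simp
  then show "0 \<le> schur xs h" "schur xs h \<le> schur ys h" by auto
qed

lemma schur_nonneg: "(\<And>x. x \<in> set xs \<Longrightarrow> 0 \<le> x) \<Longrightarrow> 0 \<le> schur xs h"
  by (rule schur_mono(1)[of xs xs]) (auto simp: list_all2_conv_all_nth)

lemma isCont_schur:
  assumes "\<And>g. g \<in> set gs \<Longrightarrow> isCont g a"
  shows "isCont (\<lambda>t. schur (map (\<lambda>g. g t) gs) h) a"
  using assms by (induction gs arbitrary: h) (auto intro!: continuous_intros)

lemma vandermonde_prod_conv_prod:
  "vandermonde_prod xs = (\<Prod>(i, j) \<in> {(i, j). i < j \<and> j < length xs}. xs ! i - xs ! j)"
proof (induction xs)
  case (Cons z xs)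
  let ?S = "{(i, j). i < j \<and> j < length xs}"
  have fin: "finite ?S" by (rule finite_subset[of _ "{..<length xs} \<times> {..<length xs}"]) auto
  have S: "{(i, j). i < j \<and> j < length (z # xs)}
     = (\<lambda>j. (0, Suc j)) ` {..<length xs} \<union> (\<lambda>(i, j). (Suc i, Suc j)) ` ?S"
  proof safe
    fix i j assume "i < j" "j < length (z # xs)"
      "(i, j) \<notin> (\<lambda>(i, j). (Suc i, Suc j)) ` ?S"
    then show "(i, j) \<in> (\<lambda>j. (0, Suc j)) ` {..<length xs}"
      by (cases i; cases j) (auto simp: image_iff)
  qed auto
  have "(\<Prod>(i, j) \<in> {(i, j). i < j \<and> j < length (z # xs)}. (z # xs) ! i - (z # xs) ! j)
     = (\<Prod>j<length xs. z - xs ! j) * (\<Prod>(i, j) \<in> ?S. xs ! i - xs ! j)"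
    unfolding S using fin
    by (subst prod.union_disjoint)
       (auto simp: prod.reindex inj_on_def case_prod_unfold)
  then show ?case
    using Cons by (simp add: prod.list_conv_set_nth atLeast0LessThan)
qed simp

lemma power_diff_quotient_limit:
  "((\<lambda>t::real. (t ^ a - t ^ b) / (t - 1)) \<longlongrightarrow> real a - real b) (at 1)"
proof -
  have "((\<lambda>t::real. t ^ a - t ^ b) has_field_derivative real a - real b) (at 1)"
    by (auto intro!: derivative_eq_intros)
  then show ?thesis by (simp add: has_field_derivative_iff)
qed

text \<open>Principal specialization: at the points \<open>1, t, t\<^sup>2, \<dots>\<close> the alternant is, read by columns, a
  Vandermonde determinant in the numbers \<open>t ^ (h ! i)\<close>.\<close>

lemma schur_geometric:
  assumes dec: "sorted_wrt (>) h" and n: "n = length h" and t: "0 < t" "t \<noteq> 1"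
  shows "schur (map (\<lambda>j. t ^ (n - Suc j)) [0..<n]) h =
    (\<Prod>(i, j) \<in> {(i, j). i < j \<and> j < n}.
       ((t ^ (h ! i) - t ^ (h ! j)) / (t - 1)) / ((t ^ (n - Suc i) - t ^ (n - Suc j)) / (t - 1)))"
proof -
  let ?xs = "map (\<lambda>j. t ^ (n - Suc j)) [0..<n]"
  let ?us = "map (\<lambda>i. t ^ (h ! i)) [0..<n]"
  have inj: "t ^ a = t ^ b \<longleftrightarrow> a = b" for a b :: nat
    using t power_inject_exp'[of t a b] by auto
  have "distinct ?xs" by (auto simp: distinct_map inj_on_def inj)
  have "alternant h ?xs = Determinant.det (Matrix.mat n n (\<lambda>(i, j). t ^ ((n - Suc j) * (h ! i))))"
    unfolding alternant_def using n by (auto intro!: arg_cong[of _ _ Determinant.det] eq_matI simp: power_mult)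
  also have "\<dots> = alternant (rev [0..<n]) ?us"
    unfolding alternant_def
    by (subst det_transpose[symmetric, of _ n])
       (auto intro!: arg_cong[of _ _ Determinant.det] eq_matI simp: rev_nth mult.commute simp flip: power_mult)
  also have "\<dots> = vandermonde_prod ?us" by (simp add: vandermonde_prod_eq_alternant)
  finally have "vandermonde_prod ?xs * schur ?xs h = vandermonde_prod ?us"
    using dec n by (simp add: alternant_eq_vandermonde_schur)
  then have "schur ?xs h = vandermonde_prod ?us / vandermonde_prod ?xs"
    using vandermonde_prod_nonzero[OF \<open>distinct ?xs\<close>] by (simp add: field_simps)
  also have "\<dots> = (\<Prod>(i, j) \<in> {(i, j). i < j \<and> j < n}.
       (t ^ (h ! i) - t ^ (h ! j)) / (t ^ (n - Suc i) - t ^ (n - Suc j)))"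
    unfolding vandermonde_prod_conv_prod
    by (auto simp: prod_dividef[symmetric] intro!: prod.cong)
  also have "\<dots> = (\<Prod>(i, j) \<in> {(i, j). i < j \<and> j < n}.
       ((t ^ (h ! i) - t ^ (h ! j)) / (t - 1)) / ((t ^ (n - Suc i) - t ^ (n - Suc j)) / (t - 1)))"
    using t by (intro prod.cong) auto
  finally show ?thesis .
qed

lemma N_seq_lambda_seq:
  assumes "sorted_wrt (>) h"
  shows "N_seq (lambda_seq h) =
    (\<Prod>(i, j) \<in> {(i, j). i < j \<and> j < length h}. (real (h ! i) - real (h ! j)) / (real j - real i))"
proof -
  have "real (lambda_seq h ! i) = real (h ! i) + real (Suc i) - real (length h)" if "i < length h" for i
    using lambda_seq_no_truncation[OF assms that] that by (simp add: lambda_seq_def of_nat_diff)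
  moreover have "length (lambda_seq h) = length h" by (simp add: lambda_seq_def)
  ultimately show ?thesis
    unfolding N_seq_def by (intro prod.cong) auto
qed

text \<open>The Weyl dimension formula, as the limit \<open>t \<rightarrow> 1\<close> of the principal specialization.\<close>

lemma schur_ones:
  assumes dec: "sorted_wrt (>) h"
  shows "schur (replicate (length h) 1) h = N_seq (lambda_seq h)"
proof -
  define n where "n = length h"
  let ?gs = "map (\<lambda>j (t::real). t ^ (n - Suc j)) [0..<n]"
  let ?F = "\<lambda>t. schur (map (\<lambda>g. g t) ?gs) h"
  have "?F \<midarrow>1\<rightarrow> ?F 1"
  proof -
    have "isCont g 1" if "g \<in> set ?gs" for g
      using that by (auto intro!: continuous_intros)
    from isCont_schur[OF this] show ?thesis by (simp only: isCont_def)
  qed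
  moreover have "?F 1 = schur (replicate n 1) h"
  proof -
    have "map (\<lambda>g. g 1) ?gs = replicate n 1" by (intro nth_equalityI) auto
    then show ?thesis by (simp only:)
  qed
  (* both Vandermonde products vanish at t = 1; divide each factor by t - 1 *)
  moreover have "?F \<midarrow>1\<rightarrow> N_seq (lambda_seq h)"
  proof -
    let ?S = "{(i, j). i < j \<and> j < n}"
    have "((\<lambda>t. \<Prod>(i, j) \<in> ?S.
       ((t ^ (h ! i) - t ^ (h ! j)) / (t - 1)) / ((t ^ (n - Suc i) - t ^ (n - Suc j)) / (t - 1)))
      \<longlongrightarrow> (\<Prod>(i, j) \<in> ?S. (real (h ! i) - real (h ! j)) / (real (n - Suc i) - real (n - Suc j)))) (at 1)"
      unfolding case_prod_unfold
      by (intro tendsto_prod tendsto_divide power_diff_quotient_limit) auto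
    also have "(\<Prod>(i, j) \<in> ?S. (real (h ! i) - real (h ! j)) / (real (n - Suc i) - real (n - Suc j)))
       = N_seq (lambda_seq h)"
      unfolding N_seq_lambda_seq[OF dec] n_def[symmetric]
      by (intro prod.cong) (auto simp: of_nat_diff)
    finally show ?thesis
    proof (rule Lim_transform_eventually)
      have "\<forall>\<^sub>F t::real in at 1. 0 < t \<and> t \<noteq> 1"
        by (auto intro!: eventually_conj eventually_neq_at_within
            order_tendstoD(1)[OF tendsto_ident_at])
      then show "\<forall>\<^sub>F t in at 1. (\<Prod>(i, j) \<in> ?S.
       ((t ^ (h ! i) - t ^ (h ! j)) / (t - 1)) / ((t ^ (n - Suc i) - t ^ (n - Suc j)) / (t - 1))) = ?F t"
        by eventually_elim (simp add: schur_geometric[OF dec n_def] o_def)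
    qed
  qed
  ultimately show ?thesis
    using LIM_unique n_def by fastforce
qed

lemma schur_le_N_const:
  assumes h: "h \<in> N_index n" and len: "length xs = length h" and xs: "set xs \<subseteq> {0..1}"
  shows "schur xs h \<le> N_const n"
proof -
  have "list_all2 (\<lambda>x y. 0 \<le> x \<and> x \<le> y) xs (replicate (length h) 1)"
  proof -
    have "xs ! i \<in> {0..1}" if "i < length xs" for i
      using xs nth_mem[OF that] by (rule subsetD)
    then show ?thesis using len by (simp add: list_all2_conv_all_nth)
  qed
  then have "schur xs h \<le> schur (replicate (length h) 1) h" by (rule schur_mono)
  also have "\<dots> = N_seq (lambda_seq h)" using h by (intro schur_ones) (simp add: N_index_def)
  also have "\<dots> \<le> N_const n"
    unfolding N_const_def using h finite_N_index by (intro Max_ge) auto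
  finally show ?thesis .
qed

text \<open>One term of the branching rule: lower every exponent but the last by one, which gives the largest
  interlacing sequence.\<close>

lemma schur_Cons_ge:
  assumes len: "length h = Suc (length xs)" and dec: "sorted_wrt (>) h"
    and pos: "0 \<le> z" "\<And>x. x \<in> set xs \<Longrightarrow> 0 \<le> x"
  shows "z ^ (h ! length xs) * schur xs (map (\<lambda>i. h ! i - 1) [0..<length xs]) \<le> schur (z # xs) h"
proof -
  let ?n = "length xs"
  let ?f = "restrict (\<lambda>i. h ! i - 1) {0..<?n}"
  let ?T = "\<lambda>f. z ^ (h ! ?n) * (\<Prod>i=0..<?n. z ^ (h ! i - 1 - f i)) * schur xs (map f [0..<?n])"
  have "h ! Suc i < h ! i" if "i < ?n" for i
    using sorted_wrt_nth_less[OF dec, of i "Suc i"] that len by simp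
  then have "h ! Suc i \<le> h ! i - 1 \<and> h ! i - 1 < h ! i" if "i < ?n" for i
    using that by fastforce
  then have f: "?f \<in> PiE {0..<?n} (\<lambda>i. {h ! Suc i..<h ! i})"
    by (auto simp: PiE_iff)
  have "?T ?f \<le> (\<Sum>f\<in>PiE {0..<?n} (\<lambda>i. {h ! Suc i..<h ! i}). ?T f)"
  proof (rule member_le_sum[OF f])
    show "0 \<le> ?T f" for f
      using pos by (intro mult_nonneg_nonneg prod_nonneg schur_nonneg) auto
    show "finite (PiE {0..<?n} (\<lambda>i. {h ! Suc i..<h ! i}))" by (intro finite_PiE) auto
  qed
  moreover have "map ?f [0..<?n] = map (\<lambda>i. h ! i - 1) [0..<?n]" by simp
  moreover have "(\<Prod>i=0..<?n. z ^ (h ! i - 1 - ?f i)) = 1" by simp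
  ultimately show ?thesis by (simp only: schur.simps mult_1_right)
qed

text \<open>Iterating the single term, the Schur polynomial dominates a monomial whose exponents are the
  parts of the partition. The last hypothesis says that the parts are at most \<open>d\<close>.\<close>

lemma schur_lower_bound:
  assumes "length h = length xs" "sorted_wrt (>) h" "0 \<le> g" "g \<le> 1"
    and "\<And>x. x \<in> set xs \<Longrightarrow> g \<le> x"
    and "\<And>i. i < length h \<Longrightarrow> h ! i + Suc i \<le> length h + d"
  shows "g ^ (length xs * d) \<le> schur xs h"
  using assms
proof (induction xs arbitrary: h)
  case (Cons z xs)
  let ?n = "length xs"
  let ?m = "map (\<lambda>i. h ! i - 1) [0..<?n]"
  have dec: "h ! i > h ! j" if "i < j" "j \<le> ?n" for i j
    using sorted_wrt_nth_less[OF Cons.prems(2), of i j] that Cons.prems(1) by simp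
  have "h ! ?n \<le> d" using Cons.prems(6)[of ?n] Cons.prems(1) by simp
  have "g ^ d \<le> g ^ (h ! ?n)" using Cons.prems \<open>h ! ?n \<le> d\<close> by (intro power_decreasing)
  also have "\<dots> \<le> z ^ (h ! ?n)" using Cons.prems by (intro power_mono) auto
  finally have "g ^ d \<le> z ^ (h ! ?n)" .
  moreover have "g ^ (?n * d) \<le> schur xs ?m"
  proof (rule Cons.IH)
    have "h ! i - 1 > h ! j - 1" if "i < j" "j < ?n" for i j
      using dec[of i j] dec[of j ?n] that by simp
    then show "sorted_wrt (>) ?m"
      by (auto simp: sorted_wrt_iff_nth_less)
    show "?m ! i + Suc i \<le> length ?m + d" if "i < length ?m" for i
      using Cons.prems(6)[of i] Cons.prems(1) that dec[of i ?n] by simp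
  qed (use Cons.prems in auto)
  ultimately have "g ^ d * g ^ (?n * d) \<le> z ^ (h ! ?n) * schur xs ?m"
    using Cons.prems order_trans[of 0 g z] by (intro mult_mono) auto
  also have "\<dots> \<le> schur (z # xs) h"
    using Cons.prems(1,2,5) order_trans[OF Cons.prems(3)] by (intro schur_Cons_ge) simp_all
  finally show ?case by (simp add: power_add)
qed simp

text \<open>If the exponent \<open>0\<close> occurs, the last part of the partition is \<open>0\<close>, and the dominated monomial
  can be chosen free of \<open>z\<close>. This is what allows the smallest point to be \<open>0\<close>.\<close>

lemma schur_lower_bound_zero_exponent:
  assumes "length h = Suc (length xs)" "sorted_wrt (>) h" "h ! length xs = 0" "0 \<le> g" "g \<le> 1"
    and "0 \<le> z" "\<And>x. x \<in> set xs \<Longrightarrow> g \<le> x"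
    and "\<And>i. i < length h \<Longrightarrow> h ! i + Suc i \<le> length h + d"
  shows "g ^ (length xs * d) \<le> schur (z # xs) h"
proof -
  let ?n = "length xs"
  let ?m = "map (\<lambda>i. h ! i - 1) [0..<?n]"
  have dec: "h ! i > h ! j" if "i < j" "j \<le> ?n" for i j
    using sorted_wrt_nth_less[OF assms(2), of i j] that assms(1) by simp
  have "g ^ (?n * d) \<le> schur xs ?m"
  proof (rule schur_lower_bound)
    have "h ! i - 1 > h ! j - 1" if "i < j" "j < ?n" for i j
      using dec[of i j] dec[of j ?n] that by simp
    then show "sorted_wrt (>) ?m"
      by (auto simp: sorted_wrt_iff_nth_less)
    show "?m ! i + Suc i \<le> length ?m + d" if "i < length ?m" for i
      using assms(8)[of i] assms(1) that dec[of i ?n] by simp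
  qed (use assms in auto)
  also have "schur xs ?m = z ^ (h ! ?n) * schur xs ?m" using assms by simp
  also have "\<dots> \<le> schur (z # xs) h"
    using assms(1,2,6,7) order_trans[OF assms(4)] by (intro schur_Cons_ge) simp_all
  finally show ?thesis .
qed

section \<open>Polynomials with prescribed exponents and zeros\<close>

text \<open>By symmetry only the sets of exponents and points matter.\<close>

definition set_schur :: "nat set \<Rightarrow> real set \<Rightarrow> real" where
  "set_schur H A = schur (sorted_list_of_set A) (rev (sorted_list_of_set H))"

lemma schur_Cons_eq_set_schur:
  assumes "finite A" "y \<notin> A" "card H = Suc (card A)"
  shows "schur (y # sorted_list_of_set A) (rev (sorted_list_of_set H)) = set_schur H (insert y A)"
  unfolding set_schur_def
  using assms by (intro schur_mset_cong) (auto simp: sorted_desc_rev_sorted_list)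

lemma rev_sorted_list_of_set_remove_nth:
  fixes H :: "nat set"
  assumes "finite H" "i < card H"
  defines "h \<equiv> rev (sorted_list_of_set H)"
  shows "take i h @ drop (Suc i) h = rev (sorted_list_of_set (H - {h ! i}))"
proof -
  have h: "sorted_wrt (>) h" "set h = H" "length h = card H" "distinct h"
    using assms by (auto simp: h_def sorted_desc_rev_sorted_list)
  have split: "h = take i h @ h ! i # drop (Suc i) h"
    using assms h by (simp add: id_take_nth_drop)
  have "sorted_wrt (>) (take i h @ drop (Suc i) h)" 
    using h(1) by (subst (asm) split) (auto simp: sorted_wrt_append)
  moreover have "set (take i h @ drop (Suc i) h) = H - {h ! i}"
  proof -
    have "distinct (take i h @ h ! i # drop (Suc i) h)" "set (take i h @ h ! i # drop (Suc i) h) = H"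
      using h split by metis+
    then show ?thesis by auto
  qed
  ultimately show ?thesis using sorted_desc_unique by metis
qed

text \<open>The alternant with one free point, divided by the Vandermonde product of \<open>A\<close>: the polynomial
  with exponents in \<open>H\<close> that vanishes on \<open>A\<close>.\<close>

definition vanishing_poly :: "nat set \<Rightarrow> real set \<Rightarrow> real poly" where
  "vanishing_poly H A = (let h = rev (sorted_list_of_set H) in
     \<Sum>i<card H. monom ((-1) ^ i * set_schur (H - {h ! i}) A) (h ! i))"

lemma poly_vanishing_poly_aux:
  assumes "finite A" "finite H" "card H = Suc (card A)"
  shows "poly (vanishing_poly H A) y =
    (\<Prod>a\<in>A. y - a) * schur (y # sorted_list_of_set A) (rev (sorted_list_of_set H))"
proof -
  let ?h = "rev (sorted_list_of_set H)" and ?xs = "sorted_list_of_set A"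
  have nz: "vandermonde_prod ?xs \<noteq> 0" by (rule vandermonde_prod_nonzero) simp
  have "vandermonde_prod ?xs * poly (vanishing_poly H A) y
     = (\<Sum>i<card H. (-1) ^ i * y ^ (?h ! i) * alternant (take i ?h @ drop (Suc i) ?h) ?xs)"
    unfolding vanishing_poly_def Let_def poly_sum sum_distrib_left
  proof (rule sum.cong[OF refl])
    fix i assume i: "i \<in> {..<card H}"
    then have ix: "?h ! i \<in> H"
      using nth_mem[of i ?h] assms by simp
    have "alternant (take i ?h @ drop (Suc i) ?h) ?xs = vandermonde_prod ?xs * set_schur (H - {?h ! i}) A"
      using i ix assms rev_sorted_list_of_set_remove_nth[of H i]
      by (simp add: set_schur_def alternant_eq_vandermonde_schur sorted_desc_rev_sorted_list)
    then show "vandermonde_prod ?xs * poly (monom ((-1) ^ i * set_schur (H - {?h ! i}) A) (?h ! i)) y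
      = (-1) ^ i * y ^ (?h ! i) * alternant (take i ?h @ drop (Suc i) ?h) ?xs"
      by (simp add: poly_monom)
  qed
  also have "\<dots> = alternant ?h (y # ?xs)"
    using assms by (subst alternant_laplace) auto
  also have "\<dots> = (\<Prod>x\<leftarrow>?xs. y - x) * vandermonde_prod ?xs * schur (y # ?xs) ?h"
    using assms by (subst alternant_eq_vandermonde_schur) (auto simp: sorted_desc_rev_sorted_list)
  also have "(\<Prod>x\<leftarrow>?xs. y - x) = (\<Prod>a\<in>A. y - a)"
    using assms by (subst prod.distinct_set_conv_list[symmetric]) auto
  finally show ?thesis using nz by simp
qed

lemma poly_vanishing_poly_zero:
  assumes "finite A" "finite H" "card H = Suc (card A)" "a \<in> A"
  shows "poly (vanishing_poly H A) a = 0"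
  using assms by (auto simp: poly_vanishing_poly_aux)

lemma poly_vanishing_poly:
  assumes "finite A" "finite H" "card H = Suc (card A)" "y \<notin> A"
  shows "poly (vanishing_poly H A) y = (\<Prod>a\<in>A. y - a) * set_schur H (insert y A)"
  by (simp only: poly_vanishing_poly_aux[OF assms(1-3)] schur_Cons_eq_set_schur[OF assms(1,4,3)])

lemma coeff_vanishing_poly:
  assumes "finite H"
  shows "k \<notin> H \<Longrightarrow> coeff (vanishing_poly H A) k = 0"
    and "k \<in> H \<Longrightarrow> \<bar>coeff (vanishing_poly H A) k\<bar> = \<bar>set_schur (H - {k}) A\<bar>"
proof -
  let ?h = "rev (sorted_list_of_set H)"
  have len: "length ?h = card H" and set: "set ?h = H" and dist: "distinct ?h"
    using assms by auto
  have c: "coeff (vanishing_poly H A) k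
     = (\<Sum>i<card H. if ?h ! i = k then (-1) ^ i * set_schur (H - {?h ! i}) A else 0)"
    by (simp add: vanishing_poly_def Let_def coeff_sum)
  show "coeff (vanishing_poly H A) k = 0" if "k \<notin> H"
    unfolding c
  proof (rule sum.neutral, rule ballI)
    fix i assume "i \<in> {..<card H}"
    then have "?h ! i \<in> H" using nth_mem[of i ?h] len set by simp
    then show "(if ?h ! i = k then (-1) ^ i * set_schur (H - {?h ! i}) A else 0) = 0" using that by auto
  qed
  show "\<bar>coeff (vanishing_poly H A) k\<bar> = \<bar>set_schur (H - {k}) A\<bar>" if "k \<in> H"
  proof -
    from that obtain j where j: "j < card H" "?h ! j = k"
      using set len by (metis in_set_conv_nth)
    have "coeff (vanishing_poly H A) k
       = (\<Sum>i<card H. if i = j then (-1) ^ i * set_schur (H - {?h ! i}) A else 0)"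
      unfolding c
    proof (rule sum.cong[OF refl])
      fix i assume "i \<in> {..<card H}"
      then have "?h ! i = k \<longleftrightarrow> i = j"
        using j nth_eq_iff_index_eq[OF dist, of i j] len by auto
      then show "(if ?h ! i = k then (-1) ^ i * set_schur (H - {?h ! i}) A else 0)
        = (if i = j then (-1) ^ i * set_schur (H - {?h ! i}) A else 0)" by simp
    qed
    also have "\<dots> = (-1) ^ j * set_schur (H - {k}) A" using j by simp
    finally show ?thesis by (simp add: abs_mult power_abs)
  qed
qed

lemma degree_vanishing_poly:
  assumes "H \<subseteq> {..n}"
  shows "degree (vanishing_poly H A) \<le> n"
  using assms by (intro degree_le) (auto intro!: coeff_vanishing_poly finite_subset[OF assms])

lemma set_schur_nonneg: "finite A \<Longrightarrow> (\<And>a. a \<in> A \<Longrightarrow> 0 \<le> a) \<Longrightarrow> 0 \<le> set_schur H A"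
  unfolding set_schur_def by (rule schur_nonneg) simp

lemma desc_list_nth_le:
  fixes h :: "nat list"
  assumes "sorted_wrt (>) h" "set h \<subseteq> {..n}" "i < length h"
  shows "h ! i + i \<le> n"
  using assms(3)
proof (induction i)
  case 0
  then have "h ! 0 \<in> set h" by simp
  then show ?case using assms(2) by auto
next
  case (Suc i)
  then show ?case using sorted_wrt_nth_less[OF assms(1), of i "Suc i"] by auto
qed

lemma card_le_Suc: "H \<subseteq> {..n} \<Longrightarrow> card H \<le> Suc n"
  using card_mono[of "{..n}" H] by simp

lemma set_schur_le_N_const:
  assumes H: "H \<subseteq> {..n}" "H \<noteq> {}" and A: "finite A" "A \<subseteq> {0..1}" "card A = card H"
  shows "set_schur H A \<le> N_const n"
proof -
  have fin: "finite H" using H finite_subset by blast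
  let ?h = "rev (sorted_list_of_set H)"
  have "?h \<in> N_index n"
    using H fin card_le_Suc[OF H(1)] desc_list_nth_le[OF sorted_desc_rev_sorted_list, of H n 0]
    by (auto simp: N_index_def sorted_desc_rev_sorted_list hd_conv_nth card_gt_0_iff
        sorted_list_of_set_eq_Nil_iff)
  then show ?thesis
    unfolding set_schur_def using A fin by (intro schur_le_N_const) auto
qed

lemma set_schur_lower_bound:
  assumes H: "H \<subseteq> {..n}" "0 \<in> H" "card H = Suc r" and A: "card A = Suc r" "A \<subseteq> {0..}"
    and g: "0 \<le> g" "g \<le> 1" "\<And>a. a \<in> A \<Longrightarrow> a \<noteq> Min A \<Longrightarrow> g \<le> a"
  shows "g ^ (r * (n - r)) \<le> set_schur H A"
proof -
  have fin: "finite H" "finite A" "A \<noteq> {}"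
    using assms finite_subset[OF H(1)] by (auto intro: card_ge_0_finite)
  let ?h = "rev (sorted_list_of_set H)"
  have rn: "r \<le> n" using card_le_Suc[OF H(1)] H(3) by simp
  have "?h ! r = 0"
  proof -
    obtain j where j: "j < Suc r" "?h ! j = 0"
      using H fin by (metis in_set_conv_nth length_rev length_sorted_list_of_set set_rev set_sorted_list_of_set)
    then show ?thesis
      using sorted_wrt_nth_less[OF sorted_desc_rev_sorted_list[of H], of j r] H(3)
      by (cases "j = r") auto
  qed
  moreover have "?h ! i + Suc i \<le> Suc r + (n - r)" if "i < Suc r" for i
    using desc_list_nth_le[OF sorted_desc_rev_sorted_list, of H n i] that H fin rn by simp
  ultimately have "g ^ (length (sorted_list_of_set (A - {Min A})) * (n - r))
     \<le> schur (Min A # sorted_list_of_set (A - {Min A})) ?h"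
    using assms fin Min_in[of A]
    by (intro schur_lower_bound_zero_exponent) (auto simp: sorted_desc_rev_sorted_list)
  then show ?thesis
    using fin A by (simp add: set_schur_def sorted_list_of_set_nonempty)
qed

lemma set_schur_pos:
  assumes H: "finite H" "0 \<in> H" "card H = card A" and A: "finite A" "A \<subseteq> {0..}"
  shows "0 < set_schur H A"
proof -
  obtain r where r: "card H = Suc r" using H by (metis card_eq_0_iff empty_iff not0_implies_Suc)
  then have ne: "A \<noteq> {}" using H by auto
  (* any positive lower bound for the points other than the smallest one will do *)
  define g where "g = Min (insert 1 (A - {Min A}))"
  have pos: "0 < a" if "a \<in> A" "a \<noteq> Min A" for a
  proof -
    have "0 \<le> Min A" "Min A \<le> a" using A Min_le[OF A(1) that(1)] Min_in[OF A(1) ne] by auto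
    with that show ?thesis by linarith
  qed
  have "0 < g" using A pos by (auto simp: g_def)
  moreover have "g \<le> 1" "\<And>a. a \<in> A \<Longrightarrow> a \<noteq> Min A \<Longrightarrow> g \<le> a" using A by (auto simp: g_def)
  moreover have "H \<subseteq> {..Max H}" using H by auto
  ultimately have "g ^ (r * (Max H - r)) \<le> set_schur H A"
    using assms r by (intro set_schur_lower_bound) auto
  then show ?thesis using \<open>0 < g\<close> by (meson less_le_trans zero_less_power)
qed

text \<open>The monomials with exponents in \<open>H\<close>, a set containing \<open>0\<close>, form a Haar system on the nonnegative half-line. Induction:
  eliminate the largest exponent with a polynomial that vanishes on all points but one.\<close>

lemma haar_uniqueness:
  fixes p :: "real poly" and A :: "real set"
  assumes "finite H" "0 \<in> H" "card H = card A" "finite A" "A \<subseteq> {0..}"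
    and "\<And>k. k \<notin> H \<Longrightarrow> coeff p k = 0" "\<And>a. a \<in> A \<Longrightarrow> poly p a = 0"
  shows "p = 0"
  using assms
proof (induction "card H" arbitrary: H A p)
  case 0
  then show ?case by auto
next
  case (Suc r)
  show ?case
  proof (cases "H = {0}")
    case True
    then obtain a where a: "a \<in> A" using Suc.prems by force
    have "p = [:coeff p 0:]"
      using Suc.prems(6) True by (intro poly_eqI) (auto simp: coeff_pCons split: nat.split)
    then show ?thesis using Suc.prems(7)[OF a] by (metis mult_zero_right pCons_0_0 poly_pCons poly_0 add.right_neutral)
  next
    case False
    define k where "k = Max H"
    have k: "k \<in> H" "k \<noteq> 0"
    proof -
      show "k \<in> H" unfolding k_def using Suc.prems by (intro Max_in) auto
      show "k \<noteq> 0"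
      proof
        assume "k = 0"
        then have "H \<subseteq> {0}" using Suc.prems(1) Max_ge[of H] unfolding k_def by fastforce
        with False Suc.prems show False by auto
      qed
    qed
    obtain j where j: "j \<in> A" using Suc.hyps(2) Suc.prems by force
    let ?\<phi> = "vanishing_poly H (A - {j})"
    let ?e = "coeff ?\<phi> k"
    have cA: "card (A - {j}) = r" and cH: "card (H - {k}) = r"
      using j k Suc.prems Suc.hyps(2) by auto
    have c: "card H = Suc (card (A - {j}))" using cA Suc.hyps(2) by simp
    have e: "?e \<noteq> 0"
    proof -
      have "0 < set_schur (H - {k}) (A - {j})"
        using k cA cH Suc.prems by (intro set_schur_pos) auto
      then show ?thesis using coeff_vanishing_poly(2)[OF Suc.prems(1) k(1), of "A - {j}"] by auto
    qed
    have red: "Polynomial.smult ?e p - Polynomial.smult (coeff p k) ?\<phi> = 0"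
    proof (rule Suc.hyps(1)[of "H - {k}" "A - {j}"])
      show "coeff (Polynomial.smult ?e p - Polynomial.smult (coeff p k) ?\<phi>) i = 0" if "i \<notin> H - {k}" for i
        using that Suc.prems coeff_vanishing_poly(1)[OF Suc.prems(1), of i] by (cases "i = k") auto
      show "poly (Polynomial.smult ?e p - Polynomial.smult (coeff p k) ?\<phi>) a = 0" if "a \<in> A - {j}" for a
        using that Suc.prems c poly_vanishing_poly_zero[of "A - {j}" H a] by auto
    qed (use k cA cH Suc.prems in auto)
    then have "poly (Polynomial.smult ?e p - Polynomial.smult (coeff p k) ?\<phi>) j = 0" by simp
    then have "coeff p k * poly ?\<phi> j = 0" using Suc.prems(7)[OF j] by simp
    moreover have "poly ?\<phi> j \<noteq> 0"
    proof -
      have "0 < set_schur H A" using Suc.prems by (intro set_schur_pos) auto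
      then show ?thesis
        using poly_vanishing_poly[of "A - {j}" H j] Suc.prems c j by (auto simp: insert_absorb)
    qed
    ultimately have "coeff p k = 0" by simp
    with red e show ?thesis by simp
  qed
qed

text \<open>A polynomial is determined by its values on \<open>A\<close> and its coefficients outside \<open>H\<close>. The two sums
  are the Lagrange basis for these data: the difference of both sides has exponents in \<open>H\<close> and
  vanishes on \<open>A\<close>. The sign factor turns a coefficient known up to sign into \<open>set_schur H A\<close>.\<close>

lemma generalized_lagrange_interpolation:
  assumes H: "H \<subseteq> {..n}" "0 \<in> H" "card H = card A" and A: "finite A" "A \<subseteq> {0..}"
    and q: "degree q \<le> n"
  shows "Polynomial.smult (set_schur H A) q =
     (\<Sum>z\<in>A. Polynomial.smult (poly q z / (\<Prod>a\<in>A - {z}. z - a)) (vanishing_poly H (A - {z})))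
   + (\<Sum>k\<in>{..n} - H. Polynomial.smult (coeff q k * sgn (coeff (vanishing_poly (insert k H) A) k))
        (vanishing_poly (insert k H) A))"
    (is "_ = ?S + ?T")
proof -
  have fin: "finite H" using H finite_subset by blast
  have pos: "0 < set_schur H A" using assms fin by (intro set_schur_pos) auto
  have "Polynomial.smult (set_schur H A) q - ?S - ?T = 0"
  proof (rule haar_uniqueness[of H A])
    show "coeff (Polynomial.smult (set_schur H A) q - ?S - ?T) k = 0" if k: "k \<notin> H" for k
    proof -
      have S: "coeff ?S k = 0"
        using coeff_vanishing_poly(1)[OF fin k] by (simp add: coeff_sum)
      have "coeff ?T k = (\<Sum>l\<in>{..n} - H. if l = k then coeff q k * set_schur H A else 0)"
        unfolding coeff_sum
      proof (rule sum.cong[OF refl])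
        fix l assume l: "l \<in> {..n} - H"
        show "coeff (Polynomial.smult (coeff q l * sgn (coeff (vanishing_poly (insert l H) A) l))
            (vanishing_poly (insert l H) A)) k = (if l = k then coeff q k * set_schur H A else 0)"
        proof (cases "l = k")
          case True
          have "\<bar>coeff (vanishing_poly (insert k H) A) k\<bar> = set_schur H A"
            using coeff_vanishing_poly(2)[of "insert k H" k A] fin k pos by simp
          then show ?thesis
            using True by (simp add: abs_sgn mult.commute)
        next
          case False
          then show ?thesis
            using coeff_vanishing_poly(1)[of "insert l H" k A] fin k by simp
        qed
      qed
      also have "\<dots> = coeff q k * set_schur H A"
        using k q by (auto simp: coeff_eq_0)
      finally show ?thesis using S by simp
    qed
    show "poly (Polynomial.smult (set_schur H A) q - ?S - ?T) x = 0" if x: "x \<in> A" for x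
    proof -
      have T: "poly ?T x = 0"
        unfolding poly_sum
      proof (rule sum.neutral, rule ballI)
        fix k assume "k \<in> {..n} - H"
        then show "poly (Polynomial.smult (coeff q k * sgn (coeff (vanishing_poly (insert k H) A) k))
            (vanishing_poly (insert k H) A)) x = 0"
          using fin A H x by (simp add: poly_vanishing_poly_zero)
      qed
      have "poly ?S x = (\<Sum>z\<in>A. if z = x then poly q x * set_schur H A else 0)"
        unfolding poly_sum
      proof (rule sum.cong[OF refl])
        fix z assume z: "z \<in> A"
        have c: "card H = Suc (card (A - {z}))" using z A H by (simp add: card_Suc_Diff1 del: card_Diff_insert)
        show "poly (Polynomial.smult (poly q z / (\<Prod>a\<in>A - {z}. z - a)) (vanishing_poly H (A - {z}))) x
          = (if z = x then poly q x * set_schur H A else 0)"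
        proof (cases "z = x")
          case True
          have "(\<Prod>a\<in>A - {x}. x - a) \<noteq> 0" using A by auto
          then show ?thesis
            using poly_vanishing_poly[of "A - {x}" H x] True c A fin x by (simp add: insert_absorb)
        next
          case False
          then show ?thesis
            using poly_vanishing_poly_zero[of "A - {z}" H x] c A fin x by simp
        qed
      qed
      then show ?thesis using T x A by (simp add: mult.commute)
    qed
  qed (use assms fin in auto)
  then show ?thesis by (simp add: algebra_simps)
qed

lemma N_const_ge_1: "1 \<le> N_const n"
proof -
  have "N_seq (lambda_seq [0]) = 1"
    unfolding N_seq_def by (rule prod.neutral) (auto simp: lambda_seq_def)
  moreover have "N_seq (lambda_seq [0]) \<le> N_const n"
    unfolding N_const_def using finite_N_index by (intro Max_ge) (auto simp: N_index_def)
  ultimately show ?thesis by simp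
qed

lemma vanishing_poly_bound:
  assumes "H \<subseteq> {..n}" "finite A" "A \<subseteq> {0..1}" "card H = Suc (card A)" "y \<in> {0..1}"
  shows "\<bar>poly (vanishing_poly H A) y\<bar> \<le> N_const n"
proof -
  have fin: "finite H" using assms finite_subset by blast
  show ?thesis
  proof (cases "y \<in> A")
    case True
    then show ?thesis using poly_vanishing_poly_zero[of A H y] assms fin N_const_ge_1[of n] by simp
  next
    case False
    have "\<bar>\<Prod>a\<in>A. y - a\<bar> \<le> 1"
      unfolding abs_prod using assms by (intro prod_le_1) fastforce
    moreover have "0 \<le> set_schur H (insert y A)" "set_schur H (insert y A) \<le> N_const n"
      using assms False by (auto intro!: set_schur_nonneg set_schur_le_N_const)
    ultimately have "\<bar>\<Prod>a\<in>A. y - a\<bar> * set_schur H (insert y A) \<le> 1 * N_const n"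
      by (intro mult_mono) auto
    then show ?thesis
      using poly_vanishing_poly[of A H y] assms fin False \<open>0 \<le> set_schur H (insert y A)\<close>
      by (simp add: abs_mult)
  qed
qed

section \<open>From a dual certificate to strong unicity\<close>

lemma sum_poly_eq_sum_moments:
  fixes q :: "real poly"
  assumes "degree q \<le> n"
  shows "(\<Sum>z\<in>Z. \<alpha> z * poly q z) = (\<Sum>k\<le>n. coeff q k * (\<Sum>z\<in>Z. \<alpha> z * z ^ k))"
proof -
  have "poly q z = (\<Sum>k\<le>n. coeff q k * z ^ k)" for z
    unfolding poly_altdef using assms
    by (intro sum.mono_neutral_left) (auto simp: coeff_eq_0)
  then have "(\<Sum>z\<in>Z. \<alpha> z * poly q z) = (\<Sum>z\<in>Z. \<Sum>k\<le>n. coeff q k * (\<alpha> z * z ^ k))"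
    by (simp add: sum_distrib_left mult_ac)
  then show ?thesis by (subst (asm) sum.swap) (simp add: sum_distrib_left)
qed

lemma interpolation_bound:
  assumes H: "H \<subseteq> {..n}" "0 \<in> H" "card H = card A" and A: "finite A" "A \<subseteq> {0..1}"
    and q: "degree q \<le> n" and y: "y \<in> {0..1}"
  shows "set_schur H A * \<bar>poly q y\<bar> \<le> N_const n *
     ((\<Sum>z\<in>A. \<bar>poly q z\<bar> / \<bar>\<Prod>a\<in>A - {z}. z - a\<bar>) + (\<Sum>k\<in>{..n} - H. \<bar>coeff q k\<bar>))"
proof -
  have fin: "finite H" using H finite_subset by blast
  have A0: "A \<subseteq> {0..}" using A by auto
  have pos: "0 < set_schur H A" using assms fin A0 by (intro set_schur_pos) auto
  have N: "1 \<le> N_const n" by (rule N_const_ge_1)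
  let ?S = "(\<Sum>z\<in>A. Polynomial.smult (poly q z / (\<Prod>a\<in>A - {z}. z - a)) (vanishing_poly H (A - {z})))"
  let ?T = "(\<Sum>k\<in>{..n} - H. Polynomial.smult (coeff q k * sgn (coeff (vanishing_poly (insert k H) A) k))
        (vanishing_poly (insert k H) A))"
  have "\<bar>poly ?S y\<bar> \<le> (\<Sum>z\<in>A. \<bar>poly q z\<bar> / \<bar>\<Prod>a\<in>A - {z}. z - a\<bar> * N_const n)"
    unfolding poly_sum
  proof (rule sum_abs[THEN order_trans], rule sum_mono)
    fix z assume z: "z \<in> A"
    have "card H = Suc (card (A - {z}))" using z A H by (simp add: card_Suc_Diff1 del: card_Diff_insert)
    then have "\<bar>poly (vanishing_poly H (A - {z})) y\<bar> \<le> N_const n"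
      using assms by (intro vanishing_poly_bound) auto
    then show "\<bar>poly (Polynomial.smult (poly q z / (\<Prod>a\<in>A - {z}. z - a)) (vanishing_poly H (A - {z}))) y\<bar>
      \<le> \<bar>poly q z\<bar> / \<bar>\<Prod>a\<in>A - {z}. z - a\<bar> * N_const n"
      unfolding poly_smult abs_mult abs_divide by (intro mult_left_mono) auto
  qed
  moreover have "\<bar>poly ?T y\<bar> \<le> (\<Sum>k\<in>{..n} - H. \<bar>coeff q k\<bar> * N_const n)"
    unfolding poly_sum
  proof (rule sum_abs[THEN order_trans], rule sum_mono)
    fix k assume k: "k \<in> {..n} - H"
    have "\<bar>poly (vanishing_poly (insert k H) A) y\<bar> \<le> N_const n"
      using assms fin k by (intro vanishing_poly_bound) auto
    then have "\<bar>coeff q k\<bar> * \<bar>sgn (coeff (vanishing_poly (insert k H) A) k)\<bar> * \<bar>poly (vanishing_poly (insert k H) A) y\<bar>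
      \<le> \<bar>coeff q k\<bar> * 1 * N_const n"
      by (intro mult_mono) (auto simp: sgn_if)
    then show "\<bar>poly (Polynomial.smult (coeff q k * sgn (coeff (vanishing_poly (insert k H) A) k))
        (vanishing_poly (insert k H) A)) y\<bar> \<le> \<bar>coeff q k\<bar> * N_const n"
      by (simp only: poly_smult abs_mult mult_1_right)
  qed
  moreover have "set_schur H A * \<bar>poly q y\<bar> = \<bar>poly ?S y + poly ?T y\<bar>"
  proof -
    have "\<bar>poly (Polynomial.smult (set_schur H A) q) y\<bar> = \<bar>poly ?S y + poly ?T y\<bar>"
      by (simp only: generalized_lagrange_interpolation[OF H A(1) A0 q] poly_add)
    then show ?thesis using pos by (simp add: abs_mult)
  qed
  ultimately show ?thesis
    by (simp add: distrib_left sum_distrib_left sum_distrib_right mult.commute)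
qed

text \<open>Evaluate the interpolation formula for monomials with exponent in \<open>H\<close> at one further point.\<close>

lemma annihilator_exists:
  fixes Z :: "real set"
  assumes H: "H \<subseteq> {..n}" "0 \<in> H" and Z: "finite Z" "Z \<subseteq> {0..}" "card Z = Suc (card H)"
  obtains \<alpha> where "\<exists>z\<in>Z. \<alpha> z \<noteq> 0" "\<And>h. h \<in> H \<Longrightarrow> (\<Sum>z\<in>Z. \<alpha> z * z ^ h) = 0"
proof -
  have fin: "finite H" using H finite_subset by blast
  obtain j where j: "j \<in> Z" using Z by force
  define A where "A = Z - {j}"
  have A: "finite A" "A \<subseteq> {0..}" "card H = card A" "j \<notin> A" "Z = insert j A"
    using Z j by (auto simp: A_def)
  have pos: "0 < set_schur H A" using A H fin by (intro set_schur_pos) auto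
  define c where "c z = poly (vanishing_poly H (A - {z})) j / (\<Prod>a\<in>A - {z}. z - a)" for z
  show thesis
  proof (rule that[of "\<lambda>z. if z = j then - set_schur H A else c z"])
    show "\<exists>z\<in>Z. (if z = j then - set_schur H A else c z) \<noteq> 0" using j pos by auto
    fix h assume h: "h \<in> H"
    have deg: "degree (monom (1::real) h) \<le> n" using h H by (auto simp: degree_monom_eq)
    have "poly (Polynomial.smult (set_schur H A) (monom 1 h)) j
       = (\<Sum>z\<in>A. poly (monom 1 h) z / (\<Prod>a\<in>A - {z}. z - a) * poly (vanishing_poly H (A - {z})) j)
       + (\<Sum>k\<in>{..n} - H. 0)"
      unfolding generalized_lagrange_interpolation[OF H A(3,1,2) deg] poly_add poly_sum
      using h by (intro arg_cong2[of _ _ _ _ "(+)"] sum.cong) auto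
    then have "set_schur H A * j ^ h = (\<Sum>z\<in>A. c z * z ^ h)"
      by (simp add: poly_monom c_def mult.commute)
    moreover have "(\<Sum>z\<in>A. (if z = j then - set_schur H A else c z) * z ^ h) = (\<Sum>z\<in>A. c z * z ^ h)"
      using A by (intro sum.cong) auto
    ultimately show "(\<Sum>z\<in>Z. (if z = j then - set_schur H A else c z) * z ^ h) = 0"
      using A by simp
  qed
qed

text \<open>Needed to extract a convergent subsequence of coefficients from a minimizing sequence.\<close>

lemma coeff_bound_by_nodes:
  fixes A :: "real set"
  assumes A: "finite A" "A \<subseteq> {0..1}" "card A = Suc n"
  obtains C where "\<And>(q :: real poly) k. degree q \<le> n \<Longrightarrow> \<bar>coeff q k\<bar> \<le> C * (\<Sum>z\<in>A. \<bar>poly q z\<bar>)"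
proof -
  have H: "{..n} \<subseteq> {..n}" "0 \<in> {..n}" "card {..n} = card A" using A by auto
  have A0: "A \<subseteq> {0..}" using A by auto
  let ?s = "set_schur {..n} A"
  have pos: "0 < ?s" using A A0 by (intro set_schur_pos) auto
  define d where "d z k = \<bar>coeff (vanishing_poly {..n} (A - {z})) k / (\<Prod>a\<in>A - {z}. z - a)\<bar>" for z k
  define D where "D = (\<Sum>z\<in>A. \<Sum>k\<le>n. d z k)"
  have d: "d z k \<le> D" if "z \<in> A" for z k
  proof (cases "k \<le> n")
    case True
    have "d z k \<le> (\<Sum>k\<le>n. d z k)" using True by (intro member_le_sum) (auto simp: d_def)
    also have "\<dots> \<le> D" unfolding D_def using that A
      by (intro member_le_sum) (auto simp: d_def intro!: sum_nonneg)
    finally show ?thesis .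
  next
    case False
    then have "d z k = 0" by (simp add: d_def coeff_vanishing_poly)
    moreover have "0 \<le> D" by (auto simp: D_def d_def intro!: sum_nonneg)
    ultimately show ?thesis by simp
  qed
  show thesis
  proof (rule that[of "D / ?s"])
    fix q :: "real poly" and k assume q: "degree q \<le> n"
    have "?s * coeff q k = (\<Sum>z\<in>A. poly q z * (coeff (vanishing_poly {..n} (A - {z})) k / (\<Prod>a\<in>A - {z}. z - a)))"
      using arg_cong[OF generalized_lagrange_interpolation[OF H A(1) A0 q], of "\<lambda>p. coeff p k"]
      by (simp add: coeff_sum)
    then have "\<bar>?s * coeff q k\<bar> \<le> (\<Sum>z\<in>A. \<bar>poly q z\<bar> * d z k)"
      by (simp only: d_def abs_mult[symmetric] sum_abs)
    also have "\<dots> \<le> (\<Sum>z\<in>A. \<bar>poly q z\<bar> * D)" by (intro sum_mono mult_left_mono d) auto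
    also have "\<dots> = (\<Sum>z\<in>A. \<bar>poly q z\<bar>) * D" by (rule sum_distrib_right[symmetric])
    finally show "\<bar>coeff q k\<bar> \<le> D / ?s * (\<Sum>z\<in>A. \<bar>poly q z\<bar>)"
      using pos by (simp add: abs_mult pos_le_divide_eq mult.commute)
  qed
qed

text \<open>Test the annihilating functional on the polynomial with exponents in \<open>H\<close> that vanishes on all
  points except \<open>z\<close> and \<open>z'\<close>: the weights of an annihilator are unique up to a factor.\<close>

lemma annihilator_weight_ratio:
  assumes H: "H \<subseteq> {..n}" and Z: "finite Z" "card Z = Suc (card H)"
    and ann: "\<And>h. h \<in> H \<Longrightarrow> (\<Sum>z\<in>Z. \<alpha> z * z ^ h) = 0"
    and z: "z \<in> Z" "z' \<in> Z"
  shows "\<alpha> z * (\<Prod>i\<in>Z - {z}. z - i) * set_schur H (Z - {z'})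
       = \<alpha> z' * (\<Prod>i\<in>Z - {z'}. z' - i) * set_schur H (Z - {z})"
proof (cases "z = z'")
  case False
  have fin: "finite H" using H finite_subset by blast
  define A where "A = Z - {z, z'}"
  have A: "finite A" "z \<notin> A" "z' \<notin> A" "Z - {z} = insert z' A" "Z - {z'} = insert z A" "Z = insert z (insert z' A)"
    using Z z False by (auto simp: A_def)
  have c: "card H = Suc (card A)" using Z A False by simp
  let ?\<phi> = "vanishing_poly H A"
  have "0 = (\<Sum>k\<le>n. coeff ?\<phi> k * (\<Sum>z\<in>Z. \<alpha> z * z ^ k))"
    using ann coeff_vanishing_poly(1)[OF fin] by (intro sum.neutral[symmetric]) auto
  also have "\<dots> = (\<Sum>x\<in>Z. \<alpha> x * poly ?\<phi> x)"
    using degree_vanishing_poly[OF H] by (rule sum_poly_eq_sum_moments[symmetric])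
  also have "\<dots> = \<alpha> z * poly ?\<phi> z + \<alpha> z' * poly ?\<phi> z' + (\<Sum>x\<in>A. \<alpha> x * poly ?\<phi> x)"
    using A False by simp
  also have "(\<Sum>x\<in>A. \<alpha> x * poly ?\<phi> x) = 0"
    using poly_vanishing_poly_zero[OF A(1) fin c] by (intro sum.neutral) auto
  finally have "\<alpha> z * (\<Prod>a\<in>A. z - a) * set_schur H (insert z A)
     = - (\<alpha> z' * (\<Prod>a\<in>A. z' - a) * set_schur H (insert z' A))"
    using A c fin by (simp add: poly_vanishing_poly)
  then have "(z - z') * (\<alpha> z * (\<Prod>a\<in>A. z - a) * set_schur H (insert z A))
     = (z' - z) * (\<alpha> z' * (\<Prod>a\<in>A. z' - a) * set_schur H (insert z' A))"
    by (simp add: algebra_simps)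
  then show ?thesis unfolding A(4,5) using A by (simp add: mult_ac)
qed simp

text \<open>Test the functional on the polynomial with exponents in \<open>insert k H\<close> that vanishes on all points
  except \<open>z\<close>: only the moment of order \<open>k\<close> and the value at \<open>z\<close> survive.\<close>

lemma annihilator_moment:
  assumes H: "H \<subseteq> {..n}" and Z: "finite Z" "card Z = Suc (card H)"
    and ann: "\<And>h. h \<in> H \<Longrightarrow> (\<Sum>z\<in>Z. \<alpha> z * z ^ h) = 0"
    and z: "z \<in> Z" and k: "k \<le> n" "k \<notin> H"
  shows "\<bar>\<alpha> z * (\<Prod>i\<in>Z - {z}. z - i) * set_schur (insert k H) Z\<bar>
       = \<bar>set_schur H (Z - {z}) * (\<Sum>x\<in>Z. \<alpha> x * x ^ k)\<bar>"
proof -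
  have fin: "finite H" using H finite_subset by blast
  define A where "A = Z - {z}"
  have A: "finite A" "z \<notin> A" "Z = insert z A" using Z z by (auto simp: A_def)
  have c: "card (insert k H) = Suc (card A)" using Z A fin k by simp
  have iH: "insert k H \<subseteq> {..n}" using H k by auto
  let ?\<phi> = "vanishing_poly (insert k H) A"
  have "(\<Sum>l\<le>n. coeff ?\<phi> l * (\<Sum>z\<in>Z. \<alpha> z * z ^ l))
     = (\<Sum>l\<le>n. if l = k then coeff ?\<phi> k * (\<Sum>z\<in>Z. \<alpha> z * z ^ k) else 0)"
    using ann coeff_vanishing_poly(1)[of "insert k H"] fin by (intro sum.cong) auto
  also have "\<dots> = coeff ?\<phi> k * (\<Sum>z\<in>Z. \<alpha> z * z ^ k)" using k by simp
  finally have "coeff ?\<phi> k * (\<Sum>z\<in>Z. \<alpha> z * z ^ k) = (\<Sum>x\<in>Z. \<alpha> x * poly ?\<phi> x)"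
    by (simp add: sum_poly_eq_sum_moments[OF degree_vanishing_poly[OF iH]])
  also have "\<dots> = \<alpha> z * poly ?\<phi> z + (\<Sum>x\<in>A. \<alpha> x * poly ?\<phi> x)"
    using A by simp
  also have "(\<Sum>x\<in>A. \<alpha> x * poly ?\<phi> x) = 0"
    using poly_vanishing_poly_zero[OF A(1) _ c] fin by (intro sum.neutral) auto
  also have "poly ?\<phi> z = (\<Prod>a\<in>A. z - a) * set_schur (insert k H) Z"
    using poly_vanishing_poly[OF A(1) _ c A(2)] fin A by simp
  finally have "\<bar>coeff ?\<phi> k\<bar> * \<bar>\<Sum>z\<in>Z. \<alpha> z * z ^ k\<bar> = \<bar>\<alpha> z * (\<Prod>a\<in>A. z - a) * set_schur (insert k H) Z\<bar>"
    by (metis abs_mult add.right_neutral mult.assoc)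
  moreover have "\<bar>coeff ?\<phi> k\<bar> = \<bar>set_schur H A\<bar>"
    using coeff_vanishing_poly(2)[of "insert k H" k A] fin k by simp
  ultimately show ?thesis by (simp add: A_def abs_mult)
qed

text \<open>The functional with weights \<open>\<alpha>\<close>, applied to \<open>q\<close>, is the sum of \<open>coeff q k\<close> times the moment
  of order \<open>k\<close>, over the exponents \<open>k\<close> outside \<open>H\<close>. The hypotheses on the signs make the left
  side nearly nonnegative and the right side nonpositive, so every single term has size at most
  \<open>\<eta>\<close>. Dividing by the weights and moments, which are known explicitly up to the common factor
  \<open>\<kappa>\<close>, bounds the values and coefficients of \<open>q\<close> that enter the interpolation formula.\<close>

lemma strong_unicity_from_certificate:
  fixes \<alpha> :: "real \<Rightarrow> real"
  assumes H: "H \<subseteq> {..n}" "0 \<in> H" and Z: "finite Z" "Z \<subseteq> {0..1}" "card Z = Suc (card H)"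
    and g: "0 < g" "g \<le> 1" "\<And>x y. x \<in> Z \<Longrightarrow> y \<in> Z \<Longrightarrow> x \<noteq> y \<Longrightarrow> g \<le> \<bar>x - y\<bar>"
    and ann: "\<And>h. h \<in> H \<Longrightarrow> (\<Sum>z\<in>Z. \<alpha> z * z ^ h) = 0"
    and nz: "(\<Sum>z\<in>Z. \<bar>\<alpha> z\<bar>) = 1"
    and q: "degree q \<le> n" and \<eta>: "0 \<le> \<eta>"
    and node: "\<And>z. z \<in> Z \<Longrightarrow> - \<eta> * \<bar>\<alpha> z\<bar> \<le> \<alpha> z * poly q z"
    and cone: "\<And>k. k \<in> {..n} - H \<Longrightarrow> (\<Sum>z\<in>Z. \<alpha> z * z ^ k) * coeff q k \<le> 0"
    and X: "X = (n * n + 4 * n) div 2" and n: "1 \<le> n"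
    and y: "y \<in> {0..1}"
  shows "g ^ X * \<bar>poly q y\<bar> \<le> (N_const n)\<^sup>2 * (real n + 2) * (real n + 1) * \<eta>"
proof -
  let ?N = "N_const n"
  have fin: "finite H" using H finite_subset by blast
  obtain r where r: "card H = Suc r" using H fin by (metis card_eq_0_iff empty_iff not0_implies_Suc)
  have rn: "r \<le> n" using card_le_Suc[OF H(1)] r by simp
  have N1: "1 \<le> ?N" by (rule N_const_ge_1)
  define w where "w z = (\<Prod>i\<in>Z - {z}. z - i)" for z
  define s where "s z = set_schur H (Z - {z})" for z
  define \<beta> where "\<beta> k = (\<Sum>z\<in>Z. \<alpha> z * z ^ k)" for k
  define e1 where "e1 = r * (n - r)"
  define e2 where "e2 = Suc r * (n - Suc r)"
  define m where "m = max e1 e2"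
  have cZ: "card (Z - {z}) = Suc r" if "z \<in> Z" for z using that Z r by simp
  have w_low: "g ^ Suc r \<le> \<bar>w z\<bar>" if z: "z \<in> Z" for z
  proof -
    have "(\<Prod>i\<in>Z - {z}. g) \<le> (\<Prod>i\<in>Z - {z}. \<bar>z - i\<bar>)"
      using g z by (intro prod_mono) auto
    then show ?thesis by (simp add: w_def abs_prod cZ[OF z])
  qed
  have w_pos: "0 < \<bar>w z\<bar>" if "z \<in> Z" for z
    using w_low[OF that] g by (meson less_le_trans zero_less_power)
  have above: "g \<le> a" if "A \<subseteq> Z" "a \<in> A" "a \<noteq> Min A" for a A
  proof -
    have A: "finite A" "A \<noteq> {}" using that Z finite_subset by auto
    have "Min A \<in> Z" "Min A \<le> a" using Min_in[OF A] Min_le[OF A(1) that(2)] that by auto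
    moreover have "0 \<le> Min A" using \<open>Min A \<in> Z\<close> Z by auto
    ultimately show ?thesis using g(3)[of a "Min A"] that by auto
  qed
  have s_low: "g ^ e1 \<le> s z" if z: "z \<in> Z" for z
    unfolding s_def e1_def using H r g cZ[OF z] Z above[of "Z - {z}"]
    by (intro set_schur_lower_bound) auto
  have s_pos: "0 < s z" if "z \<in> Z" for z
    using s_low[OF that] g by (meson less_le_trans zero_less_power)
  have s_up: "s z \<le> ?N" if "z \<in> Z" for z
    unfolding s_def using H Z r cZ[OF that] by (intro set_schur_le_N_const) auto
  have s'_low: "g ^ e2 \<le> set_schur (insert k H) Z" if k: "k \<in> {..n} - H" for k
    unfolding e2_def using H r g Z above[of Z] k fin
    by (intro set_schur_lower_bound) auto
  obtain j where j: "j \<in> Z" using Z by force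
  (* the common factor of the weights: abs (alpha z) = kappa * s z / abs (w z) *)
  define \<kappa> where "\<kappa> = \<bar>\<alpha> j\<bar> * \<bar>w j\<bar> / s j"
  have \<kappa>: "\<bar>\<alpha> z\<bar> * \<bar>w z\<bar> = \<kappa> * s z" if z: "z \<in> Z" for z
  proof -
    have "\<alpha> z * w z * s j = \<alpha> j * w j * s z"
      unfolding w_def s_def using H(1) Z(1,3) ann z j by (rule annihilator_weight_ratio)
    then have "\<bar>\<alpha> z\<bar> * \<bar>w z\<bar> * s j = \<bar>\<alpha> j\<bar> * \<bar>w j\<bar> * s z"
      using s_pos[OF z] s_pos[OF j] by (metis abs_mult abs_of_pos)
    then show ?thesis using s_pos[OF j] by (simp add: \<kappa>_def field_simps)
  qed
  have \<kappa>0: "0 \<le> \<kappa>" using s_pos[OF j] by (simp add: \<kappa>_def)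
  (* the normalization of the weights keeps the common factor away from 0 *)
  have \<kappa>_low: "g ^ Suc r \<le> (real r + 2) * ?N * \<kappa>"
  proof -
    have "\<bar>\<alpha> z\<bar> \<le> \<kappa> * ?N / g ^ Suc r" if z: "z \<in> Z" for z
    proof -
      have "\<bar>\<alpha> z\<bar> = \<kappa> * s z / \<bar>w z\<bar>" using \<kappa>[OF z] w_pos[OF z] by (simp add: field_simps)
      also have "\<dots> \<le> \<kappa> * ?N / g ^ Suc r"
        using \<kappa>0 s_up[OF z] s_pos[OF z] w_low[OF z] g by (intro frac_le mult_left_mono) auto
      finally show ?thesis .
    qed
    then have "(\<Sum>z\<in>Z. \<bar>\<alpha> z\<bar>) \<le> (\<Sum>z\<in>Z. \<kappa> * ?N / g ^ Suc r)" by (rule sum_mono)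
    also have "\<dots> = (real r + 2) * ?N * \<kappa> / g ^ Suc r" using Z r by simp
    finally have "1 \<le> (real r + 2) * ?N * \<kappa> / g ^ Suc r" unfolding nz .
    then show ?thesis using g by (simp add: pos_le_divide_eq)
  qed
  have \<kappa>_pos: "0 < \<kappa>"
    using \<kappa>_low \<kappa>0 g by (metis less_eq_real_def mult_zero_right not_less zero_less_power)
  have \<beta>H: "\<beta> k = 0" if "k \<in> H" for k using ann[OF that] by (simp add: \<beta>_def)
  have bal: "(\<Sum>z\<in>Z. \<alpha> z * poly q z) = (\<Sum>k\<in>{..n} - H. coeff q k * \<beta> k)"
  proof -
    have "(\<Sum>k\<le>n. coeff q k * \<beta> k) = (\<Sum>k\<in>{..n} - H. coeff q k * \<beta> k)"
      using \<beta>H by (intro sum.mono_neutral_right) auto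
    then show ?thesis unfolding sum_poly_eq_sum_moments[OF q] \<beta>_def .
  qed
  have cone': "coeff q k * \<beta> k \<le> 0" if "k \<in> {..n} - H" for k
    using cone[OF that] by (simp add: \<beta>_def mult.commute)
  have node_bound: "\<bar>\<alpha> z * poly q z\<bar> \<le> \<eta>" if z: "z \<in> Z" for z
  proof -
    have split: "(\<Sum>z\<in>Z. f z) = f z + (\<Sum>x\<in>Z - {z}. f x)" for f :: "real \<Rightarrow> real"
      using Z z by (simp add: sum.remove)
    have "(\<Sum>k\<in>{..n} - H. coeff q k * \<beta> k) \<le> 0" by (intro sum_nonpos cone')
    then have "\<alpha> z * poly q z \<le> - (\<Sum>x\<in>Z - {z}. \<alpha> x * poly q x)"
      using bal split[of "\<lambda>z. \<alpha> z * poly q z"] by simp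
    also have "\<dots> \<le> - (\<Sum>x\<in>Z - {z}. - \<eta> * \<bar>\<alpha> x\<bar>)"
      using node by (intro le_imp_neg_le sum_mono) auto
    also have "\<dots> = \<eta> * (\<Sum>x\<in>Z - {z}. \<bar>\<alpha> x\<bar>)" by (simp add: sum_distrib_left sum_negf)
    also have "\<dots> \<le> \<eta> * 1" using \<eta> nz split[of "\<lambda>z. \<bar>\<alpha> z\<bar>"] by (intro mult_left_mono) auto
    finally have "\<alpha> z * poly q z \<le> \<eta>" by simp
    moreover have "\<bar>\<alpha> z\<bar> \<le> 1"
    proof -
      have "0 \<le> (\<Sum>x\<in>Z - {z}. \<bar>\<alpha> x\<bar>)" by (rule sum_nonneg) simp
      then show ?thesis using nz split[of "\<lambda>z. \<bar>\<alpha> z\<bar>"] by linarith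
    qed
    then have "\<eta> * \<bar>\<alpha> z\<bar> \<le> \<eta>" using \<eta> by (simp add: mult_left_le)
    then have "- \<eta> \<le> \<alpha> z * poly q z" using node[OF z] by simp
    ultimately show ?thesis by (simp add: abs_le_iff)
  qed
  have coeff_bound: "\<bar>coeff q k * \<beta> k\<bar> \<le> \<eta>" if k: "k \<in> {..n} - H" for k
  proof -
    have "- (coeff q k * \<beta> k) \<le> (\<Sum>k\<in>{..n} - H. - (coeff q k * \<beta> k))"
      using k by (intro member_le_sum) (auto simp: cone')
    also have "\<dots> = - (\<Sum>z\<in>Z. \<alpha> z * poly q z)" unfolding bal by (simp add: sum_negf)
    also have "\<dots> \<le> - (\<Sum>z\<in>Z. - \<eta> * \<bar>\<alpha> z\<bar>)" using node by (intro le_imp_neg_le sum_mono) auto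
    also have "\<dots> = \<eta>" using nz by (simp add: sum_negf flip: sum_distrib_left)
    finally show ?thesis using cone'[OF k] by simp
  qed
  define B where "B = \<eta> / (\<kappa> * g ^ m)"
  have gm: "0 < \<kappa> * g ^ m" using \<kappa>_pos g by simp
  have B0: "0 \<le> B" using gm \<eta> by (simp add: B_def)
  have gme: "g ^ m \<le> g ^ e1" "g ^ m \<le> g ^ e2" using g by (auto simp: m_def intro!: power_decreasing)
  define A where "A = Z - {j}"
  have A: "finite A" "A \<subseteq> {0..1}" "card H = card A" "j \<notin> A" "Z = insert j A" "set_schur H A = s j"
    using Z j r by (auto simp: A_def s_def)
  have node_term: "\<bar>poly q z\<bar> / \<bar>\<Prod>a\<in>A - {z}. z - a\<bar> \<le> B" if z: "z \<in> A" for z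
  proof -
    have zZ: "z \<in> Z" "z \<noteq> j" using z A by auto
    have "Z - {z} = insert j (A - {z})" using A zZ by auto
    then have "w z = (z - j) * (\<Prod>a\<in>A - {z}. z - a)" using A by (simp add: w_def)
    moreover have "\<bar>z - j\<bar> \<le> 1" using subsetD[OF Z(2) zZ(1)] subsetD[OF Z(2) j] by auto
    ultimately have wle: "\<bar>w z\<bar> \<le> \<bar>\<Prod>a\<in>A - {z}. z - a\<bar>"
      by (simp add: abs_mult mult_left_le_one_le)
    have "\<bar>poly q z\<bar> / \<bar>\<Prod>a\<in>A - {z}. z - a\<bar> \<le> \<bar>poly q z\<bar> / \<bar>w z\<bar>"
      using wle w_pos[OF zZ(1)] by (intro divide_left_mono) (auto intro!: mult_pos_pos)
    also have "\<dots> \<le> \<eta> / (\<kappa> * s z)"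
    proof -
      have "\<bar>poly q z\<bar> * (\<kappa> * s z) = \<bar>\<alpha> z * poly q z\<bar> * \<bar>w z\<bar>"
        by (simp add: \<kappa>[OF zZ(1), symmetric] abs_mult mult_ac)
      also have "\<dots> \<le> \<eta> * \<bar>w z\<bar>" using node_bound[OF zZ(1)] by (intro mult_right_mono) auto
      finally show ?thesis using w_pos[OF zZ(1)] \<kappa>_pos s_pos[OF zZ(1)]
        by (simp add: field_simps)
    qed
    also have "\<dots> \<le> B"
      unfolding B_def using \<eta> \<kappa>_pos s_low[OF zZ(1)] gme gm g(1)
      by (intro divide_left_mono mult_left_mono mult_pos_pos s_pos zZ) auto
    finally show ?thesis .
  qed
  have coeff_term: "\<bar>coeff q k\<bar> \<le> B" if k: "k \<in> {..n} - H" for k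
  proof -
    have pos: "0 < set_schur (insert k H) Z" using s'_low[OF k] g by (meson less_le_trans zero_less_power)
    have "\<bar>\<alpha> j * w j * set_schur (insert k H) Z\<bar> = \<bar>s j * \<beta> k\<bar>"
      unfolding w_def s_def \<beta>_def using H(1) Z(1,3) ann j k by (intro annihilator_moment) auto
    then have "\<bar>\<beta> k\<bar> = \<kappa> * set_schur (insert k H) Z"
      using \<kappa>[OF j] s_pos[OF j] pos by (auto simp: abs_mult)
    then have "\<bar>coeff q k\<bar> * (\<kappa> * set_schur (insert k H) Z) \<le> \<eta>"
      using coeff_bound[OF k] by (simp add: abs_mult)
    then have "\<bar>coeff q k\<bar> \<le> \<eta> / (\<kappa> * set_schur (insert k H) Z)"
      using \<kappa>_pos pos by (simp add: pos_le_divide_eq)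
    also have "\<dots> \<le> B"
      unfolding B_def using \<eta> \<kappa>_pos s'_low[OF k] gme gm pos g(1)
      by (intro divide_left_mono mult_left_mono mult_pos_pos) auto
    finally show ?thesis .
  qed
  have "g ^ e1 * \<bar>poly q y\<bar> \<le> s j * \<bar>poly q y\<bar>" using s_low[OF j] by (intro mult_right_mono) auto
  also have "\<dots> \<le> ?N * ((\<Sum>z\<in>A. \<bar>poly q z\<bar> / \<bar>\<Prod>a\<in>A - {z}. z - a\<bar>) + (\<Sum>k\<in>{..n} - H. \<bar>coeff q k\<bar>))"
    using interpolation_bound[OF H A(3,1,2) q y] A(6) by simp
  also have "\<dots> \<le> ?N * ((\<Sum>z\<in>A. B) + (\<Sum>k\<in>{..n} - H. B))"
    using N1 by (intro mult_left_mono add_mono sum_mono node_term coeff_term) auto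
  also have "(\<Sum>z\<in>A. B) + (\<Sum>k\<in>{..n} - H. B) = (real n + 1) * B"
  proof -
    have "card ({..n} - H) = n - r" using H fin r by (simp add: card_Diff_subset)
    moreover have "card A = Suc r" using A(3) r by simp
    ultimately show ?thesis using rn by (simp add: of_nat_diff algebra_simps)
  qed
  finally have main: "g ^ e1 * \<bar>poly q y\<bar> \<le> ?N * ((real n + 1) * B)" .
  (* the exponents: Suc r from kappa, e1 from s j, and m from s z or from the Schur polynomial over insert k H *)
  have "Suc r + e1 + m \<le> X"
  proof -
    have amgm: "4 * (a * b) \<le> (a + b) * (a + b)" for a b :: nat
    proof -
      have "4 * (int a * int b) \<le> (int a + int b) * (int a + int b)"
        using zero_le_square[of "int a - int b"] by (simp add: algebra_simps)
      then show ?thesis by (metis of_nat_add of_nat_le_iff of_nat_mult of_nat_numeral)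
    qed
    have "4 * e1 \<le> n * n" using amgm[of r "n - r"] rn by (simp add: e1_def)
    moreover have "4 * e2 \<le> n * n"
      using amgm[of "Suc r" "n - Suc r"] by (cases "r = n") (use rn in \<open>auto simp: e2_def\<close>)
    ultimately have "(Suc r + e1 + m) * 2 \<le> n * n + 4 * n" using n rn by (auto simp: m_def max_def)
    then show ?thesis unfolding X by (simp only: less_eq_div_iff_mult_less_eq zero_less_numeral)
  qed
  then have "g ^ X * \<bar>poly q y\<bar> \<le> g ^ (Suc r + e1 + m) * \<bar>poly q y\<bar>"
    using g by (intro mult_right_mono power_decreasing) auto
  also have "\<dots> = g ^ Suc r * (g ^ m * (g ^ e1 * \<bar>poly q y\<bar>))" by (simp add: power_add mult_ac)
  also have "\<dots> \<le> ((real r + 2) * ?N * \<kappa>) * (g ^ m * (?N * ((real n + 1) * B)))"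
    using main \<kappa>_low \<kappa>0 N1 g
    by (intro mult_mono[OF \<kappa>_low] mult_left_mono[OF main] mult_nonneg_nonneg) auto
  also have "\<dots> = (real r + 2) * (?N\<^sup>2 * (real n + 1)) * ((\<kappa> * g ^ m) * B)"
    by (simp add: power2_eq_square mult_ac)
  also have "(\<kappa> * g ^ m) * B = \<eta>"
    unfolding B_def using less_imp_neq[OF gm] by (metis nonzero_mult_div_cancel_left times_divide_eq_right)
  also have "(real r + 2) * (?N\<^sup>2 * (real n + 1)) * \<eta> \<le> (real n + 2) * (?N\<^sup>2 * (real n + 1)) * \<eta>"
    using rn \<eta> by (intro mult_right_mono) auto
  finally show ?thesis by (simp add: mult_ac)
qed

section \<open>Markov's inequality on the unit interval\<close>

fun chebyshev_poly :: "nat \<Rightarrow> real poly" where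
  "chebyshev_poly 0 = 1"
| "chebyshev_poly (Suc 0) = [:0, 1:]"
| "chebyshev_poly (Suc (Suc n)) = [:0, 2:] * chebyshev_poly (Suc n) - chebyshev_poly n"

lemma poly_chebyshev_poly_cos: "poly (chebyshev_poly n) (cos t) = cos (real n * t)"
proof (induction n rule: chebyshev_poly.induct)
  case (3 n)
  have "cos (real (Suc n) * t + t) + cos (real (Suc n) * t - t) = 2 * cos (real (Suc n) * t) * cos t"
    by (simp add: cos_add cos_diff)
  moreover have "real (Suc n) * t + t = real (Suc (Suc n)) * t" "real (Suc n) * t - t = real n * t"
    by (auto simp: algebra_simps)
  ultimately show ?case using 3 by (simp add: algebra_simps)
qed auto

lemma degree_chebyshev_poly: "degree (chebyshev_poly n) \<le> n"
proof (induction n rule: chebyshev_poly.induct)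
  case (3 n)
  have "degree ([:0, 2:] * chebyshev_poly (Suc n)) \<le> Suc (Suc n)"
    using 3 degree_mult_le[of "[:0, 2:]" "chebyshev_poly (Suc n)"] by simp
  moreover have "degree (chebyshev_poly n) \<le> Suc (Suc n)" using 3 by simp
  ultimately show ?case by (simp only: chebyshev_poly.simps degree_diff_le)
qed auto

lemma poly_pderiv_chebyshev_poly_1: "poly (chebyshev_poly n) 1 = 1 \<and> poly (pderiv (chebyshev_poly n)) 1 = (real n)\<^sup>2"
  by (induction n rule: chebyshev_poly.induct)
     (auto simp: pderiv_diff pderiv_mult pderiv_smult pderiv_pCons power2_eq_square algebra_simps)

text \<open>If the derivative of \<open>p\<close> at \<open>1\<close> were too large, a combination \<open>r\<close> of \<open>p\<close> and the Chebyshev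
  polynomial would have derivative \<open>0\<close> at \<open>1\<close> and still alternate at the \<open>n + 1\<close> extremal
  points of the latter. Then \<open>r\<close> has \<open>n\<close> zeros in between, and by Rolle its derivative has
  \<open>n - 1\<close> zeros besides \<open>1\<close>, too many for its degree.\<close>

lemma markov_endpoint_upper:
  fixes p :: "real poly"
  assumes deg: "degree p \<le> n" and B: "\<And>x. x \<in> {-1..1} \<Longrightarrow> \<bar>poly p x\<bar> \<le> B"
  shows "poly (pderiv p) 1 \<le> (real n)\<^sup>2 * B"
proof (rule ccontr)
  assume "\<not> ?thesis"
  then have big: "(real n)\<^sup>2 * B < poly (pderiv p) 1" by simp
  have B0: "0 \<le> B" using B[of 0] by simp
  have n: "0 < n"
  proof (rule ccontr)
    assume "\<not> 0 < n"
    then have "pderiv p = 0" using deg by (simp add: pderiv_eq_0_iff)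
    then show False using big B0 \<open>\<not> 0 < n\<close> by simp
  qed
  (* c > 0 dominates n^2 * p, while both polynomials combined in r have equal derivatives at 1 *)
  define c where "c = poly (pderiv p) 1"
  define r where "r = Polynomial.smult c (chebyshev_poly n) - Polynomial.smult ((real n)\<^sup>2) p"
  define x where "x j = cos (real j * pi / real n)" for j
  have x_less: "x j < x i" if "i < j" "j \<le> n" for i j
  proof -
    have "real i * pi / real n < real j * pi / real n" using that n by (simp add: divide_strict_right_mono)
    moreover have "real j * pi / real n \<le> pi" using that n by (simp add: pos_divide_le_eq)
    ultimately show ?thesis unfolding x_def using n by (intro cos_monotone_0_pi) auto
  qed
  have x_le: "x j \<le> x i" if "i \<le> j" "j \<le> n" for i j
    using x_less[of i j] that by (cases "i = j") auto
  have val: "0 < (-1) ^ j * poly r (x j)" if "j \<le> n" for j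
  proof -
    have "poly (chebyshev_poly n) (x j) = cos (real j * pi)"
      unfolding x_def poly_chebyshev_poly_cos using n by simp
    then have "poly (chebyshev_poly n) (x j) = (-1) ^ j" by (simp add: cos_npi mult.commute)
    then have eq: "(-1) ^ j * poly r (x j) = c - (-1) ^ j * ((real n)\<^sup>2 * poly p (x j))"
      by (simp add: r_def algebra_simps flip: power_mult_distrib)
    have "\<bar>(-1) ^ j * ((real n)\<^sup>2 * poly p (x j))\<bar> \<le> (real n)\<^sup>2 * B"
      using B[of "x j"] by (simp add: abs_mult x_def mult_left_mono)
    then show ?thesis using big unfolding eq c_def by linarith
  qed
  have "\<exists>y. x (Suc j) < y \<and> y < x j \<and> poly r y = 0" if "j < n" for j
  proof -
    have "0 < ((-1) ^ j * poly r (x j)) * ((-1) ^ Suc j * poly r (x (Suc j)))"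
      using that by (intro mult_pos_pos[OF val val]) simp_all
    also have "\<dots> = - (poly r (x j) * poly r (x (Suc j)))"
      by (simp add: power_mult_distrib[symmetric] mult_ac)
    finally have "poly r (x (Suc j)) * poly r (x j) < 0" by (simp add: mult.commute)
    from poly_IVT[OF x_less[of j "Suc j"] this] show ?thesis using that by auto
  qed
  then obtain y where y: "\<And>j. j < n \<Longrightarrow> x (Suc j) < y j \<and> y j < x j \<and> poly r (y j) = 0" by metis
  have y_less: "y j < y i" if "i < j" "j < n" for i j
    using y[of i] y[of j] x_le[of "Suc i" j] that by auto
  have y_le: "y j \<le> y i" if "i \<le> j" "j < n" for i j
    using y_less[of i j] that by (cases "i = j") auto
  have "\<exists>z. y (Suc j) < z \<and> z < y j \<and> poly (pderiv r) z = 0" if "Suc j < n" for j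
  proof -
    have "y (Suc j) < y j" using y_less[of j "Suc j"] that by simp
    from poly_MVT[OF this, of r] show ?thesis
      using y[of j] y[of "Suc j"] that \<open>y (Suc j) < y j\<close> by auto
  qed
  then obtain z where z: "\<And>j. Suc j < n \<Longrightarrow> y (Suc j) < z j \<and> z j < y j \<and> poly (pderiv r) (z j) = 0" by metis
  have z_less: "z j < z i" if "i < j" "Suc j < n" for i j
    using z[of i] z[of j] y_le[of "Suc i" j] that by auto
  have z1: "z j < 1" if "Suc j < n" for j
  proof -
    have "z j < x j" using z[of j] y[of j] that by auto
    also have "x j \<le> 1" by (simp add: x_def)
    finally show ?thesis .
  qed
  have inj: "inj_on z {..<n - 1}"
    by (intro linorder_inj_onI) (metis less_diff_conv lessThan_iff less_irrefl z_less Suc_eq_plus1, auto)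
  have nz: "pderiv r \<noteq> 0"
  proof
    assume "pderiv r = 0"
    then have "degree r = 0" by (simp add: pderiv_eq_0_iff)
    then obtain a where "r = [:a:]" by (metis degree_eq_zeroE)
    then show False using val[of 0] val[of 1] n by simp
  qed
  have "insert 1 (z ` {..<n - 1}) \<subseteq> {t. poly (pderiv r) t = 0}"
    using z poly_pderiv_chebyshev_poly_1[of n] by (auto simp: r_def pderiv_diff pderiv_smult c_def)
  then have "card (insert 1 (z ` {..<n - 1})) \<le> card {t. poly (pderiv r) t = 0}"
    using poly_roots_finite[OF nz] by (intro card_mono)
  also have "\<dots> \<le> degree (pderiv r)" using nz by (rule card_poly_roots_bound)
  also have "\<dots> \<le> n - 1"
    using deg degree_chebyshev_poly[of n] by (auto simp: degree_pderiv r_def intro!: diff_le_mono degree_diff_le)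
  finally have "card (insert 1 (z ` {..<n - 1})) \<le> n - 1" .
  moreover have "card (insert 1 (z ` {..<n - 1})) = Suc (n - 1)"
  proof -
    have "1 \<notin> z ` {..<n - 1}" using z1
      by (metis Suc_eq_plus1 imageE less_diff_conv lessThan_iff less_irrefl)
    then show ?thesis using card_image[OF inj] by simp
  qed
  ultimately show False by simp
qed

lemma markov_endpoint:
  fixes p :: "real poly"
  assumes deg: "degree p \<le> n" and B: "\<And>x. x \<in> {-1..1} \<Longrightarrow> \<bar>poly p x\<bar> \<le> B"
  shows "\<bar>poly (pderiv p) 1\<bar> \<le> (real n)\<^sup>2 * B"
  using markov_endpoint_upper[OF deg B] markov_endpoint_upper[of "- p" n B] deg B
  by (simp add: pderiv_minus abs_le_iff)

text \<open>Apply the estimate at an endpoint to the longer one of the intervals between \<open>t\<close> and the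
  endpoints of the unit interval. Its length is at least \<open>1 / 2\<close>, which costs a factor \<open>2\<close> against
  the sharp constant \<open>2 * n\<^sup>2\<close> for the unit interval.\<close>

lemma markov_unit_interval:
  fixes p :: "real poly"
  assumes deg: "degree p \<le> n" and B: "\<And>x. x \<in> {0..1} \<Longrightarrow> \<bar>poly p x\<bar> \<le> B" and t: "t \<in> {0..1}"
  shows "\<bar>poly (pderiv p) t\<bar> \<le> 4 * (real n)\<^sup>2 * B"
proof -
  have B0: "0 \<le> B" using B[of 0] by simp
  (* the affine map sends 1 to t and the interval [-1, 1] into the unit interval *)
  define b where "b = (if 1 / 2 \<le> t then t / 2 else (t - 1) / 2)"
  define P where "P = pcompose p [:t - b, b:]"
  have b: "1 / 4 \<le> \<bar>b\<bar>" using t by (auto simp: b_def)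
  have in01: "t - b + u * b \<in> {0..1}" if u: "u \<in> {-1..1}" for u
  proof -
    have "t - b + u * b = (1 - u) / 2 * (t - 2 * b) + (1 + u) / 2 * t" by (simp add: field_simps)
    moreover have "t - 2 * b = 0 \<or> t - 2 * b = 1" by (auto simp: b_def field_simps)
    then have "t - 2 * b \<in> {0..1}" by auto
    ultimately show ?thesis
      using convexD[OF convex_real_interval(5)[of 0 1], of "t - 2 * b" t "(1 - u) / 2" "(1 + u) / 2"] t u
      by (simp add: field_simps)
  qed
  have "degree P \<le> n" using deg degree_pcompose_le[of p "[:t - b, b:]"]
    by (simp add: P_def split: if_splits)
  moreover have "\<bar>poly P u\<bar> \<le> B" if "u \<in> {-1..1}" for u
    using B[OF in01[OF that]] by (simp add: P_def poly_pcompose)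
  ultimately have "\<bar>poly (pderiv P) 1\<bar> \<le> (real n)\<^sup>2 * B" by (rule markov_endpoint)
  also have "poly (pderiv P) 1 = poly (pderiv p) t * b"
    by (simp add: P_def pderiv_pcompose poly_pcompose pderiv_pCons)
  finally have "\<bar>poly (pderiv p) t\<bar> * \<bar>b\<bar> \<le> (real n)\<^sup>2 * B" by (simp add: abs_mult)
  moreover have "\<bar>poly (pderiv p) t\<bar> * (1 / 4) \<le> \<bar>poly (pderiv p) t\<bar> * \<bar>b\<bar>"
    using b by (intro mult_left_mono) auto
  ultimately show ?thesis by simp
qed

lemma poly_lipschitz_unit_interval:
  fixes p :: "real poly"
  assumes deg: "degree p \<le> n" and B: "\<And>x. x \<in> {0..1} \<Longrightarrow> \<bar>poly p x\<bar> \<le> B"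
    and xy: "x \<in> {0..1}" "y \<in> {0..1}"
  shows "\<bar>poly p x - poly p y\<bar> \<le> 4 * (real n)\<^sup>2 * B * \<bar>x - y\<bar>"
proof -
  have less: "\<bar>poly p b - poly p a\<bar> \<le> 4 * (real n)\<^sup>2 * B * \<bar>b - a\<bar>"
    if ab: "a < b" "a \<in> {0..1}" "b \<in> {0..1}" for a b
  proof -
    obtain t where t: "a < t" "t < b" "poly p b - poly p a = (b - a) * poly (pderiv p) t"
      using poly_MVT[OF ab(1), of p] by auto
    have "\<bar>poly (pderiv p) t\<bar> \<le> 4 * (real n)\<^sup>2 * B"
      using t ab by (intro markov_unit_interval[OF deg B]) auto
    then have "\<bar>b - a\<bar> * \<bar>poly (pderiv p) t\<bar> \<le> \<bar>b - a\<bar> * (4 * (real n)\<^sup>2 * B)"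
      by (intro mult_left_mono) auto
    then show ?thesis unfolding t(3) abs_mult by (simp add: mult_ac)
  qed
  show ?thesis using less[of x y] less[of y x] xy
    by (cases x y rule: linorder_cases) (auto simp: abs_minus_commute)
qed

section \<open>Duality for finitely many linear inequalities\<close>

lemma convergent_subsequence_finite:
  fixes u :: "nat \<Rightarrow> 'i \<Rightarrow> real"
  assumes "finite I" "\<And>i. i \<in> I \<Longrightarrow> \<exists>C. \<forall>j. \<bar>u j i\<bar> \<le> C"
  shows "\<exists>(s :: nat \<Rightarrow> nat) l. strict_mono s \<and> (\<forall>i\<in>I. (\<lambda>j. u (s j) i) \<longlonglongrightarrow> l i)"
  using assms
proof (induction I rule: finite_induct)
  case empty
  then show ?case by (auto intro: exI[of _ id] strict_mono_id)
next
  case (insert i I)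
  then obtain s l where s: "strict_mono (s :: nat \<Rightarrow> nat)" "\<forall>i\<in>I. (\<lambda>j. u (s j) i) \<longlonglongrightarrow> l i"
    by auto
  obtain C where "\<forall>j. \<bar>u j i\<bar> \<le> C" using insert.prems by blast
  then have "bounded (range (\<lambda>j. u (s j) i))" by (auto simp: bounded_iff)
  from bounded_imp_convergent_subsequence[OF this]
  obtain l' r where r: "strict_mono (r :: nat \<Rightarrow> nat)" "((\<lambda>j. u (s j) i) \<circ> r) \<longlonglongrightarrow> l'" by blast
  have "(\<lambda>j. u ((s \<circ> r) j) k) \<longlonglongrightarrow> (l(i := l')) k" if "k \<in> insert i I" for k
  proof (cases "k = i")
    case True
    then show ?thesis using r by (simp add: o_def)
  next
    case False
    then have "(\<lambda>j. u (s j) k) \<longlonglongrightarrow> l k" using that s by auto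
    from LIMSEQ_subseq_LIMSEQ[OF this r(1)] show ?thesis using False by (simp add: o_def)
  qed
  moreover have "strict_mono (s \<circ> r)" using s r by (simp add: strict_mono_o)
  ultimately show ?case by blast
qed

lemma minimizer_on_simplex:
  fixes F :: "('i \<Rightarrow> real) \<Rightarrow> real"
  assumes X: "finite X" "X \<noteq> {}"
    and cont: "\<And>u l. (\<And>x. x \<in> X \<Longrightarrow> (\<lambda>j. u j x) \<longlonglongrightarrow> l x) \<Longrightarrow> (\<lambda>j. F (u j)) \<longlonglongrightarrow> F l"
    and bdd: "\<And>\<theta>. 0 \<le> F \<theta>"
  obtains \<theta> where "\<forall>x\<in>X. 0 \<le> \<theta> x" "sum \<theta> X = 1"
    "\<And>\<theta>'. \<forall>x\<in>X. 0 \<le> \<theta>' x \<Longrightarrow> sum \<theta>' X = 1 \<Longrightarrow> F \<theta> \<le> F \<theta>'"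
proof -
  define S where "S = {\<theta> :: 'i \<Rightarrow> real. (\<forall>x\<in>X. 0 \<le> \<theta> x) \<and> sum \<theta> X = 1}"
  obtain x0 where x0: "x0 \<in> X" using X by auto
  have "(\<lambda>x. if x = x0 then 1 else 0) \<in> S" using X x0 by (simp add: S_def)
  then have ne: "F ` S \<noteq> {}" by auto
  have bb: "bdd_below (F ` S)" using bdd by (auto intro!: bdd_belowI[of _ 0])
  have "\<exists>\<theta>\<in>S. F \<theta> < Inf (F ` S) + 1 / real (Suc j)" for j
    using cInf_lessD[OF ne, of "Inf (F ` S) + 1 / real (Suc j)"] by auto
  then obtain u where u: "\<And>j. u j \<in> S" "\<And>j. F (u j) < Inf (F ` S) + 1 / real (Suc j)" by metis
  have ubdd: "\<exists>C. \<forall>j. \<bar>u j x\<bar> \<le> C" if x: "x \<in> X" for x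
  proof (intro exI[of _ 1] allI)
    fix j
    have "u j x \<le> sum (u j) X" using u(1)[of j] x X by (intro member_le_sum) (auto simp: S_def)
    then show "\<bar>u j x\<bar> \<le> 1" using u(1)[of j] x by (auto simp: S_def)
  qed
  obtain s l where s: "strict_mono (s :: nat \<Rightarrow> nat)" "\<forall>x\<in>X. (\<lambda>j. u (s j) x) \<longlonglongrightarrow> l x"
    using convergent_subsequence_finite[OF X(1), of u] ubdd by blast
  have "(\<lambda>j. sum (u (s j)) X) \<longlonglongrightarrow> sum l X" using s by (intro tendsto_sum) auto
  moreover have "(\<lambda>j. sum (u (s j)) X) = (\<lambda>j. 1)" using u by (auto simp: S_def)
  ultimately have "sum l X = 1" using LIMSEQ_unique[of "\<lambda>j. 1::real" 1 "sum l X"] by simp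
  moreover have "0 \<le> l x" if "x \<in> X" for x
    using s(2) that u(1) by (intro LIMSEQ_le_const[of "\<lambda>j. u (s j) x"]) (auto simp: S_def)
  moreover have "F l \<le> F \<theta>'" if "\<forall>x\<in>X. 0 \<le> \<theta>' x" "sum \<theta>' X = 1" for \<theta>'
  proof -
    have "(\<lambda>j. F (u (s j))) \<longlonglongrightarrow> F l" using s(2) by (intro cont) auto
    moreover have "(\<lambda>j. Inf (F ` S) + 1 / real (Suc (s j))) \<longlonglongrightarrow> Inf (F ` S) + 0"
      using LIMSEQ_subseq_LIMSEQ[OF LIMSEQ_inverse_real_of_nat s(1)]
      by (intro tendsto_add tendsto_const) (simp add: o_def inverse_eq_divide)
    moreover have "F (u (s j)) \<le> Inf (F ` S) + 1 / real (Suc (s j))" for j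
      using u(2)[of "s j"] by simp
    ultimately have "F l \<le> Inf (F ` S) + 0" by (intro LIMSEQ_le) auto
    also have "\<dots> \<le> F \<theta>'" using that bb by (auto simp: S_def intro!: cInf_lower)
    finally show ?thesis .
  qed
  ultimately show thesis by (intro that[of l]) auto
qed

lemma nonneg_linear_of_quadratic:
  fixes b c :: real
  assumes "\<And>t. 0 < t \<Longrightarrow> t \<le> 1 \<Longrightarrow> 0 \<le> t * b + t\<^sup>2 * c" and "0 \<le> c"
  shows "0 \<le> b"
proof (rule ccontr)
  assume b: "\<not> 0 \<le> b"
  define t where "t = min 1 (- b / (2 * (c + 1)))"
  have "0 < - b / (2 * (c + 1))" using b assms(2) by (intro divide_pos_pos) auto
  then have t: "0 < t" "t \<le> 1" "t \<le> - b / (2 * (c + 1))" by (auto simp: t_def)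
  have "t * (c + 1) \<le> - b / 2" using t(3) assms(2) by (simp add: field_simps)
  then have "t * c < - b" using b t by (simp add: distrib_left)
  then have "t * (t * c) < t * - b" using t by (intro mult_strict_left_mono)
  then show False using assms(1)[OF t(1,2)] by (simp add: power2_eq_square)
qed

text \<open>The projection of a coordinate onto its admissible directions: a coefficient at its lower bound
  may only grow, one at its upper bound may only decrease, and one at both bounds is fixed.\<close>

definition cone_part :: "nat set \<Rightarrow> nat set \<Rightarrow> nat \<Rightarrow> real \<Rightarrow> real" where
  "cone_part lo up i v = (if i \<in> lo \<and> i \<in> up then 0 else if i \<in> lo then max 0 v
     else if i \<in> up then min 0 v else v)"

lemma cone_part_square_add: "(cone_part lo up i (v + d))\<^sup>2 \<le> (cone_part lo up i v + d)\<^sup>2"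
proof -
  have "\<bar>max 0 (v + d)\<bar> \<le> \<bar>max 0 v + d\<bar>" "\<bar>min 0 (v + d)\<bar> \<le> \<bar>min 0 v + d\<bar>" by auto
  then show ?thesis by (auto simp: cone_part_def abs_le_square_iff[symmetric])
qed

lemma cone_part_mult_self: "cone_part lo up i v * v = (cone_part lo up i v)\<^sup>2"
  by (auto simp: cone_part_def power2_eq_square max_def min_def)

lemma isCont_cone_part: "isCont (cone_part lo up i) v"
  unfolding cone_part_def by (cases "i \<in> lo"; cases "i \<in> up") (auto intro!: continuous_intros)

text \<open>A theorem of the alternative. Minimize the squared length of the projection of a convex
  combination of the vectors \<open>G x\<close> onto the admissible directions. If the minimum is positive, its
  gradient, the projected vector \<open>q\<close>, solves the inequalities by the first-order condition; if it
  is \<open>0\<close>, the minimizer is the certificate.\<close>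

lemma finite_alternative:
  fixes G :: "'i \<Rightarrow> nat \<Rightarrow> real"
  assumes X: "finite X" "X \<noteq> {}"
    and infeasible: "\<not> (\<exists>q. (\<forall>x\<in>X. 0 < (\<Sum>i\<le>n. q i * G x i)) \<and>
       (\<forall>i\<le>n. (i \<in> lo \<longrightarrow> 0 \<le> q i) \<and> (i \<in> up \<longrightarrow> q i \<le> 0)))"
  obtains \<theta> where "\<forall>x\<in>X. 0 \<le> \<theta> x" "sum \<theta> X = 1"
    "\<And>i. i \<le> n \<Longrightarrow> cone_part lo up i (\<Sum>x\<in>X. \<theta> x * G x i) = 0"
proof -
  define V where "V \<theta> i = (\<Sum>x\<in>X. \<theta> x * G x i)" for \<theta> i
  define F where "F \<theta> = (\<Sum>i\<le>n. (cone_part lo up i (V \<theta> i))\<^sup>2)" for \<theta>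
  obtain \<theta> where \<theta>: "\<forall>x\<in>X. 0 \<le> \<theta> x" "sum \<theta> X = 1"
    and min: "\<And>\<theta>'. \<forall>x\<in>X. 0 \<le> \<theta>' x \<Longrightarrow> sum \<theta>' X = 1 \<Longrightarrow> F \<theta> \<le> F \<theta>'"
  proof (rule minimizer_on_simplex[OF X, of F])
    show "(\<lambda>j. F (u j)) \<longlonglongrightarrow> F l" if "\<And>x. x \<in> X \<Longrightarrow> (\<lambda>j. u j x) \<longlonglongrightarrow> l x" for u l
      unfolding F_def V_def
      by (intro tendsto_intros isCont_tendsto_compose[OF isCont_cone_part] that)
    show "0 \<le> F \<theta>" for \<theta> by (simp add: F_def sum_nonneg)
  qed blast
  define q where "q i = cone_part lo up i (V \<theta> i)" for i
  have "F \<theta> = 0"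
  proof (rule ccontr)
    assume "F \<theta> \<noteq> 0"
    moreover have "0 \<le> F \<theta>" by (simp add: F_def sum_nonneg)
    ultimately have pos: "0 < F \<theta>" by simp
    have "0 < (\<Sum>i\<le>n. q i * G x i)" if x: "x \<in> X" for x
    proof -
      define d where "d i = G x i - V \<theta> i" for i
      have "0 \<le> 2 * (\<Sum>i\<le>n. q i * d i)"
      proof (rule nonneg_linear_of_quadratic)
        fix t :: real assume t: "0 < t" "t \<le> 1"
        (* move the minimizer a step t towards the vertex x of the simplex *)
        define \<theta>' where "\<theta>' z = (1 - t) * \<theta> z + (if z = x then t else 0)" for z
        have "sum \<theta>' X = 1" using X x \<theta> by (simp add: \<theta>'_def sum.distrib flip: sum_distrib_left)
        moreover have "\<forall>z\<in>X. 0 \<le> \<theta>' z" using t \<theta> by (auto simp: \<theta>'_def)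
        ultimately have "F \<theta> \<le> F \<theta>'" by (intro min)
        also have "V \<theta>' i = V \<theta> i + t * d i" for i
        proof -
          have "V \<theta>' i = (\<Sum>z\<in>X. (1 - t) * (\<theta> z * G z i) + (if z = x then t * G x i else 0))"
            unfolding V_def \<theta>'_def by (intro sum.cong) (auto simp: algebra_simps)
          also have "\<dots> = (1 - t) * V \<theta> i + t * G x i"
            using X x by (simp add: sum.distrib V_def flip: sum_distrib_left)
          finally show ?thesis by (simp add: d_def algebra_simps)
        qed
        then have "F \<theta>' \<le> (\<Sum>i\<le>n. (q i + t * d i)\<^sup>2)"
          unfolding F_def q_def by (auto intro!: sum_mono cone_part_square_add)
        also have "\<dots> = F \<theta> + (t * (2 * (\<Sum>i\<le>n. q i * d i)) + t\<^sup>2 * (\<Sum>i\<le>n. (d i)\<^sup>2))"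
          unfolding F_def q_def[symmetric] sum_distrib_left sum.distrib[symmetric]
          by (intro sum.cong) (auto simp: power2_eq_square algebra_simps)
        finally show "0 \<le> t * (2 * (\<Sum>i\<le>n. q i * d i)) + t\<^sup>2 * (\<Sum>i\<le>n. (d i)\<^sup>2)" by simp
      qed (simp add: sum_nonneg)
      then have "(\<Sum>i\<le>n. q i * V \<theta> i) \<le> (\<Sum>i\<le>n. q i * G x i)"
        by (simp add: d_def algebra_simps sum_subtractf)
      moreover have "(\<Sum>i\<le>n. q i * V \<theta> i) = F \<theta>"
        unfolding F_def q_def by (intro sum.cong cone_part_mult_self) auto
      ultimately show ?thesis using pos by simp
    qed
    moreover have "(i \<in> lo \<longrightarrow> 0 \<le> q i) \<and> (i \<in> up \<longrightarrow> q i \<le> 0)" for i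
      by (auto simp: q_def cone_part_def)
    ultimately show False using infeasible by blast
  qed
  then have "q i = 0" if "i \<le> n" for i
    using that unfolding F_def q_def[symmetric] by (simp add: sum_nonneg_eq_0_iff)
  then show thesis using \<theta> by (intro that[of \<theta>]) (auto simp: q_def V_def)
qed

section \<open>Certificates of minimal support\<close>

lemma cone_part_zero_mono:
  assumes "cone_part lo up i v = 0" "0 \<le> v * v'" "v = 0 \<Longrightarrow> v' = 0"
  shows "cone_part lo up i v' = 0"
  using assms by (auto simp: cone_part_def max_def min_def zero_le_mult_iff split: if_splits)

text \<open>The analogue of the alternation in Chebyshev's theorem: Schur polynomials are positive, so the
  signs of the weights are those of the Vandermonde products, which alternate.\<close>

lemma annihilator_alternates:
  fixes \<alpha> :: "real \<Rightarrow> real"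
  assumes H: "H \<subseteq> {..n}" "0 \<in> H" and Z: "finite Z" "Z \<subseteq> {0..}" "card Z = Suc (card H)"
    and ann: "\<And>h. h \<in> H \<Longrightarrow> (\<Sum>z\<in>Z. \<alpha> z * z ^ h) = 0"
    and z: "z \<in> Z" "z' \<in> Z" "z < z'" "\<And>i. i \<in> Z \<Longrightarrow> \<not> (z < i \<and> i < z')"
    and nz: "\<alpha> z \<noteq> 0" "\<alpha> z' \<noteq> 0"
  shows "\<alpha> z * \<alpha> z' < 0"
proof -
  have fin: "finite H" using H finite_subset by blast
  define w where "w z = (\<Prod>i\<in>Z - {z}. z - i)" for z
  define s where "s z = set_schur H (Z - {z})" for z
  have s: "0 < s x" if "x \<in> Z" for x
    unfolding s_def using that Z H fin by (intro set_schur_pos) auto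
  have "\<alpha> z * w z * s z' = \<alpha> z' * w z' * s z"
    unfolding w_def s_def using H(1) Z(1,3) ann z(1,2) by (rule annihilator_weight_ratio)
  then have "(\<alpha> z * w z * s z') * (\<alpha> z' * w z' * s z) = (\<alpha> z * w z * s z')\<^sup>2"
    by (simp add: power2_eq_square)
  moreover have w: "w z \<noteq> 0" "w z' \<noteq> 0" using Z by (auto simp: w_def)
  ultimately have "0 < (\<alpha> z * w z * s z') * (\<alpha> z' * w z' * s z)"
    using nz s[OF z(2)] by simp
  also have "\<dots> = (s z * s z') * ((\<alpha> z * \<alpha> z') * (w z * w z'))" by (simp add: mult_ac)
  finally have pos: "0 < (\<alpha> z * \<alpha> z') * (w z * w z')"
    using mult_pos_pos[OF s[OF z(1)] s[OF z(2)]] by (rule zero_less_mult_pos)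
  define A where "A = Z - {z, z'}"
  have A: "finite A" "z \<notin> A" "z' \<notin> A" "Z - {z} = insert z' A" "Z - {z'} = insert z A"
    using Z z by (auto simp: A_def)
  have "0 < (\<Prod>i\<in>A. (z - i) * (z' - i))"
  proof (rule prod_pos)
    fix i assume "i \<in> A"
    then have "i < z \<or> z' < i" using z(4)[of i] by (auto simp: A_def)
    then show "0 < (z - i) * (z' - i)" using z(3) by (auto intro: mult_pos_pos mult_neg_neg)
  qed
  moreover have "w z * w z' = - ((z' - z)\<^sup>2 * (\<Prod>i\<in>A. (z - i) * (z' - i)))"
  proof -
    have "w z = (z - z') * (\<Prod>i\<in>A. z - i)" "w z' = (z' - z) * (\<Prod>i\<in>A. z' - i)"
      using A by (simp_all add: w_def)
    moreover have "(z - z') * P * ((z' - z) * Q) = - ((z' - z)\<^sup>2 * (P * Q))" for P Q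
      by (simp add: power2_eq_square algebra_simps)
    ultimately show ?thesis by (simp only: prod.distrib)
  qed
  ultimately have "w z * w z' < 0" using z(3) by (simp add: mult_pos_pos)
  with pos show ?thesis by (metis mult.commute mult_nonneg_nonpos not_less order_less_imp_le)
qed

text \<open>Among all certificates take one with the fewest weights and nonzero moments. With fewer than
  \<open>card H + 1\<close> points the Haar property would make the weights zero. With more points there is an
  annihilator of the exponents in \<open>H\<close> that is supported on a proper subset of \<open>Z\<close>; subtracting a
  multiple of it until the first weight or moment vanishes gives a smaller certificate.\<close>

lemma minimal_certificate:
  fixes \<sigma> :: "real \<Rightarrow> real"
  assumes X: "finite X" "X \<subseteq> {0..1}" and \<sigma>: "\<And>x. x \<in> X \<Longrightarrow> \<bar>\<sigma> x\<bar> = 1"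
    and free: "0 \<notin> lo" "0 \<notin> up"
    and \<theta>0: "\<forall>x\<in>X. 0 \<le> \<theta>0 x" "sum \<theta>0 X = 1"
      "\<And>i. i \<le> n \<Longrightarrow> cone_part lo up i (\<Sum>x\<in>X. \<theta>0 x * (\<sigma> x * x ^ i)) = 0"
  obtains Z H \<theta> where "Z \<subseteq> X" "H \<subseteq> {..n}" "0 \<in> H" "card Z = Suc (card H)"
    "\<And>z. z \<in> Z \<Longrightarrow> 0 < \<theta> z" "sum \<theta> Z = 1"
    "\<And>h. h \<in> H \<Longrightarrow> (\<Sum>z\<in>Z. \<theta> z * (\<sigma> z * z ^ h)) = 0"
    "\<And>i. i \<le> n \<Longrightarrow> cone_part lo up i (\<Sum>z\<in>Z. \<theta> z * (\<sigma> z * z ^ i)) = 0"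
proof -
  define V where "V \<theta> i = (\<Sum>x\<in>X. \<theta> x * (\<sigma> x * x ^ i))" for \<theta> i
  define cert where "cert \<theta> \<longleftrightarrow> (\<forall>x\<in>X. 0 \<le> \<theta> x) \<and> 0 < sum \<theta> X \<and>
     (\<forall>i\<le>n. cone_part lo up i (V \<theta> i) = 0)" for \<theta>
  define supp where "supp \<theta> = {x \<in> X. \<theta> x \<noteq> 0}" for \<theta> :: "real \<Rightarrow> real"
  define mom where "mom \<theta> = {i. i \<le> n \<and> V \<theta> i \<noteq> 0}" for \<theta>
  define rank where "rank \<theta> = card (supp \<theta>) + card (mom \<theta>)" for \<theta>
  have fin: "finite (supp \<theta>)" "finite (mom \<theta>)" for \<theta> using X by (auto simp: supp_def mom_def)
  have "cert \<theta>0" using \<theta>0 by (simp add: cert_def V_def)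
  then obtain \<theta> where \<theta>: "cert \<theta>" and min: "\<And>\<theta>'. cert \<theta>' \<Longrightarrow> rank \<theta> \<le> rank \<theta>'"
    using ex_has_least_nat[of cert \<theta>0 rank] by blast
  define Z where "Z = supp \<theta>"
  define H where "H = {..n} - mom \<theta>"
  have Z: "finite Z" "Z \<subseteq> X" "Z \<subseteq> {0..}" using X fin by (auto simp: Z_def supp_def)
  have H: "H \<subseteq> {..n}" "finite H" by (auto simp: H_def)
  have pos: "0 < \<theta> z" if "z \<in> Z" for z using that \<theta> by (force simp: Z_def supp_def cert_def)
  have VH: "V \<theta> h = 0" if "h \<in> H" for h using that by (auto simp: H_def mom_def)
  have H0: "0 \<in> H"
  proof -
    have "cone_part lo up 0 (V \<theta> 0) = 0" using \<theta> by (simp add: cert_def)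
    then show ?thesis using free by (simp add: cone_part_def H_def mom_def)
  qed
  have sumZ: "(\<Sum>x\<in>X. \<theta> x * f x) = (\<Sum>x\<in>Z. \<theta> x * f x)" for f :: "real \<Rightarrow> real"
    using X by (intro sum.mono_neutral_right) (auto simp: Z_def supp_def)
  have "Z \<noteq> {}" using \<theta> sumZ[of "\<lambda>_. 1"] by (auto simp: cert_def)
  have ge: "Suc (card H) \<le> card Z"
  proof (rule ccontr)
    assume "\<not> ?thesis"
    then have "card Z - 1 \<le> card (H - {0})" using H H0 by simp
    then obtain H1 where H1: "H1 \<subseteq> H - {0}" "card H1 = card Z - 1" "finite H1"
      by (rule obtain_subset_with_card_n)
    define H' where "H' = insert 0 H1"
    have H': "H' \<subseteq> H" "0 \<in> H'" "finite H'" "H' \<subseteq> {..n}"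
      using H1 H0 H by (auto simp: H'_def)
    have "0 \<notin> H1" "0 < card Z" using H1 Z \<open>Z \<noteq> {}\<close> by (auto simp: card_gt_0_iff)
    then have cH': "card H' = card Z" using H1 by (simp add: H'_def)
    obtain z where z: "z \<in> Z" using \<open>Z \<noteq> {}\<close> by auto
    have c: "card H' = Suc (card (Z - {z}))" using cH' z Z by (simp add: card_Suc_Diff1 del: card_Diff_insert)
    let ?\<phi> = "vanishing_poly H' (Z - {z})"
    have V: "V \<theta> k = (\<Sum>x\<in>Z. (\<theta> x * \<sigma> x) * x ^ k)" for k
      unfolding V_def sumZ by (simp add: mult.assoc)
    have "(\<Sum>x\<in>Z. (\<theta> x * \<sigma> x) * poly ?\<phi> x) = (\<Sum>k\<le>n. coeff ?\<phi> k * V \<theta> k)"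
      unfolding V by (intro sum_poly_eq_sum_moments degree_vanishing_poly H')
    also have "\<dots> = 0" using coeff_vanishing_poly(1)[OF H'(3)] VH H'(1) by (intro sum.neutral) auto
    also have "(\<Sum>x\<in>Z. (\<theta> x * \<sigma> x) * poly ?\<phi> x) = \<theta> z * \<sigma> z * poly ?\<phi> z"
      using Z z poly_vanishing_poly_zero[of "Z - {z}" H'] H' c
      by (subst sum.remove[OF Z(1) z]) (auto intro!: sum.neutral)
    also have "poly ?\<phi> z = (\<Prod>a\<in>Z - {z}. z - a) * set_schur H' Z"
      using poly_vanishing_poly[of "Z - {z}" H' z] Z H' c z by (simp add: insert_absorb)
    finally have "\<theta> z * \<sigma> z * ((\<Prod>a\<in>Z - {z}. z - a) * set_schur H' Z) = 0" .
    moreover have "0 < set_schur H' Z" using H' cH' Z by (intro set_schur_pos) auto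
    moreover have "\<sigma> z \<noteq> 0" using \<sigma>[of z] z Z by auto
    ultimately show False using pos[OF z] Z by auto
  qed
  have le: "card Z \<le> Suc (card H)"
  proof (rule ccontr)
    assume "\<not> ?thesis"
    then have lt: "Suc (card H) < card Z" by simp
    obtain Z' where Z': "Z' \<subseteq> Z" "card Z' = Suc (card H)" "finite Z'"
      using obtain_subset_with_card_n[of "Suc (card H)" Z] lt by auto
    have "Z' \<noteq> Z" using Z' lt by auto
    then obtain z1 where z1: "z1 \<in> Z" "z1 \<notin> Z'" using Z' by auto
    have "Z' \<subseteq> {0..}" using Z' Z by auto
    from annihilator_exists[OF H(1) H0 Z'(3) this Z'(2)]
    obtain \<alpha>0 where \<alpha>0: "\<exists>z\<in>Z'. \<alpha>0 z \<noteq> 0" "\<And>h. h \<in> H \<Longrightarrow> (\<Sum>z\<in>Z'. \<alpha>0 z * z ^ h) = 0" by blast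
    obtain z0 where z0: "z0 \<in> Z'" "\<alpha>0 z0 \<noteq> 0" using \<alpha>0 by auto
    have \<sigma>0: "\<sigma> z0 \<noteq> 0" using \<sigma>[of z0] z0 Z' Z by auto
    (* orient the annihilator so that subtracting it decreases the weight at z0 *)
    define c where "c = sgn (\<alpha>0 z0 * \<sigma> z0)"
    define \<rho> where "\<rho> x = (if x \<in> Z' then c * \<alpha>0 x * \<sigma> x else 0)" for x
    have "\<rho> z0 = \<bar>\<alpha>0 z0 * \<sigma> z0\<bar>" using z0 unfolding abs_sgn by (simp add: \<rho>_def c_def mult_ac)
    then have \<rho>0: "0 < \<rho> z0" using z0 \<sigma>0 by simp
    have V\<rho>: "V \<rho> i = c * (\<Sum>z\<in>Z'. \<alpha>0 z * z ^ i)" for i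
    proof -
      have "V \<rho> i = (\<Sum>x\<in>Z'. \<rho> x * (\<sigma> x * x ^ i))"
        unfolding V_def using X Z' Z by (intro sum.mono_neutral_right) (auto simp: \<rho>_def)
      also have "\<dots> = (\<Sum>x\<in>Z'. c * (\<alpha>0 x * x ^ i))"
      proof (rule sum.cong[OF refl])
        fix x assume x: "x \<in> Z'"
        then have "\<bar>\<sigma> x\<bar> = 1" using \<sigma> Z' Z by auto
        then have "\<sigma> x * \<sigma> x = 1" by (metis abs_mult_self_eq mult_1)
        moreover have "\<rho> x * (\<sigma> x * x ^ i) = c * (\<alpha>0 x * x ^ i) * (\<sigma> x * \<sigma> x)"
          using x by (simp add: \<rho>_def mult_ac)
        ultimately show "\<rho> x * (\<sigma> x * x ^ i) = c * (\<alpha>0 x * x ^ i)" by simp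
      qed
      finally show ?thesis by (simp add: sum_distrib_left)
    qed
    have V\<rho>H: "V \<rho> i = 0" if "i \<in> H" for i using V\<rho> \<alpha>0(2)[OF that] by simp
    (* step lengths at which a weight or a moment vanishes *)
    define T where "T = (\<lambda>z. \<theta> z / \<rho> z) ` {z \<in> Z'. 0 < \<rho> z}
       \<union> (\<lambda>i. V \<theta> i / V \<rho> i) ` {i \<in> mom \<theta>. 0 < V \<theta> i * V \<rho> i}"
    have T: "finite T" "T \<noteq> {}" using Z' fin z0 \<rho>0 by (auto simp: T_def)
    define t where "t = Min T"
    have tT: "t \<in> T" using Min_in[OF T] by (simp add: t_def)
    have t_le: "t \<le> x" if "x \<in> T" for x using that T by (simp add: t_def)
    have t0: "0 < t"
    proof -
      have "0 < x" if "x \<in> T" for x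
        using that pos Z' unfolding T_def
        by (auto simp: zero_less_divide_iff zero_less_mult_iff)
      then show ?thesis using tT by blast
    qed
    define \<theta>' where "\<theta>' x = \<theta> x - t * \<rho> x" for x
    have V': "V \<theta>' i = V \<theta> i - t * V \<rho> i" for i
      unfolding V_def \<theta>'_def by (simp add: algebra_simps sum_subtractf sum_distrib_left)
    have nonneg: "0 \<le> \<theta>' x" if x: "x \<in> X" for x
    proof (cases "x \<in> Z' \<and> 0 < \<rho> x")
      case True
      then have "t \<le> \<theta> x / \<rho> x" by (intro t_le) (auto simp: T_def)
      then show ?thesis using True by (simp add: \<theta>'_def pos_le_divide_eq)
    next
      case False
      then have "\<rho> x \<le> 0" by (auto simp: \<rho>_def)
      then have "t * \<rho> x \<le> 0" using t0 by (simp add: mult_nonneg_nonpos)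
      moreover have "0 \<le> \<theta> x" using \<theta> x by (auto simp: cert_def)
      ultimately show ?thesis by (simp add: \<theta>'_def)
    qed
    have sgnV: "0 \<le> V \<theta> i * V \<theta>' i" if i: "i \<in> mom \<theta>" for i
    proof (cases "0 < V \<theta> i * V \<rho> i")
      case True
      then have "t \<le> V \<theta> i / V \<rho> i" using i by (intro t_le) (auto simp: T_def)
      then have "t * (V \<theta> i * V \<rho> i) \<le> V \<theta> i / V \<rho> i * (V \<theta> i * V \<rho> i)"
        using True by (intro mult_right_mono) auto
      also have "\<dots> = V \<theta> i * V \<theta> i" using True by auto
      finally show ?thesis by (simp add: V' algebra_simps)
    next
      case False
      then have "t * (V \<theta> i * V \<rho> i) \<le> 0" using t0 by (simp add: mult_nonneg_nonpos)
      then have "t * (V \<theta> i * V \<rho> i) \<le> V \<theta> i * V \<theta> i" by (meson order_trans zero_le_square)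
      then show ?thesis by (simp add: V' algebra_simps)
    qed
    have V'H: "V \<theta>' i = 0" if "i \<le> n" "V \<theta> i = 0" for i
      using that V\<rho>H[of i] by (simp add: V' H_def mom_def)
    have "cert \<theta>'"
    proof -
      have "\<theta>' z1 \<le> sum \<theta>' X" using nonneg z1 Z X by (intro member_le_sum) auto
      moreover have "\<theta>' z1 = \<theta> z1" using z1 by (simp add: \<theta>'_def \<rho>_def)
      ultimately have "0 < sum \<theta>' X" using pos[OF z1(1)] by simp
      moreover have "cone_part lo up i (V \<theta>' i) = 0" if i: "i \<le> n" for i
      proof (rule cone_part_zero_mono)
        show "cone_part lo up i (V \<theta> i) = 0" using \<theta> i by (simp add: cert_def)
        show "0 \<le> V \<theta> i * V \<theta>' i" using sgnV[of i] i by (cases "V \<theta> i = 0") (auto simp: mom_def)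
        show "V \<theta> i = 0 \<Longrightarrow> V \<theta>' i = 0" using V'H i by simp
      qed
      ultimately show ?thesis using nonneg by (simp add: cert_def)
    qed
    moreover have sub: "supp \<theta>' \<subseteq> supp \<theta>" "mom \<theta>' \<subseteq> mom \<theta>"
      using Z'(1) V'H by (auto simp: supp_def mom_def \<theta>'_def \<rho>_def Z_def)
    have "rank \<theta>' < rank \<theta>"
    proof -
      consider z where "z \<in> Z'" "0 < \<rho> z" "t = \<theta> z / \<rho> z"
        | i where "i \<in> mom \<theta>" "0 < V \<theta> i * V \<rho> i" "t = V \<theta> i / V \<rho> i"
        using tT by (auto simp: T_def)
      then show ?thesis
      proof cases
        case 1
        then have "z \<in> supp \<theta>" "z \<notin> supp \<theta>'" using Z' by (auto simp: Z_def supp_def \<theta>'_def)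
        then have "card (supp \<theta>') < card (supp \<theta>)" using sub fin by (intro psubset_card_mono) auto
        moreover have "card (mom \<theta>') \<le> card (mom \<theta>)" using sub fin by (intro card_mono)
        ultimately show ?thesis by (simp add: rank_def)
      next
        case 2
        then have "V \<theta>' i = 0" by (auto simp: V')
        then have "i \<notin> mom \<theta>'" by (simp add: mom_def)
        then have "card (mom \<theta>') < card (mom \<theta>)" using 2 sub fin by (intro psubset_card_mono) auto
        moreover have "card (supp \<theta>') \<le> card (supp \<theta>)" using sub fin by (intro card_mono)
        ultimately show ?thesis by (simp add: rank_def)
      qed
    qed
    ultimately show False using min by fastforce
  qed
  define s where "s = sum \<theta> X"
  have s: "0 < s" "s = sum \<theta> Z" using \<theta> sumZ[of "\<lambda>_. 1"] by (simp_all add: s_def cert_def)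
  have VZ: "(\<Sum>z\<in>Z. \<theta> z / s * (\<sigma> z * z ^ i)) = V \<theta> i / s" for i
    unfolding V_def sumZ by (simp add: sum_divide_distrib)
  show thesis
  proof (rule that[of Z H "\<lambda>z. \<theta> z / s"])
    show "sum (\<lambda>z. \<theta> z / s) Z = 1" using s by (simp flip: sum_divide_distrib)
    show "cone_part lo up i (\<Sum>z\<in>Z. \<theta> z / s * (\<sigma> z * z ^ i)) = 0" if i: "i \<le> n" for i
      unfolding VZ
    proof (rule cone_part_zero_mono)
      show "cone_part lo up i (V \<theta> i) = 0" using \<theta> i by (simp add: cert_def)
      show "0 \<le> V \<theta> i * (V \<theta> i / s)" using s(1) by simp
    qed simp
  qed (use Z H H0 ge le pos s VZ VH in auto)
qed

section \<open>Strong unicity on a finite grid\<close>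

text \<open>A direction that reduces the error at every extremal point and respects the attained bounds
  improves the approximation for small steps.\<close>

lemma descent_contradiction:
  fixes p q :: "real poly" and f :: "real \<Rightarrow> real"
  assumes K: "K = constrained_polys n m k a b" and p: "p \<in> K" and q: "degree q \<le> n"
    and Y: "finite Y" and e: "0 < e" "\<And>y. y \<in> Y \<Longrightarrow> \<bar>f y - poly p y\<bar> \<le> e"
    and best: "\<And>p'. p' \<in> K \<Longrightarrow> \<exists>y\<in>Y. e \<le> \<bar>f y - poly p' y\<bar>"
    and dir: "\<And>y. y \<in> Y \<Longrightarrow> \<bar>f y - poly p y\<bar> = e \<Longrightarrow> 0 < sgn (f y - poly p y) * poly q y"
    and lo: "\<And>i. i \<in> {1..m} \<Longrightarrow> a i = ereal (coeff p (k i)) \<Longrightarrow> 0 \<le> coeff q (k i)"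
    and up: "\<And>i. i \<in> {1..m} \<Longrightarrow> b i = ereal (coeff p (k i)) \<Longrightarrow> coeff q (k i) \<le> 0"
  shows False
proof -
  let ?p = "\<lambda>t. p + Polynomial.smult t q"
  have tp: "((\<lambda>t::real. c + t * d) \<longlongrightarrow> c) (at_right 0)" for c d :: real
    by (auto intro!: tendsto_eq_intros)
  have pos: "\<forall>\<^sub>F t::real in at_right 0. 0 < t" by (simp add: eventually_at_right_less)
  have "\<forall>\<^sub>F t in at_right 0. \<bar>f y - poly (?p t) y\<bar> < e" if y: "y \<in> Y" for y
  proof (cases "\<bar>f y - poly p y\<bar> = e")
    case False
    then have "\<bar>f y - poly p y\<bar> < e" using e(2)[OF y] by simp
    moreover have "((\<lambda>t. \<bar>f y - (poly p y + t * poly q y)\<bar>) \<longlongrightarrow> \<bar>f y - poly p y\<bar>) (at_right 0)"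
      by (intro tendsto_rabs tendsto_diff tendsto_const tp)
    ultimately show ?thesis by (simp add: order_tendstoD(2))
  next
    case True
    define s where "s = sgn (f y - poly p y)"
    define d where "d = s * poly q y"
    have s: "\<bar>s\<bar> = 1" "s * (f y - poly p y) = e"
      using True e(1) unfolding s_def by (auto simp: sgn_if split: if_splits)
    have d: "0 < d" using dir[OF y True] by (simp add: d_def s_def)
    have "\<forall>\<^sub>F t in at_right 0. 0 + t * d < 2 * e" using tp[of 0 d] e(1) by (simp add: order_tendstoD(2))
    with pos show ?thesis
    proof eventually_elim
      case (elim t)
      have "\<bar>f y - poly (?p t) y\<bar> = \<bar>s * (f y - poly (?p t) y)\<bar>" using s by (simp add: abs_mult)
      also have "s * (f y - poly (?p t) y) = e - t * d" using s(2) by (simp add: d_def algebra_simps)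
      also have "\<bar>e - t * d\<bar> < e" using elim d mult_pos_pos[OF elim(1) d] by (simp add: abs_less_iff)
      finally show ?case .
    qed
  qed
  then have "\<forall>\<^sub>F t in at_right 0. \<forall>y\<in>Y. \<bar>f y - poly (?p t) y\<bar> < e"
    using Y by (intro eventually_ball_finite) auto
  moreover have "\<forall>\<^sub>F t in at_right 0. \<forall>i\<in>{1..m}. a i \<le> ereal (coeff (?p t) (k i)) \<and> ereal (coeff (?p t) (k i)) \<le> b i"
  proof (intro eventually_ball_finite ballI eventually_conj)
    fix i assume i: "i \<in> {1..m}"
    have ab: "a i \<le> ereal (coeff p (k i))" "ereal (coeff p (k i)) \<le> b i"
      using p i by (auto simp: K constrained_polys_def)
    have lim: "((\<lambda>t. ereal (coeff (?p t) (k i))) \<longlongrightarrow> ereal (coeff p (k i))) (at_right 0)"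
      using tp[of "coeff p (k i)" "coeff q (k i)"] by simp
    show "\<forall>\<^sub>F t in at_right 0. a i \<le> ereal (coeff (?p t) (k i))"
    proof (cases "a i = ereal (coeff p (k i))")
      case True
      from pos show ?thesis by eventually_elim (use lo[OF i True] True in simp)
    next
      case False
      then have "a i < ereal (coeff p (k i))" using ab by simp
      from order_tendstoD(1)[OF lim this] show ?thesis by eventually_elim simp
    qed
    show "\<forall>\<^sub>F t in at_right 0. ereal (coeff (?p t) (k i)) \<le> b i"
    proof (cases "b i = ereal (coeff p (k i))")
      case True
      from pos show ?thesis by eventually_elim (use up[OF i True] True in \<open>simp add: mult_nonneg_nonpos\<close>)
    next
      case False
      then have "ereal (coeff p (k i)) < b i" using ab by simp
      from order_tendstoD(2)[OF lim this] show ?thesis by eventually_elim simp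
    qed
  qed simp
  ultimately obtain t where t: "\<forall>y\<in>Y. \<bar>f y - poly (?p t) y\<bar> < e"
    "\<forall>i\<in>{1..m}. a i \<le> ereal (coeff (?p t) (k i)) \<and> ereal (coeff (?p t) (k i)) \<le> b i"
    using eventually_happens'[OF _ eventually_conj] trivial_limit_at_right_real by blast
  have "?p t \<in> K"
    using p q t(2) by (auto simp: K constrained_polys_def intro!: degree_add_le degree_smult_le[THEN order_trans])
  from best[OF this] t(1) show False by force
qed

lemma spacing_from_adjacent:
  fixes Z :: "real set"
  assumes Z: "finite Z" and adj: "\<And>z z'. z \<in> Z \<Longrightarrow> z' \<in> Z \<Longrightarrow> z < z' \<Longrightarrow>
      (\<And>i. i \<in> Z \<Longrightarrow> \<not> (z < i \<and> i < z')) \<Longrightarrow> g \<le> z' - z"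
    and xy: "x \<in> Z" "y \<in> Z" "x \<noteq> y"
  shows "g \<le> \<bar>x - y\<bar>"
proof -
  have less: "g \<le> v - u" if uv: "u \<in> Z" "v \<in> Z" "u < v" for u v
  proof -
    define w where "w = Min {i \<in> Z. u < i}"
    have fin: "finite {i \<in> Z. u < i}" and ne: "{i \<in> Z. u < i} \<noteq> {}" using Z uv by auto
    have w: "w \<in> Z" "u < w" using Min_in[OF fin ne] by (auto simp: w_def)
    have min: "w \<le> i" if "i \<in> Z" "u < i" for i using Min_le[OF fin] that by (auto simp: w_def)
    have "g \<le> w - u" using min by (intro adj uv w) (meson not_less)
    then show ?thesis using min[OF uv(2,3)] by simp
  qed
  show ?thesis using less[of x y] less[of y x] xy by (cases x y rule: linorder_cases) auto
qed

text \<open>The hypothesis on the oscillation of the error, with \<open>2 * e\<close> the jump between extremal points of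
  opposite sign, makes the alternating points of the certificate \<open>g\<close>-separated.\<close>

lemma strong_unicity_on_grid:
  fixes p p' :: "real poly" and f :: "real \<Rightarrow> real"
  assumes K: "K = constrained_polys n m k a b" and k: "\<forall>i\<in>{1..m}. 0 < k i \<and> k i \<le> n"
    and p: "p \<in> K" and p': "p' \<in> K"
    and Y: "finite Y" "Y \<subseteq> {0..1}" and e: "0 < e" "\<And>y. y \<in> Y \<Longrightarrow> \<bar>f y - poly p y\<bar> \<le> e"
    and best: "\<And>p'. p' \<in> K \<Longrightarrow> \<exists>y\<in>Y. e \<le> \<bar>f y - poly p' y\<bar>"
    and near: "\<And>y. y \<in> Y \<Longrightarrow> \<bar>f y - poly p' y\<bar> \<le> e + \<eta>" and \<eta>: "0 \<le> \<eta>"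
    and g: "0 < g" "g \<le> 1"
    and osc: "\<And>x y. x \<in> Y \<Longrightarrow> y \<in> Y \<Longrightarrow> \<bar>x - y\<bar> < g \<Longrightarrow>
        \<bar>(f x - poly p x) - (f y - poly p y)\<bar> < 2 * e"
    and X: "X = (n * n + 4 * n) div 2" and n: "1 \<le> n" and y: "y \<in> {0..1}"
  shows "g ^ X * \<bar>poly p' y - poly p y\<bar> \<le> (N_const n)\<^sup>2 * (real n + 2) * (real n + 1) * \<eta>"
proof -
  define E where "E = {y \<in> Y. \<bar>f y - poly p y\<bar> = e}"
  define \<sigma> where "\<sigma> x = sgn (f x - poly p x)" for x
  define lo where "lo = k ` {i \<in> {1..m}. a i = ereal (coeff p (k i))}"
  define up where "up = k ` {i \<in> {1..m}. b i = ereal (coeff p (k i))}"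
  have E: "finite E" "E \<subseteq> {0..1}" using Y by (auto simp: E_def)
  have "E \<noteq> {}" using best[OF p] e(2) by (fastforce simp: E_def)
  have \<sigma>: "\<bar>\<sigma> x\<bar> = 1" "\<sigma> x * (f x - poly p x) = e" if "x \<in> E" for x
    using that e(1) unfolding E_def \<sigma>_def by (auto simp: sgn_if split: if_splits)
  have free: "0 \<notin> lo" "0 \<notin> up" using k by (force simp: lo_def up_def)+
  have infeasible: "\<not> (\<exists>q. (\<forall>x\<in>E. 0 < (\<Sum>i\<le>n. q i * (\<sigma> x * x ^ i))) \<and>
       (\<forall>i\<le>n. (i \<in> lo \<longrightarrow> 0 \<le> q i) \<and> (i \<in> up \<longrightarrow> q i \<le> 0)))"
  proof
    assume "\<exists>q. (\<forall>x\<in>E. 0 < (\<Sum>i\<le>n. q i * (\<sigma> x * x ^ i))) \<and>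
       (\<forall>i\<le>n. (i \<in> lo \<longrightarrow> 0 \<le> q i) \<and> (i \<in> up \<longrightarrow> q i \<le> 0))"
    then obtain q where q: "\<And>x. x \<in> E \<Longrightarrow> 0 < (\<Sum>i\<le>n. q i * (\<sigma> x * x ^ i))"
      "\<And>i. i \<le> n \<Longrightarrow> i \<in> lo \<Longrightarrow> 0 \<le> q i" "\<And>i. i \<le> n \<Longrightarrow> i \<in> up \<Longrightarrow> q i \<le> 0" by blast
    define Q where "Q = (\<Sum>i\<le>n. monom (q i) i)"
    have Qc: "coeff Q i = q i" if "i \<le> n" for i using that by (simp add: Q_def coeff_sum)
    have "degree Q \<le> n" unfolding Q_def
      by (intro degree_sum_le) (auto intro: degree_monom_le[THEN order_trans])
    moreover have "sgn (f x - poly p x) * poly Q x = (\<Sum>i\<le>n. q i * (\<sigma> x * x ^ i))" for x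
      by (simp add: Q_def poly_sum poly_monom \<sigma>_def sum_distrib_left mult_ac)
    ultimately show False
      using q k by (intro descent_contradiction[OF K p _ Y(1) e best, of Q])
        (auto simp: E_def lo_def up_def Qc)
  qed
  obtain \<theta>0 where \<theta>0: "\<forall>x\<in>E. 0 \<le> \<theta>0 x" "sum \<theta>0 E = 1"
    "\<And>i. i \<le> n \<Longrightarrow> cone_part lo up i (\<Sum>x\<in>E. \<theta>0 x * (\<sigma> x * x ^ i)) = 0"
    by (rule finite_alternative[OF E(1) \<open>E \<noteq> {}\<close> infeasible]) blast
  obtain Z H \<theta> where Z: "Z \<subseteq> E" and H: "H \<subseteq> {..n}" "0 \<in> H" and card: "card Z = Suc (card H)"
    and \<theta>: "\<And>z. z \<in> Z \<Longrightarrow> 0 < \<theta> z" "sum \<theta> Z = 1"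
    and ann: "\<And>h. h \<in> H \<Longrightarrow> (\<Sum>z\<in>Z. \<theta> z * (\<sigma> z * z ^ h)) = 0"
    and cone: "\<And>i. i \<le> n \<Longrightarrow> cone_part lo up i (\<Sum>z\<in>Z. \<theta> z * (\<sigma> z * z ^ i)) = 0"
    by (rule minimal_certificate[OF E \<sigma>(1) free \<theta>0]) blast+
  define \<alpha> where "\<alpha> z = \<theta> z * \<sigma> z" for z
  have finZ: "finite Z" "Z \<subseteq> {0..1}" using Z E finite_subset by auto
  have ann': "(\<Sum>z\<in>Z. \<alpha> z * z ^ h) = 0" if "h \<in> H" for h
    using ann[OF that] by (simp add: \<alpha>_def mult.assoc)
  have abs\<alpha>: "\<bar>\<alpha> z\<bar> = \<theta> z" if "z \<in> Z" for z
    using \<sigma>(1)[of z] \<theta>(1)[OF that] that Z by (auto simp: \<alpha>_def abs_mult)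
  have spacing: "g \<le> \<bar>x - y\<bar>" if "x \<in> Z" "y \<in> Z" "x \<noteq> y" for x y
  proof (rule spacing_from_adjacent[OF finZ(1) _ that])
    fix z z' assume z: "z \<in> Z" "z' \<in> Z" "z < z'" and adj: "\<And>i. i \<in> Z \<Longrightarrow> \<not> (z < i \<and> i < z')"
    have "\<alpha> z \<noteq> 0" "\<alpha> z' \<noteq> 0" using abs\<alpha> \<theta>(1) z by fastforce+
    moreover have "Z \<subseteq> {0..}" using finZ by auto
    ultimately have "\<alpha> z * \<alpha> z' < 0"
      using annihilator_alternates[OF H finZ(1) _ card ann' z adj] by blast
    then have "(\<theta> z * \<theta> z') * (\<sigma> z * \<sigma> z') < 0" by (simp add: \<alpha>_def mult_ac)
    moreover have "0 < \<theta> z * \<theta> z'" using \<theta> z by simp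
    ultimately have neg: "\<sigma> z * \<sigma> z' < 0"
      by (meson mult_nonneg_nonneg not_less order_less_imp_le)
    have zE: "z \<in> E" "z' \<in> E" using z Z by auto
    have "\<sigma> z = - \<sigma> z'" using neg \<sigma>(1)[OF zE(1)] \<sigma>(1)[OF zE(2)]
      by (auto simp: abs_if mult_less_0_iff split: if_splits)
    moreover have "\<sigma> x * \<sigma> x = 1" if "x \<in> E" for x using \<sigma>(1)[OF that] by (metis abs_mult_self_eq mult_1)
    then have "f x - poly p x = \<sigma> x * e" if "x \<in> E" for x
      using \<sigma>(2)[OF that] that by (metis mult.assoc mult_1)
    ultimately have "\<bar>(f z - poly p z) - (f z' - poly p z')\<bar> = \<bar>2 * (\<sigma> z * e)\<bar>"
      using zE by (simp add: mult.commute)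
    also have "\<dots> = 2 * e" using \<sigma>(1)[OF zE(1)] e(1) by (simp add: abs_mult)
    finally have "\<not> \<bar>z - z'\<bar> < g" using osc[of z z'] zE by (auto simp: E_def)
    then show "g \<le> z' - z" using z by simp
  qed
  have degs: "degree p \<le> n" "degree p' \<le> n" using p p' by (auto simp: K constrained_polys_def)
  have "g ^ X * \<bar>poly (p' - p) y\<bar> \<le> (N_const n)\<^sup>2 * (real n + 2) * (real n + 1) * \<eta>"
  proof (rule strong_unicity_from_certificate[OF H finZ card g spacing ann' _ _ \<eta> _ _ X n y])
    show "(\<Sum>z\<in>Z. \<bar>\<alpha> z\<bar>) = 1" using abs\<alpha> \<theta>(2) by simp
    show "degree (p' - p) \<le> n" using degs by (intro degree_diff_le)
    show "- \<eta> * \<bar>\<alpha> z\<bar> \<le> \<alpha> z * poly (p' - p) z" if z: "z \<in> Z" for z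
    proof -
      have zE: "z \<in> E" "z \<in> Y" using z Z by (auto simp: E_def)
      have "\<sigma> z * (f z - poly p' z) \<le> \<bar>\<sigma> z * (f z - poly p' z)\<bar>" by simp
      also have "\<dots> \<le> e + \<eta>" using \<sigma>(1)[OF zE(1)] near[OF zE(2)] by (simp add: abs_mult)
      finally have "- \<eta> \<le> \<sigma> z * poly (p' - p) z" using \<sigma>(2)[OF zE(1)] by (simp add: algebra_simps)
      then have "\<theta> z * - \<eta> \<le> \<theta> z * (\<sigma> z * poly (p' - p) z)" using \<theta>(1)[OF z] by (intro mult_left_mono) auto
      then show ?thesis using abs\<alpha>[OF z] by (simp add: \<alpha>_def mult_ac)
    qed
    show "(\<Sum>z\<in>Z. \<alpha> z * z ^ l) * coeff (p' - p) l \<le> 0" if l: "l \<in> {..n} - H" for l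
    proof -
      define v where "v = (\<Sum>z\<in>Z. \<alpha> z * z ^ l)"
      have c: "cone_part lo up l v = 0" using cone[of l] l by (simp add: v_def \<alpha>_def mult.assoc)
      have c_lo: "0 \<le> coeff (p' - p) l" if "l \<in> lo"
      proof -
        from that obtain i where i: "i \<in> {1..m}" "a i = ereal (coeff p (k i))" "l = k i" by (auto simp: lo_def)
        then have "a i \<le> ereal (coeff p' (k i))" using p' unfolding K constrained_polys_def by blast
        then show ?thesis using i by simp
      qed
      have c_up: "coeff (p' - p) l \<le> 0" if "l \<in> up"
      proof -
        from that obtain i where i: "i \<in> {1..m}" "b i = ereal (coeff p (k i))" "l = k i" by (auto simp: up_def)
        then have "ereal (coeff p' (k i)) \<le> b i" using p' unfolding K constrained_polys_def by blast
        then show ?thesis using i by simp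
      qed
      have "v * coeff (p' - p) l \<le> 0"
        using c c_lo c_up
        by (auto simp: cone_part_def max_def min_def mult_le_0_iff split: if_splits)
      then show ?thesis by (simp add: v_def)
    qed
  qed
  then show ?thesis by simp
qed

section \<open>Existence of best approximations\<close>

text \<open>The set \<open>Y\<close> may be the unit interval as well as a finite grid. The coefficients of
  a minimizing sequence are bounded, since its values at \<open>n + 1\<close> points are, and the constraints
  are closed.\<close>

lemma best_approximation_exists:
  fixes f :: "real \<Rightarrow> real"
  assumes K: "K = constrained_polys n m k a b" and p0: "p0 \<in> K"
    and Y: "Y \<subseteq> {0..1}" and A: "A \<subseteq> Y" "finite A" "card A = Suc n"
    and f: "\<And>y. y \<in> Y \<Longrightarrow> \<bar>f y\<bar> \<le> C"
  obtains p e where "p \<in> K" "\<And>y. y \<in> Y \<Longrightarrow> \<bar>f y - poly p y\<bar> \<le> e"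
    "\<And>q B. q \<in> K \<Longrightarrow> (\<And>y. y \<in> Y \<Longrightarrow> \<bar>f y - poly q y\<bar> \<le> B) \<Longrightarrow> e \<le> B"
proof -
  define S where "S = {B. \<exists>q\<in>K. \<forall>y\<in>Y. \<bar>f y - poly q y\<bar> \<le> B}"
  have degK: "degree q \<le> n" if "q \<in> K" for q using that by (simp add: K constrained_polys_def)
  have poly_eq: "poly q y = (\<Sum>i\<le>n. coeff q i * y ^ i)" if "degree q \<le> n" for q and y :: real
    unfolding poly_altdef using that by (intro sum.mono_neutral_left) (auto simp: coeff_eq_0)
  obtain y0 where y0: "y0 \<in> Y" using A by force
  have "C + (\<Sum>i\<le>n. \<bar>coeff p0 i\<bar>) \<in> S"
  proof -
    have "\<bar>f y - poly p0 y\<bar> \<le> C + (\<Sum>i\<le>n. \<bar>coeff p0 i\<bar>)" if y: "y \<in> Y" for y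
    proof -
      have "\<bar>poly p0 y\<bar> \<le> (\<Sum>i\<le>n. \<bar>coeff p0 i * y ^ i\<bar>)" unfolding poly_eq[OF degK[OF p0]] by (rule sum_abs)
      also have "\<dots> \<le> (\<Sum>i\<le>n. \<bar>coeff p0 i\<bar>)"
        using y Y by (intro sum_mono) (auto simp: abs_mult power_abs intro!: mult_left_le power_le_one)
      finally show ?thesis using f[OF y] by linarith
    qed
    then show ?thesis using p0 by (auto simp: S_def)
  qed
  then have ne: "S \<noteq> {}" by auto
  have "0 \<le> B" if "B \<in> S" for B using that y0 abs_ge_zero order_trans by (fastforce simp: S_def)
  then have bb: "bdd_below S" by (auto intro: bdd_belowI[of _ 0])
  define e where "e = Inf S"
  have low: "e \<le> B" if "q \<in> K" "\<And>y. y \<in> Y \<Longrightarrow> \<bar>f y - poly q y\<bar> \<le> B" for q B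
    unfolding e_def using that bb by (intro cInf_lower) (auto simp: S_def)
  have "\<exists>q\<in>K. \<forall>y\<in>Y. \<bar>f y - poly q y\<bar> \<le> e + 1 / real (Suc j)" for j
  proof -
    obtain B where "B \<in> S" "B < e + 1 / real (Suc j)"
      using cInf_lessD[OF ne, of "e + 1 / real (Suc j)"] by (auto simp: e_def)
    then show ?thesis by (force simp: S_def)
  qed
  then obtain u where u: "\<And>j. u j \<in> K" "\<And>j y. y \<in> Y \<Longrightarrow> \<bar>f y - poly (u j) y\<bar> \<le> e + 1 / real (Suc j)"
    by metis
  have "A \<subseteq> {0..1}" using A Y by auto
  from coeff_bound_by_nodes[OF A(2) this A(3)]
  obtain D where D: "\<And>(q :: real poly) l. degree q \<le> n \<Longrightarrow> \<bar>coeff q l\<bar> \<le> D * (\<Sum>z\<in>A. \<bar>poly q z\<bar>)"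
    by blast
  have cbd: "\<exists>B. \<forall>j. \<bar>coeff (u j) i\<bar> \<le> B" for i
  proof (intro exI allI)
    fix j
    have "\<bar>poly (u j) z\<bar> \<le> C + e + 1" if z: "z \<in> A" for z
    proof -
      have "1 / real (Suc j) \<le> 1" "z \<in> Y" using z A by auto
      then show ?thesis using u(2)[of z j] f[of z] by linarith
    qed
    then have "(\<Sum>z\<in>A. \<bar>poly (u j) z\<bar>) \<le> (\<Sum>z\<in>A. C + e + 1)" by (rule sum_mono)
    then have "\<bar>D\<bar> * (\<Sum>z\<in>A. \<bar>poly (u j) z\<bar>) \<le> \<bar>D\<bar> * (\<Sum>z\<in>A. C + e + 1)" by (intro mult_left_mono) auto
    moreover have "D * (\<Sum>z\<in>A. \<bar>poly (u j) z\<bar>) \<le> \<bar>D\<bar> * (\<Sum>z\<in>A. \<bar>poly (u j) z\<bar>)"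
      by (intro mult_right_mono sum_nonneg) auto
    ultimately show "\<bar>coeff (u j) i\<bar> \<le> \<bar>D\<bar> * (\<Sum>z\<in>A. C + e + 1)"
      using D[OF degK[OF u(1)], of j i] by linarith
  qed
  obtain s l where s: "strict_mono (s :: nat \<Rightarrow> nat)" "\<forall>i\<in>{..n}. (\<lambda>j. coeff (u (s j)) i) \<longlonglongrightarrow> l i"
    using convergent_subsequence_finite[of "{..n}" "\<lambda>j i. coeff (u j) i"] cbd by blast
  define p where "p = (\<Sum>i\<le>n. monom (l i) i)"
  have degp: "degree p \<le> n" unfolding p_def
    by (intro degree_sum_le) (auto intro: degree_monom_le[THEN order_trans])
  have lim: "(\<lambda>j. coeff (u (s j)) i) \<longlonglongrightarrow> coeff p i" for i
  proof (cases "i \<le> n")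
    case True
    then show ?thesis using s(2) by (simp add: p_def coeff_sum)
  next
    case False
    then have "coeff (u (s j)) i = 0" "coeff p i = 0" for j
      using degK[OF u(1)[of "s j"]] degp by (auto intro!: coeff_eq_0)
    then show ?thesis by simp
  qed
  have "a i \<le> ereal (coeff p (k i)) \<and> ereal (coeff p (k i)) \<le> b i" if i: "i \<in> {1..m}" for i
  proof -
    have l: "(\<lambda>j. ereal (coeff (u (s j)) (k i))) \<longlonglongrightarrow> ereal (coeff p (k i))" using lim by simp
    have "a i \<le> ereal (coeff (u (s j)) (k i)) \<and> ereal (coeff (u (s j)) (k i)) \<le> b i" for j
      using u(1)[of "s j"] i by (auto simp: K constrained_polys_def)
    then show ?thesis using LIMSEQ_le_const[OF l, of "a i"] LIMSEQ_le_const2[OF l, of "b i"] by blast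
  qed
  then have "p \<in> K" using degp by (simp add: K constrained_polys_def)
  moreover have "\<bar>f y - poly p y\<bar> \<le> e" if y: "y \<in> Y" for y
  proof -
    have "(\<lambda>j. \<bar>f y - (\<Sum>i\<le>n. coeff (u (s j)) i * y ^ i)\<bar>) \<longlonglongrightarrow> \<bar>f y - (\<Sum>i\<le>n. coeff p i * y ^ i)\<bar>"
      by (intro tendsto_intros lim)
    then have "(\<lambda>j. \<bar>f y - poly (u (s j)) y\<bar>) \<longlonglongrightarrow> \<bar>f y - poly p y\<bar>"
      by (simp add: poly_eq[OF degK[OF u(1)]] poly_eq[OF degp])
    moreover have "(\<lambda>j. e + 1 / real (Suc (s j))) \<longlonglongrightarrow> e + 0"
      using LIMSEQ_subseq_LIMSEQ[OF LIMSEQ_inverse_real_of_nat s(1)]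
      by (intro tendsto_add tendsto_const) (simp add: o_def inverse_eq_divide)
    ultimately have "\<bar>f y - poly p y\<bar> \<le> e + 0" using u(2)[OF y] by (intro LIMSEQ_le) auto
    then show ?thesis by simp
  qed
  ultimately show thesis using low by (rule that)
qed

lemma supnorm_least: "(\<And>x. x \<in> {0..1} \<Longrightarrow> \<bar>g x\<bar> \<le> B) \<Longrightarrow> supnorm g \<le> B"
  unfolding supnorm_def by (intro cSUP_least) auto

lemma supnorm_upper:
  assumes "continuous_on {0..1} g" "x \<in> {0..1}"
  shows "\<bar>g x\<bar> \<le> supnorm g"
proof -
  have "compact ((\<lambda>x. \<bar>g x\<bar>) ` {0..1})"
    using assms by (intro compact_continuous_image continuous_intros) auto
  then show ?thesis
    unfolding supnorm_def using assms(2)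
    by (intro cSUP_upper) (auto dest: compact_imp_bounded bounded_imp_bdd_above)
qed

lemma modulus_imp_continuous:
  assumes "modulus_of_uniform_continuity \<omega> f"
  shows "continuous_on {0..1} f"
  unfolding continuous_on_iff
proof (intro ballI allI impI)
  fix x \<epsilon> :: real assume "x \<in> {0..1}" "0 < \<epsilon>"
  then have "0 < \<omega> \<epsilon> \<and> (\<forall>x'\<in>{0..1}. dist x' x < \<omega> \<epsilon> \<longrightarrow> dist (f x') (f x) < \<epsilon>)"
    using assms by (auto simp: modulus_of_uniform_continuity_def dist_real_def)
  then show "\<exists>d>0. \<forall>x'\<in>{0..1}. dist x' x < d \<longrightarrow> dist (f x') (f x) < \<epsilon>" by blast
qed

text \<open>The third bound is stated without division, in the form in which it controls the increment of a
  polynomial of norm at most \<open>M\<close>.\<close>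

lemma chi_bounds:
  assumes "0 < \<epsilon>" "0 \<le> M" "0 < \<omega> (\<epsilon> / 2)"
  shows "0 < chi \<omega> n M \<epsilon>" "chi \<omega> n M \<epsilon> \<le> 1"
    "chi \<omega> n M \<epsilon> * (4 * (real n)\<^sup>2 * M + 1) \<le> \<epsilon>" "chi \<omega> n M \<epsilon> \<le> \<omega> (\<epsilon> / 2)"
proof -
  have pos: "0 < 4 * (real n)\<^sup>2 * M + 1" using assms by (simp add: add_nonneg_pos)
  then show "0 < chi \<omega> n M \<epsilon>" using assms by (simp add: chi_def)
  show "chi \<omega> n M \<epsilon> \<le> 1" "chi \<omega> n M \<epsilon> \<le> \<omega> (\<epsilon> / 2)" by (simp_all add: chi_def)
  have "chi \<omega> n M \<epsilon> \<le> \<epsilon> / (4 * (real n)\<^sup>2 * M + 1)" by (simp add: chi_def)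
  then show "chi \<omega> n M \<epsilon> * (4 * (real n)\<^sup>2 * M + 1) \<le> \<epsilon>" using pos by (simp add: pos_le_divide_eq)
qed

lemma F_const_ge: "3 / 2 \<le> F_const n"
proof -
  have "(2 * (real n)\<^sup>2) ^ 0 / fact 0 \<le> Max ((\<lambda>i. (2 * (real n)\<^sup>2) ^ i / fact i) ` {0..n})"
    by (rule Max_ge[OF _ imageI]) auto
  then show ?thesis by (simp add: F_const_def)
qed

lemma unit_grid_near:
  assumes "0 < N" "x \<in> {0..1}"
  shows "\<exists>y\<in>(\<lambda>i. real i / real N) ` {..N}. \<bar>x - y\<bar> \<le> 1 / real N"
proof -
  define i where "i = nat \<lfloor>x * real N\<rfloor>"
  have x: "0 \<le> x * real N" "x * real N \<le> real N" using assms by (auto simp: mult_left_le_one_le)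
  have i: "real i \<le> x * real N" "x * real N < real i + 1" using x by (auto simp: i_def of_nat_nat)
  have "i \<le> N" using i x by linarith
  moreover have "\<bar>x - real i / real N\<bar> \<le> 1 / real N"
  proof -
    have "x - real i / real N = (x * real N - real i) / real N" using assms by (simp add: field_simps)
    moreover have "\<bar>x * real N - real i\<bar> \<le> 1" using i by auto
    ultimately show ?thesis using assms by (simp add: abs_divide divide_right_mono)
  qed
  ultimately show ?thesis by auto
qed

section \<open>From the grid to the unit interval\<close>

text \<open>For \<open>n = 0\<close> the certificate consists of two points and the exponent of \<open>chi\<close> is \<open>0\<close>, so that the
  general estimate, which loses a power of the spacing, does not apply. Instead, the mean of two
  nearly optimal constants improves on their common error bound by half of their distance.\<close>

lemma close_best_constants:
  fixes f :: "real \<Rightarrow> real"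
  assumes best: "\<And>c. E \<le> supnorm (\<lambda>x. f x - c)" and cont: "continuous_on {0..1} f"
    and near: "supnorm (\<lambda>x. f x - c1) \<le> E + \<eta>" "supnorm (\<lambda>x. f x - c2) \<le> E + \<eta>"
  shows "\<bar>c1 - c2\<bar> \<le> 2 * \<eta>"
proof -
  have key: "\<bar>(u + v) / 2\<bar> + \<bar>u - v\<bar> / 2 \<le> B" if "\<bar>u\<bar> \<le> B" "\<bar>v\<bar> \<le> B" for u v B :: real
    using that by (auto simp: abs_if field_simps split: if_splits)
  have "\<bar>f x - (c1 + c2) / 2\<bar> \<le> E + \<eta> - \<bar>c1 - c2\<bar> / 2" if x: "x \<in> {0..1}" for x
  proof -
    have "\<bar>f x - c\<bar> \<le> supnorm (\<lambda>x. f x - c)" for c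
      using cont x by (intro supnorm_upper continuous_intros)
    from this[of c1] this[of c2] near have "\<bar>f x - c1\<bar> \<le> E + \<eta>" "\<bar>f x - c2\<bar> \<le> E + \<eta>" by auto
    from key[OF this] show ?thesis by (simp add: field_simps abs_minus_commute)
  qed
  then have "supnorm (\<lambda>x. f x - (c1 + c2) / 2) \<le> E + \<eta> - \<bar>c1 - c2\<bar> / 2" by (rule supnorm_least)
  with best[of "(c1 + c2) / 2"] show ?thesis by simp
qed

lemma grid_mesh_exists:
  fixes a b c :: real
  assumes "0 < a"
  obtains N :: nat where "n \<le> N" "0 < N" "1 / real N < a" "b / real N \<le> 1 / 5" "c / real N < a"
proof -
  have lim: "(\<lambda>N. x / real N) \<longlonglongrightarrow> 0" for x :: real by (rule lim_const_over_n)
  have "\<forall>\<^sub>F N in sequentially. n \<le> N \<and> 0 < N \<and> 1 / real N < a \<and> b / real N < 1 / 5 \<and> c / real N < a"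
    using assms by (intro eventually_conj eventually_ge_at_top eventually_gt_at_top
        order_tendstoD(2)[OF lim]) auto
  then show thesis using that by (auto simp: eventually_sequentially)
qed

text \<open>The polynomial \<open>p\<close> is a best approximation on a grid so fine that passing from the grid to the
  interval costs at most \<open>\<epsilon>\<close>. It depends on the grid, but the constant in the conclusion does not,
  so that \<open>\<epsilon>\<close> can tend to \<open>0\<close> afterwards.\<close>

lemma strong_unicity_perturbed:
  fixes f :: "real \<Rightarrow> real" and p0 :: "real poly"
  assumes K: "K = constrained_polys n m k a b" and k: "\<forall>i\<in>{1..m}. 0 < k i \<and> k i \<le> n"
    and p0: "p0 \<in> K" and mod: "modulus_of_uniform_continuity \<omega> f"
    and M: "M = 5 / 2 * supnorm f + 3 / 2 * supnorm (poly p0)"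
    and ps: "ps \<in> K" "supnorm (\<lambda>x. f x - poly ps x) = E"
    and best: "\<And>q. q \<in> K \<Longrightarrow> E \<le> supnorm (\<lambda>x. f x - poly q x)"
    and L: "0 < L" "L \<le> E" and n: "1 \<le> n" and \<epsilon>: "0 < \<epsilon>" "\<epsilon> \<le> L / 2" and \<eta>: "0 \<le> \<eta>"
  obtains p where "\<And>q x. q \<in> K \<Longrightarrow> supnorm (\<lambda>x. f x - poly q x) \<le> E + \<eta> \<Longrightarrow> x \<in> {0..1} \<Longrightarrow>
     (chi \<omega> n M (L / 2) / 2) ^ ((n * n + 4 * n) div 2) * \<bar>poly q x - poly p x\<bar>
       \<le> (N_const n)\<^sup>2 * (real n + 2) * (real n + 1) * (\<eta> + \<epsilon>)"
proof -
  have cont: "continuous_on {0..1} f" using mod by (rule modulus_imp_continuous)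
  have cpoly: "continuous_on {0..1} (poly q)" for q :: "real poly" by (intro continuous_intros)
  have cdiff: "continuous_on {0..1} (\<lambda>x. f x - poly q x)" for q by (intro continuous_intros cont)
  have fx: "\<bar>f x\<bar> \<le> supnorm f" if "x \<in> {0..1}" for x using cont that by (rule supnorm_upper)
  have f0: "0 \<le> supnorm f" using fx[of 0] by simp
  have p00: "0 \<le> supnorm (poly p0)" using supnorm_upper[OF cpoly, of 0 p0] by simp
  have M0: "0 \<le> M" using f0 p00 by (simp add: M)
  have \<omega>: "0 < \<omega> t" if "0 < t" for t using mod that by (simp add: modulus_of_uniform_continuity_def)
  have f\<omega>: "\<bar>f x - f y\<bar> < t" if "0 < t" "x \<in> {0..1}" "y \<in> {0..1}" "\<bar>x - y\<bar> < \<omega> t" for x y t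
    using mod that by (simp add: modulus_of_uniform_continuity_def)
  have EL: "E \<le> supnorm f + supnorm (poly p0)"
  proof -
    have "supnorm (\<lambda>x. f x - poly p0 x) \<le> supnorm f + supnorm (poly p0)"
    proof (rule supnorm_least)
      fix x :: real assume "x \<in> {0..1}"
      then show "\<bar>f x - poly p0 x\<bar> \<le> supnorm f + supnorm (poly p0)"
        using fx supnorm_upper[OF cpoly, of x p0] abs_triangle_ineq4[of "f x" "poly p0 x"] by fastforce
    qed
    with best[OF p0] show ?thesis by simp
  qed
  define D where "D = 4 * (real n)\<^sup>2"
  have D0: "0 \<le> D" by (simp add: D_def)
  obtain N where N: "n \<le> N" "0 < N" "1 / real N < min (\<epsilon> / 2) (\<omega> (\<epsilon> / 2))" "D / real N \<le> 1 / 5"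
    "D * M / real N < min (\<epsilon> / 2) (\<omega> (\<epsilon> / 2))"
    by (rule grid_mesh_exists[of "min (\<epsilon> / 2) (\<omega> (\<epsilon> / 2))" n D "D * M"]) (use \<epsilon> \<omega>[of "\<epsilon> / 2"] in auto)
  define Y where "Y = (\<lambda>i. real i / real N) ` {..N}"
  have Y: "finite Y" "Y \<subseteq> {0..1}" using N by (auto simp: Y_def)
  have inj: "inj_on (\<lambda>i. real i / real N) {..N}" using N by (auto simp: inj_on_def)
  define A where "A = (\<lambda>i. real i / real N) ` {..n}"
  have A: "A \<subseteq> Y" "finite A" "card A = Suc n"
    using N card_image[OF inj_on_subset[OF inj, of "{..n}"]] by (auto simp: A_def Y_def)
  have mesh: "\<exists>y\<in>Y. \<bar>x - y\<bar> \<le> 1 / real N" if "x \<in> {0..1}" for x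
    unfolding Y_def using N(2) that by (rule unit_grid_near)
  obtain p e where p: "p \<in> K" and pe: "\<And>y. y \<in> Y \<Longrightarrow> \<bar>f y - poly p y\<bar> \<le> e"
    and emin: "\<And>q B. q \<in> K \<Longrightarrow> (\<And>y. y \<in> Y \<Longrightarrow> \<bar>f y - poly q y\<bar> \<le> B) \<Longrightarrow> e \<le> B"
    by (rule best_approximation_exists[OF K p0 Y(2) A, of f "supnorm f"]) (use Y fx in auto)
  have degp: "degree p \<le> n" using p by (simp add: K constrained_polys_def)
  have eE: "e \<le> E"
  proof (rule emin[OF ps(1)])
    show "\<bar>f y - poly ps y\<bar> \<le> E" if "y \<in> Y" for y
      using supnorm_upper[OF cdiff, of y ps] that Y ps(2) by auto
  qed
  have px: "\<bar>poly p x\<bar> \<le> supnorm (poly p)" if "x \<in> {0..1}" for x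
    using supnorm_upper[OF cpoly that] by simp
  have lip: "\<bar>poly p x - poly p y\<bar> \<le> D * supnorm (poly p) * \<bar>x - y\<bar>" if "x \<in> {0..1}" "y \<in> {0..1}" for x y
    unfolding D_def using degp px that by (rule poly_lipschitz_unit_interval)
  have s0: "0 \<le> supnorm (poly p)" using px[of 0] by simp
  have lipN: "\<bar>poly p x - poly p y\<bar> \<le> supnorm (poly p) * (D / real N)"
    if "x \<in> {0..1}" "y \<in> {0..1}" "\<bar>x - y\<bar> \<le> 1 / real N" for x y
  proof -
    have "D * supnorm (poly p) * \<bar>x - y\<bar> \<le> D * supnorm (poly p) * (1 / real N)"
      using that D0 s0 by (intro mult_left_mono) auto
    then show ?thesis using lip[OF that(1,2)] by (simp add: mult_ac)
  qed
  (* the slack between 2 and 5/2, and between 1 and 3/2, in M absorbs the factor 5/4 lost here *)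
  have pM: "supnorm (poly p) \<le> M"
  proof -
    have "supnorm (poly p) \<le> supnorm f + E + supnorm (poly p) * (1 / 5)"
    proof (rule supnorm_least)
      fix x :: real assume x: "x \<in> {0..1}"
      obtain y where y: "y \<in> Y" "\<bar>x - y\<bar> \<le> 1 / real N" using mesh[OF x] by blast
      then have y01: "y \<in> {0..1}" using Y by auto
      have "\<bar>poly p x - poly p y\<bar> \<le> supnorm (poly p) * (D / real N)" using lipN x y01 y by blast
      also have "\<dots> \<le> supnorm (poly p) * (1 / 5)" using s0 N(4) by (intro mult_left_mono)
      finally show "\<bar>poly p x\<bar> \<le> supnorm f + E + supnorm (poly p) * (1 / 5)"
        using pe[OF y(1)] fx[OF y01] eE by linarith
    qed
    then show ?thesis using EL f0 p00 unfolding M by linarith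
  qed
  have Ee: "E \<le> e + \<epsilon>"
  proof -
    have "supnorm (\<lambda>x. f x - poly p x) \<le> e + \<epsilon>"
    proof (rule supnorm_least)
      fix x :: real assume x: "x \<in> {0..1}"
      obtain y where y: "y \<in> Y" "\<bar>x - y\<bar> \<le> 1 / real N" using mesh[OF x] by blast
      then have y01: "y \<in> {0..1}" using Y by auto
      have "\<bar>f x - f y\<bar> < \<epsilon> / 2" using y(2) N(3) \<epsilon> x y01 by (intro f\<omega>) auto
      moreover have "\<bar>poly p x - poly p y\<bar> \<le> \<epsilon> / 2"
      proof -
        have "\<bar>poly p x - poly p y\<bar> \<le> supnorm (poly p) * (D / real N)" using lipN x y01 y by blast
        also have "\<dots> \<le> M * (D / real N)" using pM D0 by (intro mult_right_mono) auto
        also have "\<dots> \<le> \<epsilon> / 2" using N(5) by (simp add: mult.commute)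
        finally show ?thesis .
      qed
      ultimately show "\<bar>f x - poly p x\<bar> \<le> e + \<epsilon>" using pe[OF y(1)] by linarith
    qed
    with best[OF p] show ?thesis by simp
  qed
  have e: "L / 2 \<le> e" "0 < e" using Ee L \<epsilon> by auto
  define c where "c = chi \<omega> n M (L / 2)"
  have c: "0 < c" "c \<le> 1" "c * (D * M + 1) \<le> L / 2" "c \<le> \<omega> (L / 4)"
    using chi_bounds[of "L / 2" M \<omega> n] L M0 \<omega>[of "L / 4"] by (auto simp: c_def D_def)
  have grid_best: "\<exists>y\<in>Y. e \<le> \<bar>f y - poly q y\<bar>" if q: "q \<in> K" for q
  proof (rule ccontr)
    assume "\<not> ?thesis"
    then have lt: "\<forall>y\<in>Y. \<bar>f y - poly q y\<bar> < e" by auto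
    have ne: "(\<lambda>y. \<bar>f y - poly q y\<bar>) ` Y \<noteq> {}" "finite ((\<lambda>y. \<bar>f y - poly q y\<bar>) ` Y)" using Y by (auto simp: Y_def)
    have "e \<le> Max ((\<lambda>y. \<bar>f y - poly q y\<bar>) ` Y)" using ne by (intro emin[OF q]) auto
    moreover have "Max ((\<lambda>y. \<bar>f y - poly q y\<bar>) ` Y) < e" using ne lt by (subst Max_less_iff) auto
    ultimately show False by simp
  qed
  (* L / 4 from f and L / 2 from p, together less than L *)
  have osc: "\<bar>(f x - poly p x) - (f y - poly p y)\<bar> < 2 * e"
    if "x \<in> Y" "y \<in> Y" "\<bar>x - y\<bar> < c / 2" for x y
  proof -
    have xy: "x \<in> {0..1}" "y \<in> {0..1}" using that Y by auto
    have "\<bar>f x - f y\<bar> < L / 4" using that(3) c L xy by (intro f\<omega>) auto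
    moreover have "\<bar>poly p x - poly p y\<bar> \<le> L / 2"
    proof -
      have "\<bar>poly p x - poly p y\<bar> \<le> D * supnorm (poly p) * \<bar>x - y\<bar>" by (rule lip[OF xy])
      also have "\<dots> \<le> D * M * c" using that(3) c D0 pM M0 s0 by (intro mult_mono) auto
      also have "\<dots> \<le> L / 2" using c(1,3) by (simp add: algebra_simps)
      finally show ?thesis .
    qed
    ultimately show ?thesis using e(1) L by linarith
  qed
  show thesis
  proof (rule that[of p])
    fix q :: "real poly" and x :: real
    assume q: "q \<in> K" and near: "supnorm (\<lambda>x. f x - poly q x) \<le> E + \<eta>" and x: "x \<in> {0..1}"
    have "\<bar>f y - poly q y\<bar> \<le> e + (\<eta> + \<epsilon>)" if "y \<in> Y" for y
      using supnorm_upper[OF cdiff, of y q] that Y near Ee by fastforce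
    then show "(chi \<omega> n M (L / 2) / 2) ^ ((n * n + 4 * n) div 2) * \<bar>poly q x - poly p x\<bar>
       \<le> (N_const n)\<^sup>2 * (real n + 2) * (real n + 1) * (\<eta> + \<epsilon>)"
      using \<eta> \<epsilon> c
      by (intro strong_unicity_on_grid[OF K k p q Y e(2) pe grid_best _ _ _ _ osc refl n x])
        (auto simp: c_def)
  qed
qed

theorem theorem3p10:
  fixes n m :: nat and k :: "nat \<Rightarrow> nat" and a b :: "nat \<Rightarrow> ereal"
    and K :: "real poly set" and p0 p1 p2 :: "real poly"
    and f \<omega> :: "real \<Rightarrow> real" and M E \<delta> L :: real
  assumes "m \<le> n"
    and "strict_mono_on {1..m} k"
    and "\<forall>i\<in>{1..m}. 0 < k i \<and> k i \<le> n"
    and "\<forall>i\<in>{1..m}. a i \<le> b i \<and> a i \<noteq> \<infinity> \<and> b i \<noteq> -\<infinity>"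
    and "K = constrained_polys n m k a b"
    and "p0 \<in> K"
    and "modulus_of_uniform_continuity \<omega> f"
    and "M = 5 / 2 * supnorm f + 3 / 2 * supnorm (poly p0)"
    and "E = (LEAST e. e \<in> (\<lambda>q. supnorm (\<lambda>x. f x - poly q x)) ` K)"
    and "\<delta> \<ge> 0"
    and "0 < L" and "L \<le> E"
    and "p1 \<in> K" and "p2 \<in> K"
    and "\<forall>p\<in>{p1, p2}. supnorm (\<lambda>x. f x - poly p x)
           \<le> E + (chi \<omega> n M (L / 2) / 2) powr ((real n)\<^sup>2 / 2 + 2 * real n)
                 / (10 * (N_const n)\<^sup>2 * (real n + 1) * (real n * F_const n + 1)) * \<delta>"
  shows "supnorm (\<lambda>x. poly p1 x - poly p2 x) \<le> \<delta>"
proof -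
  note K = assms(5) and k = assms(3) and mod = assms(7)
  have cont: "continuous_on {0..1} f" using mod by (rule modulus_imp_continuous)
  have cdiff: "continuous_on {0..1} (\<lambda>x. f x - poly q x)" for q by (intro continuous_intros cont)
  have fx: "\<bar>f x\<bar> \<le> supnorm f" if "x \<in> {0..1}" for x using cont that by (rule supnorm_upper)
  have "\<exists>A :: real set. A \<subseteq> {0..1} \<and> finite A \<and> card A = Suc n"
    using infinite_arbitrarily_large[of "{0..1::real}" "Suc n"] by (auto simp: infinite_Icc)
  then obtain A :: "real set" where A: "A \<subseteq> {0..1}" "finite A" "card A = Suc n" by blast
  obtain ps e where ps: "ps \<in> K" "\<And>y. y \<in> {0..1} \<Longrightarrow> \<bar>f y - poly ps y\<bar> \<le> e"
    and emin: "\<And>q B. q \<in> K \<Longrightarrow> (\<And>y. y \<in> {0..1} \<Longrightarrow> \<bar>f y - poly q y\<bar> \<le> B) \<Longrightarrow> e \<le> B"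
    by (rule best_approximation_exists[OF K assms(6) order_refl A, of f "supnorm f"]) (use fx in auto)
  have e_le: "e \<le> supnorm (\<lambda>x. f x - poly q x)" if "q \<in> K" for q
    by (rule emin[OF that]) (rule supnorm_upper[OF cdiff])
  have e_eq: "supnorm (\<lambda>x. f x - poly ps x) = e"
    using e_le[OF ps(1)] supnorm_least[of "\<lambda>x. f x - poly ps x" e] ps(2) by force
  have Ee: "E = e"
    unfolding assms(9) by (rule Least_equality) (use ps e_eq e_le in auto)
  define N where "N = N_const n"
  define F where "F = F_const n"
  define g where "g = chi \<omega> n M (L / 2) / 2"
  define W where "W = (real n)\<^sup>2 / 2 + 2 * real n"
  define \<eta> where "\<eta> = g powr W / (10 * N\<^sup>2 * (real n + 1) * (real n * F + 1)) * \<delta>"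
  have N1: "1 \<le> N" unfolding N_def by (rule N_const_ge_1)
  have F1: "3 / 2 \<le> F" unfolding F_def by (rule F_const_ge)
  have "0 \<le> supnorm f" using fx[of 0] by simp
  moreover have "0 \<le> supnorm (poly p0)"
    using supnorm_upper[of "poly p0" 0] by (simp add: continuous_intros)
  ultimately have M0: "0 \<le> M" by (simp add: assms(8))
  have "0 < \<omega> (L / 2 / 2)" using mod assms(11) by (simp add: modulus_of_uniform_continuity_def)
  then have g: "0 < g" "g \<le> 1"
    using chi_bounds(1,2)[of "L / 2" M \<omega> n] M0 assms(11) by (auto simp: g_def)
  have nF: "0 \<le> real n * F" using F1 by simp
  have den: "0 < 10 * N\<^sup>2 * (real n + 1) * (real n * F + 1)"
    using N1 nF by (intro mult_pos_pos) auto
  have \<eta>0: "0 \<le> \<eta>" using den assms(10) by (simp add: \<eta>_def)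
  have near: "supnorm (\<lambda>x. f x - poly p1 x) \<le> E + \<eta>" "supnorm (\<lambda>x. f x - poly p2 x) \<le> E + \<eta>"
    using assms(15) by (simp_all add: \<eta>_def N_def F_def g_def W_def)
  show ?thesis
  proof (cases "n = 0")
    case True
    have K0: "K = {p. degree p = 0}"
      using assms(1) True by (auto simp: K constrained_polys_def)
    obtain c1 c2 where c: "p1 = [:c1:]" "p2 = [:c2:]"
      using assms(13,14) by (auto simp: K0 elim!: degree_eq_zeroE)
    have "E \<le> supnorm (\<lambda>x. f x - c)" for c
      using e_le[of "[:c:]"] by (simp add: K0 Ee)
    then have "\<bar>c1 - c2\<bar> \<le> 2 * \<eta>"
      using near by (intro close_best_constants[OF _ cont]) (auto simp: c)
    also have "2 * \<eta> = \<delta> / (5 * N\<^sup>2)" using True g by (simp add: \<eta>_def W_def)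
    also have "\<dots> \<le> \<delta> / 1"
    proof (rule divide_left_mono)
      have "1 \<le> N\<^sup>2" by (rule one_le_power[OF N1])
      then show "1 \<le> 5 * N\<^sup>2" "0 < 5 * N\<^sup>2 * 1" by linarith+
    qed (rule assms(10))
    finally show ?thesis by (intro supnorm_least) (simp add: c)
  next
    case False
    then have n: "1 \<le> n" by simp
    define X where "X = (n * n + 4 * n) div 2"
    define C where "C = N\<^sup>2 * (real n + 2) * (real n + 1)"
    have C0: "0 \<le> C" by (simp add: C_def)
    show ?thesis
    proof (rule supnorm_least)
      fix x :: real assume x: "x \<in> {0..1}"
      have "g ^ X * \<bar>poly p1 x - poly p2 x\<bar> \<le> 2 * C * \<eta> + t" if t: "0 < t" for t
      proof -
        (* eps is chosen so that its contribution 2 * C * eps is at most t *)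
        define \<epsilon> where "\<epsilon> = min (L / 2) (t / (2 * C + 1))"
        have "0 < t / (2 * C + 1)" using t C0 by (intro divide_pos_pos) auto
        then have \<epsilon>: "0 < \<epsilon>" "\<epsilon> \<le> L / 2" "\<epsilon> \<le> t / (2 * C + 1)"
          using assms(11) unfolding \<epsilon>_def by linarith+
        obtain p where p: "\<And>q x. q \<in> K \<Longrightarrow> supnorm (\<lambda>x. f x - poly q x) \<le> E + \<eta> \<Longrightarrow> x \<in> {0..1} \<Longrightarrow>
           g ^ X * \<bar>poly q x - poly p x\<bar> \<le> C * (\<eta> + \<epsilon>)"
          unfolding g_def X_def C_def N_def
          by (rule strong_unicity_perturbed[OF K k assms(6) mod assms(8) ps(1) _ _ assms(11,12) n \<epsilon>(1,2) \<eta>0])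
            (use e_eq e_le Ee in auto)
        have "\<bar>poly p1 x - poly p2 x\<bar> \<le> \<bar>poly p1 x - poly p x\<bar> + \<bar>poly p2 x - poly p x\<bar>" by linarith
        then have "g ^ X * \<bar>poly p1 x - poly p2 x\<bar>
            \<le> g ^ X * \<bar>poly p1 x - poly p x\<bar> + g ^ X * \<bar>poly p2 x - poly p x\<bar>"
          using g by (simp flip: distrib_left)
        also have "\<dots> \<le> C * (\<eta> + \<epsilon>) + C * (\<eta> + \<epsilon>)"
          by (intro add_mono p assms(13,14) near x)
        also have "\<dots> = 2 * C * \<eta> + 2 * C * \<epsilon>" by (simp add: algebra_simps)
        also have "2 * C * \<epsilon> \<le> t"
        proof -
          have "\<epsilon> * (2 * C + 1) \<le> t" using \<epsilon>(3) C0 by (simp add: pos_le_divide_eq)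
          then show ?thesis using \<epsilon>(1) by (simp add: algebra_simps)
        qed
        finally show ?thesis by simp
      qed
      then have "g ^ X * \<bar>poly p1 x - poly p2 x\<bar> \<le> 2 * C * \<eta>" by (rule field_le_epsilon)
      (* the factor n + 2 is absorbed by 5 * (n * F + 1) *)
      also have "\<dots> \<le> g ^ X * \<delta>"
      proof -
        have "real X \<le> W"
        proof -
          have "2 * X \<le> n * n + 4 * n" by (simp add: X_def)
          then have "real (2 * X) \<le> real (n * n + 4 * n)" by (rule of_nat_mono)
          then show ?thesis by (simp add: W_def power2_eq_square)
        qed
        then have gW: "g powr W \<le> g ^ X"
          using g powr_mono'[of "real X" W g] by (simp add: powr_realpow)
        have "real n * (3 / 2) \<le> real n * F" using F1 by (intro mult_left_mono) auto
        moreover have "r + 2 \<le> 5 * (s + 1)" if "r * (3 / 2) \<le> s" "0 \<le> r" for r s :: real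
          using that by (simp add: algebra_simps)
        ultimately have five: "real n + 2 \<le> 5 * (real n * F + 1)" by simp
        have "2 * C * \<eta> = (real n + 2) / (5 * (real n * F + 1)) * (g powr W * \<delta>)"
          using N1 nF by (simp add: C_def \<eta>_def divide_simps)
        also have "\<dots> \<le> 1 * (g powr W * \<delta>)"
          using five nF assms(10) by (intro mult_right_mono) (auto simp: pos_divide_le_eq)
        also have "\<dots> \<le> g ^ X * \<delta>" using gW assms(10) by (simp add: mult_right_mono)
        finally show ?thesis .
      qed
      finally show "\<bar>poly p1 x - poly p2 x\<bar> \<le> \<delta>" using g by simp
    qed
  qed
qed

end
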